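(* Let $I$ be a monomial ideal in a polynomial ring in the variables $x_1,\dots,x_n$ and let $p\ge 2$ be a prime number. Then for every integer $i\ge 0$ there exists $h_i\ge 1$ such that either $\beta_i^{\mathbb{Z}_p}(I^h)=\beta_i^{\mathbb{Q}}(I^h)$ for every $h\ge h_i$, or $\beta_i^{\mathbb{Z}_p}(I^h)\ne\beta_i^{\mathbb{Q}}(I^h)$ for every $h\ge h_i$.
   Context: A monomial ideal $I$ has a unique minimal system $G(I)$ of monic monomial generators, which makes sense over every coefficient field. For a field $k$, $\beta_i^k(I)=\dim_k \mathrm{Tor}_i^R(I,k)$, with $R=k[x_1,\dots,x_n]$, denotes the $i$-th (total) Betti number of the ideal generated by $G(I)$ in $R$ (the Betti numbers are those of the ideal $I$ as a module, not of $R/I$). Powers $I^h$ are treated in the same way. $\mathbb{Z}_p$ denotes the field with $p$ elements. *)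

theory Defs
  imports Complex_Main "HOL-Library.Poly_Mapping" "HOL-Library.Cardinality"
    "HOL-Computational_Algebra.Primes"
begin

text \<open>
  The free \<open>R\<close>-module on a set \<open>B\<close> consists of the finitely supported functions
  \<open>'b \<Rightarrow>\<^sub>0 'r\<close> with support in \<open>B\<close>.
\<close>

definition free_scale :: "'r::comm_ring_1 \<Rightarrow> ('b \<Rightarrow>\<^sub>0 'r) \<Rightarrow> ('b \<Rightarrow>\<^sub>0 'r)"
  where "free_scale a = Poly_Mapping.map ((*) a)"

definition free_on :: "'b set \<Rightarrow> ('b \<Rightarrow>\<^sub>0 'r::comm_ring_1) set"
  where "free_on B = {u. Poly_Mapping.keys u \<subseteq> B}"

lemma lookup_free_scale: "Poly_Mapping.lookup (free_scale a u) b = a * Poly_Mapping.lookup u b"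
  by (simp add: free_scale_def Poly_Mapping.map.rep_eq when_def)

lemma module_free_scale: "module (free_scale :: 'r::comm_ring_1 \<Rightarrow> ('b \<Rightarrow>\<^sub>0 'r) \<Rightarrow> _)"
  by unfold_locales
    (auto intro!: poly_mapping_eqI simp: lookup_free_scale lookup_add algebra_simps)

text \<open>
  A module is given by a scalar multiplication on a type together with a submodule of that type.
  A free resolution
  \<open>\<dots> \<rightarrow> F 2 \<rightarrow> F 1 \<rightarrow> F 0 \<rightarrow> M \<rightarrow> 0\<close> has \<open>F i = free_on (B i)\<close>,
  augmentation \<open>e : F 0 \<rightarrow> M\<close> and differentials \<open>d i : F (i + 1) \<rightarrow> F i\<close>. Homomorphisms out of
  \<open>F i\<close> are represented by homomorphisms defined on all of \<open>nat \<Rightarrow>\<^sub>0 'r\<close>; since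
  \<open>F i\<close> is a direct summand, each of them extends. Bases are sets of natural numbers, which
  suffices for finitely generated modules over Noetherian rings.
\<close>

definition free_resolution ::
    "('r::comm_ring_1 \<Rightarrow> 'm::ab_group_add \<Rightarrow> 'm) \<Rightarrow> 'm set \<Rightarrow> (nat \<Rightarrow> nat set) \<Rightarrow>
     (nat \<Rightarrow> (nat \<Rightarrow>\<^sub>0 'r) \<Rightarrow> (nat \<Rightarrow>\<^sub>0 'r)) \<Rightarrow> ((nat \<Rightarrow>\<^sub>0 'r) \<Rightarrow> 'm) \<Rightarrow> bool"
  where "free_resolution sM M B d e \<longleftrightarrow>
    module_hom free_scale sM e \<and>
    (\<forall>i. module_hom free_scale free_scale (d i)) \<and>
    e ` free_on (B 0) = M \<and>
    d 0 ` free_on (B 1) = {u \<in> free_on (B 0). e u = 0} \<and>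
    (\<forall>i. d (Suc i) ` free_on (B (Suc (Suc i))) = {u \<in> free_on (B (Suc i)). d i u = 0})"

text \<open>
  The tensor product of \<open>M\<close> and \<open>N\<close> is the quotient of \<open>free_on (M \<times> N)\<close> by the
  submodule \<open>tensor_rel sM M sN N\<close> spanned by the bilinearity relations. Quotient modules are
  always handled as pairs of a module and a submodule.
\<close>

definition tensor_rel ::
    "('r::comm_ring_1 \<Rightarrow> 'm::ab_group_add \<Rightarrow> 'm) \<Rightarrow> 'm set \<Rightarrow>
     ('r \<Rightarrow> 'n::ab_group_add \<Rightarrow> 'n) \<Rightarrow> 'n set \<Rightarrow> ('m \<times> 'n \<Rightarrow>\<^sub>0 'r) set"
  where "tensor_rel sM M sN N = module.span free_scale
    ({Poly_Mapping.single (x + x', y) 1 - Poly_Mapping.single (x, y) 1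
        - Poly_Mapping.single (x', y) 1 | x x' y. x \<in> M \<and> x' \<in> M \<and> y \<in> N}
   \<union> {Poly_Mapping.single (x, y + y') 1 - Poly_Mapping.single (x, y) 1
        - Poly_Mapping.single (x, y') 1 | x y y'. x \<in> M \<and> y \<in> N \<and> y' \<in> N}
   \<union> {Poly_Mapping.single (sM a x, y) 1 - free_scale a (Poly_Mapping.single (x, y) 1)
        | a x y. x \<in> M \<and> y \<in> N}
   \<union> {Poly_Mapping.single (x, sN a y) 1 - free_scale a (Poly_Mapping.single (x, y) 1)
        | a x y. x \<in> M \<and> y \<in> N})"

text \<open>The linear map sending the generator \<open>(x, y)\<close> to \<open>(f x, y)\<close>; it induces \<open>f \<otimes> id\<close>.\<close>

definition tensor_map :: "('m \<Rightarrow> 'l) \<Rightarrow> ('m \<times> 'n \<Rightarrow>\<^sub>0 'r::comm_ring_1) \<Rightarrow> ('l \<times> 'n \<Rightarrow>\<^sub>0 'r)"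
  where "tensor_map f u =
    (\<Sum>(x, y)\<in>Poly_Mapping.keys u. Poly_Mapping.single (f x, y) (Poly_Mapping.lookup u (x, y)))"

text \<open>
  The \<open>i\<close>-th homology of the complex \<open>F \<otimes> N\<close> (without the augmentation) is the quotient of
  \<open>tensor_cycles\<close> by \<open>tensor_boundaries\<close>, both taken inside \<open>free_on (F i \<times> N)\<close> and both
  containing the bilinearity relations of \<open>F i \<otimes> N\<close>.
\<close>

fun tensor_cycles ::
    "(nat \<Rightarrow> nat set) \<Rightarrow> (nat \<Rightarrow> (nat \<Rightarrow>\<^sub>0 'r) \<Rightarrow> (nat \<Rightarrow>\<^sub>0 'r)) \<Rightarrow>
     ('r::comm_ring_1 \<Rightarrow> 'n::ab_group_add \<Rightarrow> 'n) \<Rightarrow> 'n set \<Rightarrow> nat \<Rightarrow>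
     ((nat \<Rightarrow>\<^sub>0 'r) \<times> 'n \<Rightarrow>\<^sub>0 'r) set"
  where
    "tensor_cycles B d sN N 0 = free_on (free_on (B 0) \<times> N)"
  | "tensor_cycles B d sN N (Suc i) =
      {u \<in> free_on (free_on (B (Suc i)) \<times> N).
         tensor_map (d i) u \<in> tensor_rel free_scale (free_on (B i)) sN N}"

definition tensor_boundaries ::
    "(nat \<Rightarrow> nat set) \<Rightarrow> (nat \<Rightarrow> (nat \<Rightarrow>\<^sub>0 'r) \<Rightarrow> (nat \<Rightarrow>\<^sub>0 'r)) \<Rightarrow>
     ('r::comm_ring_1 \<Rightarrow> 'n::ab_group_add \<Rightarrow> 'n) \<Rightarrow> 'n set \<Rightarrow> nat \<Rightarrow>
     ((nat \<Rightarrow>\<^sub>0 'r) \<times> 'n \<Rightarrow>\<^sub>0 'r) set"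
  where "tensor_boundaries B d sN N i =
    {tensor_map (d i) u + r | u r.
       u \<in> free_on (free_on (B (Suc i)) \<times> N) \<and> r \<in> tensor_rel free_scale (free_on (B i)) sN N}"

text \<open>
  \<open>Tor\<^sub>i(M, N)\<close>, as a pair (numerator, denominator), computed from a chosen free resolution
  of \<open>M\<close>. Any two choices give isomorphic modules.
\<close>

definition Tor ::
    "nat \<Rightarrow> ('r::comm_ring_1 \<Rightarrow> 'm::ab_group_add \<Rightarrow> 'm) \<Rightarrow> 'm set \<Rightarrow>
     ('r \<Rightarrow> 'n::ab_group_add \<Rightarrow> 'n) \<Rightarrow> 'n set \<Rightarrow>
     ((nat \<Rightarrow>\<^sub>0 'r) \<times> 'n \<Rightarrow>\<^sub>0 'r) set \<times> ((nat \<Rightarrow>\<^sub>0 'r) \<times> 'n \<Rightarrow>\<^sub>0 'r) set"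
  where "Tor i sM M sN N =
    (let (B, d, e) = (SOME (B, d, e). free_resolution sM M B d e)
     in (tensor_cycles B d sN N i, tensor_boundaries B d sN N i))"

text \<open>
  \<open>S\<close> is a set of representatives of a basis of \<open>Z/W\<close>. As for \<open>vector_space.dim\<close>, the
  dimension is \<open>0\<close> by convention if it is not finite.
\<close>

definition quotient_basis ::
    "('k::field \<Rightarrow> 'v::ab_group_add \<Rightarrow> 'v) \<Rightarrow> 'v set \<Rightarrow> 'v set \<Rightarrow> 'v set \<Rightarrow> bool"
  where "quotient_basis s Z W S \<longleftrightarrow>
    S \<subseteq> Z \<and>
    (\<forall>T c. finite T \<and> T \<subseteq> S \<and> (\<Sum>v\<in>T. s (c v) v) \<in> W \<longrightarrow> (\<forall>v\<in>T. c v = 0)) \<and>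
    (\<forall>z\<in>Z. \<exists>v\<in>module.span s S. z - v \<in> W)"

definition quotient_dim ::
    "('k::field \<Rightarrow> 'v::ab_group_add \<Rightarrow> 'v) \<Rightarrow> 'v set \<Rightarrow> 'v set \<Rightarrow> nat"
  where "quotient_dim s Z W = card (SOME S. quotient_basis s Z W S)"

text \<open>
  The polynomial ring over \<open>'k\<close> in the variables \<open>'x\<close>: a monomial is its exponent vector
  in \<open>'x \<Rightarrow>\<^sub>0 nat\<close>, a polynomial maps monomials to coefficients.
\<close>

type_synonym ('x, 'k) mpoly = "('x \<Rightarrow>\<^sub>0 nat) \<Rightarrow>\<^sub>0 'k"

abbreviation monomial :: "('x \<Rightarrow>\<^sub>0 nat) \<Rightarrow> ('x, 'k::comm_ring_1) mpoly"
  where "monomial m \<equiv> Poly_Mapping.single m 1"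

abbreviation const :: "'k::comm_ring_1 \<Rightarrow> ('x, 'k) mpoly"
  where "const c \<equiv> Poly_Mapping.single 0 c"

abbreviation ideal_generated :: "'r::comm_ring_1 set \<Rightarrow> 'r set"
  where "ideal_generated \<equiv> module.span (*)"

fun ideal_power :: "'r::comm_ring_1 set \<Rightarrow> nat \<Rightarrow> 'r set"
  where
    "ideal_power I 0 = UNIV"
  | "ideal_power I (Suc h) = ideal_generated {a * b | a b. a \<in> I \<and> b \<in> ideal_power I h}"

definition monomial_ideal :: "('x, 'k::comm_ring_1) mpoly set \<Rightarrow> bool"
  where "monomial_ideal I \<longleftrightarrow> (\<exists>A. I = ideal_generated (monomial ` A))"

text \<open>
  The exponent vectors of \<open>G(I)\<close>, i.e. of the monomials of \<open>I\<close> that are minimal with respect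
  to divisibility. Divisibility is the pointwise order on exponents, not the lexicographic order
  that \<open>(\<le>)\<close> denotes on \<open>'x \<Rightarrow>\<^sub>0 nat\<close>.
\<close>

definition minimal_generators :: "('x, 'k::comm_ring_1) mpoly set \<Rightarrow> ('x \<Rightarrow>\<^sub>0 nat) set"
  where "minimal_generators I =
    {m. monomial m \<in> I \<and>
        (\<forall>m'. monomial m' \<in> I \<and> (\<forall>x. Poly_Mapping.lookup m' x \<le> Poly_Mapping.lookup m x)
              \<longrightarrow> m' = m)}"

text \<open>The residue field at the origin as a module: each variable acts as zero.\<close>

definition residue_scale :: "('x, 'k::field) mpoly \<Rightarrow> 'k \<Rightarrow> 'k"
  where "residue_scale f c = Poly_Mapping.lookup f 0 * c"

definition betti :: "nat \<Rightarrow> ('x::finite, 'k::field) mpoly set \<Rightarrow> nat"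
  where "betti i J =
    (let (Z, W) = Tor i (*) J residue_scale UNIV
     in quotient_dim (\<lambda>c. free_scale (const c)) Z W)"

text \<open>
  The \<open>i\<close>-th Betti number of a monomial ideal \<open>I\<close> over the field \<open>'k\<close>, which need not be the
  coefficient field \<open>'a\<close> of \<open>I\<close>.
\<close>

definition betti_over :: "'k::field itself \<Rightarrow> nat \<Rightarrow> ('x::finite, 'a::field) mpoly set \<Rightarrow> nat"
  where "betti_over TYPE('k) i I =
    betti i (ideal_generated (monomial ` minimal_generators I) :: ('x, 'k) mpoly set)"

end

theory Submission
  imports Defs "HOL-Library.Function_Algebras" "HOL-Library.Countable_Set"
    "HOL-Computational_Algebra.Polynomial"
begin

text \<open>
  For a countable field \<open>k\<close> and a fixed \<open>i\<close>, the Betti number \<open>\<beta>\<^sub>i\<close> of \<open>I\<^sup>h\<close> over \<open>k\<close> agrees with a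
  polynomial in \<open>h\<close> for all large \<open>h\<close> (\<open>eventually_poly_betti_over_power\<close>). Hence so does the
  difference of the Betti numbers over two such fields, and a polynomial is zero or has only finitely
  many roots.

  The Betti numbers are computed by Koszul homology. If \<open>F\<close> is any free resolution of the ideal \<open>J\<close>,
  then the Koszul complexes of the \<open>F\<^sub>j\<close> are exact in positive degrees, so Koszul homology can be
  shifted along the short exact sequences of syzygies, and \<open>Tor\<^sub>i(J, k)\<close> is isomorphic to the
  \<open>i\<close>-th Koszul homology of \<open>J\<close> (\<open>has_qdim_Tor\<close>). For a monomial ideal the latter splits into
  multidegrees: its part of degree \<open>a\<close> is the homology of the simplicial complex \<open>\<Delta>\<^sub>a\<close> of all sets of
  variables \<open>\<sigma>\<close> with \<open>x\<^bsup>a - \<sigma>\<^esup> \<in> J\<close>. Therefore (\<open>betti_over_power\<close>) \<open>\<beta>\<^sub>i(I\<^sup>h)\<close> is the sum over all \<open>\<Delta>\<close>,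
  without those that have a cone point and thus no homology, of the dimension of the homology of
  \<open>\<Delta>\<close> over \<open>k\<close> times the number of degrees \<open>a\<close> with \<open>\<Delta>\<^sub>a = \<Delta>\<close> for \<open>J = I\<^sup>h\<close>. Only the first factor
  depends on \<open>k\<close>, and only the second one on \<open>h\<close>.

  It remains to count these degrees (\<open>eventually_poly_card_deg_complex\<close>). An element of \<open>I\<^sup>h\<close> of degree
  \<open>a\<close> is a product of \<open>h\<close> generators and some variables, and the least exponent vector \<open>c\<close> of such a
  product, with respect to a monomial order, represents \<open>a\<close>. The vectors \<open>c\<close> that arise from
  \<open>\<Delta>\<close> form a difference of two sets that are closed under increasing exponents. By Dickson's
  lemma, membership in such a set depends only on the entries of \<open>c\<close> cut off at a constant \<open>N\<close>. So the set is a finite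
  disjoint union of translated orthants, and in such an orthant the vectors of degree \<open>h\<close> are
  counted by a binomial coefficient (\<open>eventually_poly_card_difference\<close>).
\<close>

section \<open>Dimensions of quotient spaces\<close>

lemma sum_fun_apply: "(\<Sum>i\<in>A. f i) x = (\<Sum>i\<in>A. f i x)"
  for f :: "'i \<Rightarrow> 'a \<Rightarrow> 'b::comm_monoid_add"
  by (induction A rule: infinite_finite_induct) auto

text \<open>
  The quotient \<open>Z/W\<close> has finite dimension \<open>n\<close>. In contrast to an equation for \<open>quotient_dim\<close>, this
  excludes that the value comes from the convention for infinite dimension, and it can be
  transported between spaces.
\<close>

definition has_qdim ::
    "('k::field \<Rightarrow> 'v::ab_group_add \<Rightarrow> 'v) \<Rightarrow> 'v set \<Rightarrow> 'v set \<Rightarrow> nat \<Rightarrow> bool"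
  where "has_qdim s Z W n \<longleftrightarrow> (\<exists>S. quotient_basis s Z W S \<and> finite S \<and> card S = n)"

lemma quotient_basisD:
  assumes "quotient_basis s Z W S"
  shows "S \<subseteq> Z"
    and "finite T \<Longrightarrow> T \<subseteq> S \<Longrightarrow> (\<Sum>v\<in>T. s (c v) v) \<in> W \<Longrightarrow> v \<in> T \<Longrightarrow> c v = 0"
    and "z \<in> Z \<Longrightarrow> \<exists>v\<in>module.span s S. z - v \<in> W"
  using assms unfolding quotient_basis_def by blast+

text \<open>
  Modulo \<open>W\<close>, the elements of \<open>T\<close> have coordinates with respect to \<open>S1\<close>. If \<open>T\<close> had more elements than
  \<open>S1\<close>, these coordinate vectors would be dependent.
\<close>

lemma quotient_basis_card_le:
  assumes vs: "vector_space s" and W: "module.subspace s W"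
    and S1: "quotient_basis s Z W S1" "finite S1" and S2: "quotient_basis s Z W S2"
    and T: "finite T" "T \<subseteq> S2"
  shows "card T \<le> card S1"
proof (rule ccontr)
  assume "\<not> card T \<le> card S1"
  hence gt: "card T > card S1" by simp
  interpret vector_space s by fact
  have "\<exists>a. v - (\<Sum>x\<in>S1. s (a x) x) \<in> W \<and> (\<forall>x. x \<notin> S1 \<longrightarrow> a x = 0)" if "v \<in> T" for v
  proof -
    have "v \<in> Z" using that T S2 by (auto simp: quotient_basis_def)
    then obtain u where u: "u \<in> span S1" "v - u \<in> W" using S1 by (auto simp: quotient_basis_def)
    then obtain a where a: "u = (\<Sum>x\<in>S1. s (a x) x)" using span_finite[OF S1(2)] by auto
    show ?thesis
      using u a by (intro exI[of _ "\<lambda>x. if x \<in> S1 then a x else 0"]) (auto cong: sum.cong)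
  qed
  then obtain A where A: "\<And>v. v \<in> T \<Longrightarrow> v - (\<Sum>x\<in>S1. s (A v x) x) \<in> W"
      "\<And>v x. v \<in> T \<Longrightarrow> x \<notin> S1 \<Longrightarrow> A v x = 0" by metis
  have indep: "\<forall>v\<in>U. c v = 0" if "finite U" "U \<subseteq> T" "(\<Sum>v\<in>U. s (c v) v) \<in> W" for U c
    using S2 T that unfolding quotient_basis_def by (meson subset_trans)
  have comb: "(\<Sum>v\<in>T. s (c v) v) \<in> W" if "\<And>x. (\<Sum>v\<in>T. c v * A v x) = 0" for c
  proof -
    have "(\<Sum>v\<in>T. s (c v) (v - (\<Sum>x\<in>S1. s (A v x) x))) \<in> W"
      by (intro subspace_sum[OF W] subspace_scale[OF W] A)
    also have "(\<Sum>v\<in>T. s (c v) (v - (\<Sum>x\<in>S1. s (A v x) x)))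
       = (\<Sum>v\<in>T. s (c v) v) - (\<Sum>v\<in>T. \<Sum>x\<in>S1. s (c v * A v x) x)"
      by (simp add: scale_right_diff_distrib sum_subtractf scale_sum_right)
    also have "(\<Sum>v\<in>T. \<Sum>x\<in>S1. s (c v * A v x) x) = (\<Sum>x\<in>S1. s (\<Sum>v\<in>T. c v * A v x) x)"
      by (subst sum.swap) (simp add: scale_sum_left)
    also have "\<dots> = 0" using that by simp
    finally show ?thesis by simp
  qed
  let ?sc = "\<lambda>(c::'a) (f::'b \<Rightarrow> 'a) x. c * f x"
  interpret F: vector_space ?sc
    by unfold_locales (auto simp: algebra_simps fun_eq_iff)
  have inj: "inj_on A T"
  proof (rule inj_onI, rule ccontr)
    fix v v' assume v: "v \<in> T" "v' \<in> T" "A v = A v'" "v \<noteq> v'"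
    let ?c = "\<lambda>x. if x = v then 1 else if x = v' then - 1 else (0::'a)"
    have "(\<Sum>u\<in>T. ?c u * A u x) = 0" for x
    proof -
      have "(\<Sum>u\<in>T. ?c u * A u x) = (\<Sum>u\<in>{v,v'}. ?c u * A u x)"
        using v T by (intro sum.mono_neutral_right) auto
      also have "\<dots> = 0" using v by auto
      finally show ?thesis .
    qed
    from indep[OF T(1) order_refl comb[of ?c, OF this]] v show False by auto
  qed
  let ?E = "(\<lambda>x y. if y = x then 1 else (0::'a)) ` S1"
  have "A ` T \<subseteq> F.span ?E"
  proof safe
    fix v assume v: "v \<in> T"
    have "A v = (\<Sum>x\<in>S1. ?sc (A v x) (\<lambda>y. if y = x then 1 else 0))"
    proof
      fix y
      have "(\<Sum>x\<in>S1. A v x * (if y = x then 1 else 0)) = A v y"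
        using A(2)[OF v, of y] S1(2) by (simp add: if_distrib sum.delta cong: if_cong)
      thus "A v y = (\<Sum>x\<in>S1. ?sc (A v x) (\<lambda>y. if y = x then 1 else 0)) y"
        by (simp add: sum_fun_apply)
    qed
    also have "\<dots> \<in> F.span ?E" by (intro F.span_sum F.span_scale F.span_base) auto
    finally show "A v \<in> F.span ?E" .
  qed
  moreover have "card ?E \<le> card S1" using S1 card_image_le by blast
  moreover have "card (A ` T) = card T" using inj card_image by blast
  ultimately have dep: "F.dependent (A ` T)"
    using F.independent_span_bound[of ?E "A ` T"] gt S1 by force
  have "finite (A ` T)" using T by simp
  from dep[unfolded F.dependent_finite[OF this]] obtain u where
    u: "\<exists>v\<in>A ` T. u v \<noteq> 0" "(\<Sum>v\<in>A ` T. ?sc (u v) v) = 0" by blast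
  have "(\<Sum>v\<in>T. u (A v) * A v x) = 0" for x
    using fun_cong[OF u(2), of x] by (simp add: sum.reindex[OF inj] sum_fun_apply)
  from indep[OF T(1) order_refl comb[of "\<lambda>v. u (A v)", OF this]] u(1) show False by auto
qed

text \<open>
  A quotient basis is not unique, but if one of them is finite then all have the same cardinality.
\<close>

lemma quotient_dim_eqI:
  assumes vs: "vector_space s" and W: "module.subspace s W" and "has_qdim s Z W n"
  shows "quotient_dim s Z W = n"
proof -
  obtain S1 where S1: "quotient_basis s Z W S1" "finite S1" "card S1 = n"
    using assms by (auto simp: has_qdim_def)
  define S2 where "S2 = (SOME S. quotient_basis s Z W S)"
  have S2: "quotient_basis s Z W S2" unfolding S2_def using S1 by (metis someI_ex)
  note le = quotient_basis_card_le[OF vs W]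
  have fin: "finite S2"
  proof (rule ccontr)
    assume "infinite S2"
    then obtain T where "T \<subseteq> S2" "finite T" "card T = Suc (card S1)"
      using infinite_arbitrarily_large by blast
    with le[OF S1(1,2) S2] show False by fastforce
  qed
  show ?thesis
    using le[OF S1(1,2) S2 fin] le[OF S2 fin S1(1,2)] S1
    by (simp add: quotient_dim_def S2_def[symmetric])
qed

text \<open>
  A linear correspondence, that is, a subspace of the product of two vector spaces. The
  isomorphisms of homology below come from zig-zags of maps, which are relations rather than
  functions on representatives.
\<close>

definition linear_rel ::
    "('k::field \<Rightarrow> 'v::ab_group_add \<Rightarrow> 'v) \<Rightarrow> ('k \<Rightarrow> 'w::ab_group_add \<Rightarrow> 'w) \<Rightarrow> ('v \<Rightarrow> 'w \<Rightarrow> bool) \<Rightarrow> bool"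
  where "linear_rel s s' P \<longleftrightarrow> P 0 0 \<and> (\<forall>x y x' y'. P x y \<longrightarrow> P x' y' \<longrightarrow> P (x + x') (y + y')) \<and>
    (\<forall>c x y. P x y \<longrightarrow> P (s c x) (s' c y))"

lemma linear_rel_sum:
  "linear_rel s s' P \<Longrightarrow> (\<And>i. i \<in> A \<Longrightarrow> P (f i) (g i)) \<Longrightarrow> P (sum f A) (sum g A)"
  by (induction A rule: infinite_finite_induct) (auto simp: linear_rel_def)

lemma linear_rel_diff:
  assumes "vector_space s" "vector_space s'" "linear_rel s s' P" "P x y" "P x' y'"
  shows "P (x - x') (y - y')"
proof -
  interpret V: vector_space s by fact
  interpret V': vector_space s' by fact
  have "P (s (- 1) x') (s' (- 1) y')" using assms(3,5) unfolding linear_rel_def by blast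
  hence "P (x + s (- 1) x') (y + s' (- 1) y')" using assms(3,4) unfolding linear_rel_def by blast
  thus ?thesis by simp
qed

text \<open>
  A linear correspondence between \<open>Z\<close> and \<open>Z'\<close> that is total on both sides and respects membership
  in \<open>W\<close> and \<open>W'\<close> in both directions induces an isomorphism \<open>Z/W \<cong> Z'/W'\<close>.
\<close>

lemma has_qdim_transport:
  assumes vs: "vector_space s" "vector_space s'"
    and sub: "module.subspace s Z" "module.subspace s' Z'" "module.subspace s' W'"
    and P: "linear_rel s s' P"
    and total1: "\<And>z. z \<in> Z \<Longrightarrow> \<exists>z'\<in>Z'. P z z'"
    and total2: "\<And>z'. z' \<in> Z' \<Longrightarrow> \<exists>z\<in>Z. P z z'"
    and match: "\<And>z z'. z \<in> Z \<Longrightarrow> z' \<in> Z' \<Longrightarrow> P z z' \<Longrightarrow> z \<in> W \<longleftrightarrow> z' \<in> W'"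
    and "has_qdim s Z W n"
  shows "has_qdim s' Z' W' n"
proof -
  interpret V: vector_space s by fact
  interpret V': vector_space s' by fact
  obtain S where S: "quotient_basis s Z W S" "finite S" "card S = n"
    using assms by (auto simp: has_qdim_def)
  have SZ: "S \<subseteq> Z" and ind: "\<And>T c v. finite T \<Longrightarrow> T \<subseteq> S \<Longrightarrow> (\<Sum>v\<in>T. s (c v) v) \<in> W \<Longrightarrow> v \<in> T \<Longrightarrow> c v = 0"
    and spn: "\<And>z. z \<in> Z \<Longrightarrow> \<exists>v\<in>V.span S. z - v \<in> W"
    using quotient_basisD[OF S(1)] by auto
  obtain g where g: "\<And>v. v \<in> S \<Longrightarrow> g v \<in> Z' \<and> P v (g v)"
    using total1 SZ by (metis subset_iff)
  note Pd = linear_rel_diff[OF vs P]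
  have inj: "inj_on g S"
  proof (rule inj_onI, rule ccontr)
    fix v v' assume v: "v \<in> S" "v' \<in> S" "g v = g v'" "v \<noteq> v'"
    have "P v (g v)" "P v' (g v')" using g v(1,2) by blast+
    hence "P (v - v') (g v - g v')" by (rule Pd)
    hence "P (v - v') 0" using v by simp
    moreover have "v - v' \<in> Z" using v SZ sub V.subspace_diff by blast
    ultimately have "v - v' \<in> W"
      using match V'.subspace_0[OF sub(2)] V'.subspace_0[OF sub(3)] by blast
    hence "(\<Sum>u\<in>{v,v'}. s (if u = v then 1 else -1) u) \<in> W" using v by simp
    from ind[OF _ _ this, of v] v show False by auto
  qed
  have "quotient_basis s' Z' W' (g ` S)"
    unfolding quotient_basis_def
  proof (intro conjI allI impI ballI)
    show "g ` S \<subseteq> Z'" using g by auto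
  next
    fix T' c v' assume T': "finite T' \<and> T' \<subseteq> g ` S \<and> (\<Sum>v\<in>T'. s' (c v) v) \<in> W'" "v' \<in> T'"
    then obtain T where T: "T \<subseteq> S" "T' = g ` T" by (metis subset_image_iff)
    have fT: "finite T" using T S finite_subset by auto
    have injT: "inj_on g T" using inj T inj_on_subset by blast
    have eq: "(\<Sum>v\<in>T'. s' (c v) v) = (\<Sum>v\<in>T. s' (c (g v)) (g v))"
      using T by (simp add: sum.reindex[OF injT])
    have "P (\<Sum>v\<in>T. s (c (g v)) v) (\<Sum>v\<in>T. s' (c (g v)) (g v))"
      using P T g by (intro linear_rel_sum[OF P]) (auto simp: linear_rel_def)
    moreover have "(\<Sum>v\<in>T. s (c (g v)) v) \<in> Z"
      using T SZ by (intro V.subspace_sum[OF sub(1)] V.subspace_scale[OF sub(1)]) auto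
    moreover have "(\<Sum>v\<in>T. s' (c (g v)) (g v)) \<in> Z'"
      using T g by (intro V'.subspace_sum[OF sub(2)] V'.subspace_scale[OF sub(2)]) auto
    ultimately have "(\<Sum>v\<in>T. s (c (g v)) v) \<in> W" using match T' eq by metis
    from ind[OF fT T(1) this] T T'(2) show "c v' = 0" by auto
  next
    fix z' assume z': "z' \<in> Z'"
    then obtain z where z: "z \<in> Z" "P z z'" using total2 by auto
    then obtain v where v: "v \<in> V.span S" "z - v \<in> W" using spn by auto
    then obtain a where a: "v = (\<Sum>x\<in>S. s (a x) x)" using V.span_finite[OF S(2)] by auto
    define v' where "v' = (\<Sum>x\<in>S. s' (a x) (g x))"
    have "P v v'" unfolding a v'_def using P g
      by (intro linear_rel_sum[OF P]) (auto simp: linear_rel_def)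
    hence "P (z - v) (z' - v')" using Pd z by auto
    moreover have "z - v \<in> Z" using z SZ unfolding a
      by (intro V.subspace_diff[OF sub(1)] V.subspace_sum[OF sub(1)] V.subspace_scale[OF sub(1)]) auto
    moreover have "z' - v' \<in> Z'" using z' g unfolding v'_def
      by (intro V'.subspace_diff[OF sub(2)] V'.subspace_sum[OF sub(2)] V'.subspace_scale[OF sub(2)]) auto
    moreover have "v' \<in> V'.span (g ` S)" unfolding v'_def
      by (intro V'.span_sum V'.span_scale V'.span_base) auto
    ultimately show "\<exists>v\<in>V'.span (g ` S). z' - v \<in> W'" using match v by metis
  qed
  thus ?thesis unfolding has_qdim_def using S card_image[OF inj] by blast
qed

text \<open>
  \<open>Z/W\<close> is the direct sum of the \<open>Z' a/W' a\<close>, with projections \<open>\<pi> a\<close> and inclusions \<open>\<iota> a\<close>; only the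
  summands with \<open>a \<in> E\<close> are non-zero.
\<close>

lemma has_qdim_direct_sum:
  fixes \<pi> :: "'i \<Rightarrow> 'v::ab_group_add \<Rightarrow> 'w::ab_group_add" and \<iota> :: "'i \<Rightarrow> 'w \<Rightarrow> 'v"
  assumes vs: "vector_space s" "vector_space s'"
    and \<pi>: "\<And>a. module_hom s s' (\<pi> a)" and \<iota>: "\<And>a. module_hom s' s (\<iota> a)"
    and sub: "module.subspace s Z" "module.subspace s W"
    and sub': "\<And>a. module.subspace s' (Z' a)"  "\<And>a. module.subspace s' (W' a)"
    and \<pi>\<iota>: "\<And>a b z. z \<in> Z' a \<Longrightarrow> \<pi> b (\<iota> a z) = (if a = b then z else 0)"
    and \<pi>W: "\<And>a w. w \<in> W \<Longrightarrow> \<pi> a w \<in> W' a" and \<pi>Z: "\<And>a z. z \<in> Z \<Longrightarrow> \<pi> a z \<in> Z' a"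
    and \<iota>W: "\<And>a w. w \<in> W' a \<Longrightarrow> \<iota> a w \<in> W" and \<iota>Z: "\<And>a z. z \<in> Z' a \<Longrightarrow> \<iota> a z \<in> Z"
    and dec: "\<And>z. z \<in> Z \<Longrightarrow> \<exists>T. finite T \<and> z = (\<Sum>a\<in>T. \<iota> a (\<pi> a z))"
    and E: "finite E" and trivial: "\<And>a. a \<notin> E \<Longrightarrow> Z' a \<subseteq> W' a"
    and n: "\<And>a. a \<in> E \<Longrightarrow> has_qdim s' (Z' a) (W' a) (n a)"
  shows "has_qdim s Z W (\<Sum>a\<in>E. n a)"
proof -
  interpret V: vector_space s by fact
  interpret V': vector_space s' by fact
  have p0: "\<pi> a 0 = 0" "\<pi> a (sum f A) = (\<Sum>x\<in>A. \<pi> a (f x))" "\<pi> a (s c x) = s' c (\<pi> a x)" for a f c x and A :: "'v set"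
    by (rule module_hom.zero[OF \<pi>] module_hom.sum[OF \<pi>] module_hom.scale[OF \<pi>])+
  have i0: "\<iota> a 0 = 0" "\<iota> a (x - y) = \<iota> a x - \<iota> a y" "\<iota> a (s' c x) = s c (\<iota> a x)"
     "\<iota> a (sum f A) = (\<Sum>x\<in>A. \<iota> a (f x))" for a f c x y and A :: "'w set"
    by (rule module_hom.zero[OF \<iota>] module_hom.diff[OF \<iota>] module_hom.scale[OF \<iota>] module_hom.sum[OF \<iota>])+
  have "\<exists>S. \<forall>a\<in>E. quotient_basis s' (Z' a) (W' a) (S a) \<and> finite (S a) \<and> card (S a) = n a"
    using n unfolding has_qdim_def by (intro bchoice) auto
  then obtain S where S: "\<And>a. a \<in> E \<Longrightarrow> quotient_basis s' (Z' a) (W' a) (S a)"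
      "\<And>a. a \<in> E \<Longrightarrow> finite (S a)" "\<And>a. a \<in> E \<Longrightarrow> card (S a) = n a" by blast
  have SZ: "\<And>a. a \<in> E \<Longrightarrow> S a \<subseteq> Z' a"
    and ind: "\<And>a T c v. a \<in> E \<Longrightarrow> finite T \<Longrightarrow> T \<subseteq> S a \<Longrightarrow> (\<Sum>v\<in>T. s' (c v) v) \<in> W' a \<Longrightarrow> v \<in> T \<Longrightarrow> c v = 0"
    and spn: "\<And>a z. a \<in> E \<Longrightarrow> z \<in> Z' a \<Longrightarrow> \<exists>v\<in>V'.span (S a). z - v \<in> W' a"
    using quotient_basisD[OF S(1)] by auto
  have S0: "0 \<notin> S a" if "a \<in> E" for a
  proof
    assume "0 \<in> S a"
    thus False using ind[OF that, of "{0}" "\<lambda>_. 1" 0] V'.subspace_0[OF sub'(2)] by auto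
  qed
  let ?S = "\<Union>a\<in>E. \<iota> a ` S a"
  have inj: "inj_on (\<iota> a) (S a)" if "a \<in> E" for a
    by (rule inj_onI) (metis SZ that \<pi>\<iota> subsetD)
  have disj: "\<iota> a ` S a \<inter> \<iota> b ` S b = {}" if ab: "a \<in> E" "b \<in> E" "a \<noteq> b" for a b
  proof -
    have False if "x \<in> S a" "y \<in> S b" "\<iota> a x = \<iota> b y" for x y
    proof -
      have "x = \<pi> a (\<iota> a x)" using \<pi>\<iota>[of x a a] SZ ab that by auto
      also have "\<dots> = \<pi> a (\<iota> b y)" using that by simp
      also have "\<dots> = 0" using \<pi>\<iota>[of y b a] SZ ab that by auto
      finally show False using S0 ab that by auto
    qed
    thus ?thesis by blast
  qed
  have fin: "finite ?S" using E S by auto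
  have card: "card ?S = (\<Sum>a\<in>E. n a)"
    using S by (subst card_UN_disjoint[OF E]) (auto simp: disj card_image[OF inj])
  have "quotient_basis s Z W ?S"
    unfolding quotient_basis_def
  proof (intro conjI allI impI ballI)
    show "?S \<subseteq> Z" using SZ \<iota>Z by blast
  next
    fix T c v assume T: "finite T \<and> T \<subseteq> ?S \<and> (\<Sum>v\<in>T. s (c v) v) \<in> W" and "v \<in> T"
    then obtain a v0 where a: "a \<in> E" "v0 \<in> S a" "v = \<iota> a v0" by blast
    define U where "U = {x \<in> S a. \<iota> a x \<in> T}"
    have U: "finite U" "U \<subseteq> S a" "v0 \<in> U" using S a \<open>v \<in> T\<close> by (auto simp: U_def)
    have injU: "inj_on (\<iota> a) U" using inj[OF a(1)] U inj_on_subset by blast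
    have "\<pi> a (\<Sum>v\<in>T. s (c v) v) = (\<Sum>v\<in>T. s' (c v) (\<pi> a v))" by (simp add: p0)
    also have "\<dots> = (\<Sum>v\<in>\<iota> a ` U. s' (c v) (\<pi> a v))"
    proof (rule sum.mono_neutral_right)
      show "\<iota> a ` U \<subseteq> T" by (auto simp: U_def)
      show "\<forall>i\<in>T - \<iota> a ` U. s' (c i) (\<pi> a i) = 0"
      proof
        fix i assume i: "i \<in> T - \<iota> a ` U"
        then obtain b y where b: "b \<in> E" "y \<in> S b" "i = \<iota> b y" using T by blast
        have "b \<noteq> a" using i b by (auto simp: U_def)
        thus "s' (c i) (\<pi> a i) = 0" using \<pi>\<iota>[of y b a] b SZ by auto
      qed
    qed (use T in simp)
    also have "\<dots> = (\<Sum>u\<in>U. s' (c (\<iota> a u)) u)"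
      using U SZ[OF a(1)] by (auto simp: sum.reindex[OF injU] \<pi>\<iota> subset_iff intro!: sum.cong)
    finally have "(\<Sum>u\<in>U. s' (c (\<iota> a u)) u) \<in> W' a" using \<pi>W T by metis
    from ind[OF a(1) U(1,2) this U(3)] a show "c v = 0" by simp
  next
    fix z assume z: "z \<in> Z"
    then obtain T where T: "finite T" "z = (\<Sum>a\<in>T. \<iota> a (\<pi> a z))" using dec by blast
    have "\<exists>u\<in>V.span ?S. \<iota> a (\<pi> a z) - u \<in> W" for a
    proof (cases "a \<in> E")
      case True
      then obtain u where u: "u \<in> V'.span (S a)" "\<pi> a z - u \<in> W' a" using spn \<pi>Z z by blast
      have "\<iota> a u \<in> V.span (\<iota> a ` S a)"
        using u module_hom.span_image[OF \<iota>, of a "S a"] by blast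
      hence "\<iota> a u \<in> V.span ?S" using V.span_mono[of "\<iota> a ` S a" ?S] True by blast
      moreover have "\<iota> a (\<pi> a z) - \<iota> a u \<in> W" using \<iota>W[OF u(2)] by (simp add: i0)
      ultimately show ?thesis by blast
    next
      case False
      hence "\<iota> a (\<pi> a z) \<in> W" using trivial \<pi>Z[OF z] \<iota>W by blast
    thus ?thesis by (intro bexI[of _ 0]) (auto simp: V.span_zero)
    qed
    then obtain u where u: "\<And>a. u a \<in> V.span ?S" "\<And>a. \<iota> a (\<pi> a z) - u a \<in> W" by metis
    have "z - (\<Sum>a\<in>T. u a) = (\<Sum>a\<in>T. \<iota> a (\<pi> a z) - u a)"
      by (subst T(2)) (simp add: sum_subtractf)
    also have "\<dots> \<in> W" by (intro V.subspace_sum[OF sub(2)] u)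
    finally show "\<exists>v\<in>V.span ?S. z - v \<in> W" using V.span_sum[of T u ?S] u(1) by blast
  qed
  thus ?thesis unfolding has_qdim_def using fin card by blast
qed

definition fun_scale :: "'k \<Rightarrow> ('a \<Rightarrow> 'k::field) \<Rightarrow> 'a \<Rightarrow> 'k"
  where "fun_scale c v = (\<lambda>x. c * v x)"

lemma fun_scale_apply [simp]: "fun_scale c v x = c * v x"
  by (simp add: fun_scale_def)

lemma vector_space_fun_scale: "vector_space fun_scale"
  by unfold_locales (auto simp: algebra_simps fun_eq_iff)

interpretation fun_space: vector_space fun_scale
  by (rule vector_space_fun_scale)

text \<open>
  The space of functions on a finite type has finite dimension, hence so does every quotient of
  subspaces of it.
\<close>

lemma has_qdim_fun:
  fixes Z W :: "('a::finite \<Rightarrow> 'k::field) set"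
  assumes W: "module.subspace fun_scale W" and "W \<subseteq> Z"
  shows "has_qdim fun_scale Z W (quotient_dim fun_scale Z W)"
proof -
  let ?E = "range (\<lambda>x y. if y = x then 1 else (0::'k)) :: ('a \<Rightarrow> 'k) set"
  have spanE: "v \<in> fun_space.span ?E" for v
  proof -
    have "v = (\<Sum>x\<in>UNIV. fun_scale (v x) (\<lambda>y. if y = x then 1 else 0))"
      by (rule ext) (simp add: sum_fun_apply if_distrib cong: if_cong)
    also have "\<dots> \<in> fun_space.span ?E" by (intro fun_space.span_sum fun_space.span_scale fun_space.span_base) auto
    finally show ?thesis .
  qed
  have fin: "finite B" if "fun_space.independent B" for B :: "('a \<Rightarrow> 'k) set"
    using fun_space.independent_span_bound[of ?E B] that spanE by auto
  obtain B0 where B0: "B0 \<subseteq> W" "fun_space.independent B0" "W \<subseteq> fun_space.span B0"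
    using fun_space.maximal_independent_subset[of W] by blast
  then obtain B where B: "B0 \<subseteq> B" "B \<subseteq> Z" "fun_space.independent B" "Z \<subseteq> fun_space.span B"
    using fun_space.maximal_independent_subset_extend[of B0 Z] assms(2) by (metis order_trans)
  have spanW: "fun_space.span B0 = W" using B0 W fun_space.span_minimal by blast
  have "quotient_basis fun_scale Z W (B - B0)"
    unfolding quotient_basis_def
  proof (intro conjI allI impI ballI)
    show "B - B0 \<subseteq> Z" using B by auto
  next
    fix T c v assume T: "finite T \<and> T \<subseteq> B - B0 \<and> (\<Sum>v\<in>T. fun_scale (c v) v) \<in> W" and v: "v \<in> T"
    hence "(\<Sum>v\<in>T. fun_scale (c v) v) \<in> fun_space.span B0" using spanW by simp
    then obtain a where a: "(\<Sum>v\<in>T. fun_scale (c v) v) = (\<Sum>v\<in>B0. fun_scale (a v) v)"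
      using fun_space.span_finite[OF fin[OF B0(2)]] by auto
    define f where "f = (\<lambda>v. if v \<in> T then c v else - a v)"
    have "(\<Sum>v\<in>T \<union> B0. fun_scale (f v) v) = (\<Sum>v\<in>T. fun_scale (f v) v) + (\<Sum>v\<in>B0. fun_scale (f v) v)"
      using T fin[OF B0(2)] by (intro sum.union_disjoint) auto
    also have "(\<Sum>v\<in>T. fun_scale (f v) v) = (\<Sum>v\<in>T. fun_scale (c v) v)" by (simp add: f_def)
    also have "(\<Sum>v\<in>B0. fun_scale (f v) v) = (\<Sum>v\<in>B0. - fun_scale (a v) v)"
      using T by (intro sum.cong) (auto simp: f_def)
    finally have "(\<Sum>v\<in>T \<union> B0. fun_scale (f v) v) = 0" unfolding sum_negf a by (simp only: add.right_inverse)
    moreover have "finite (T \<union> B0)" "T \<union> B0 \<subseteq> B" using T fin[OF B0(2)] B by auto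
    ultimately have "f v = 0" using fun_space.independentD[OF B(3)] v by blast
    thus "c v = 0" using v by (simp add: f_def)
  next
    fix z assume "z \<in> Z"
    hence "z \<in> fun_space.span B" using B by blast
    moreover have "(B - B0) \<union> B0 = B" using B by blast
    ultimately have "z \<in> fun_space.span ((B - B0) \<union> B0)" by (simp only:)
    then obtain x y where "z = x + y" "x \<in> fun_space.span (B - B0)" "y \<in> fun_space.span B0" unfolding fun_space.span_Un by blast
    thus "\<exists>v\<in>fun_space.span (B - B0). z - v \<in> W" using spanW by (intro bexI[of _ x]) auto
  qed
  hence *: "has_qdim fun_scale Z W (card (B - B0))"
    unfolding has_qdim_def using fin[OF B(3)] by auto
  from quotient_dim_eqI[OF vector_space_fun_scale W this] * show ?thesis by simp
qed

section \<open>The Koszul differential\<close>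

text \<open>
  The position of \<open>j\<close> in \<open>\<sigma>\<close>, which determines the sign in the Koszul differential. The variables
  carry no order, so they are ordered by the enumeration of a countable type.
\<close>

definition pos :: "'x::countable \<Rightarrow> 'x set \<Rightarrow> nat"
  where "pos j \<sigma> = card {l \<in> \<sigma>. to_nat l < to_nat j}"

definition signed :: "nat \<Rightarrow> 'm::ab_group_add \<Rightarrow> 'm"
  where "signed n v = (if even n then v else - v)"

lemma signed_simps [simp]:
  "signed n 0 = 0" "signed n (signed n v) = v" "signed n v = 0 \<longleftrightarrow> v = 0"
  "signed n (- v) = - signed n v"
  "signed m (signed n v) = signed (m + n) v"
  "signed n (v + w) = signed n v + signed n w"
  "signed n (v - w) = signed n v - signed n w"
  by (auto simp: signed_def)

lemma signed_sum: "signed n (sum f A) = (\<Sum>i\<in>A. signed n (f i))"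
  by (auto simp: signed_def sum_negf)

text \<open>
  A Koszul chain with values in a module is a family of elements indexed by the sets \<open>\<sigma>\<close> of
  variables; \<open>X j\<close> is the action of the \<open>j\<close>-th variable. With the identity for all \<open>X j\<close> this is the
  simplicial boundary map.
\<close>

definition koszul :: "('x::finite \<Rightarrow> 'm \<Rightarrow> 'm) \<Rightarrow> ('x set \<Rightarrow> 'm) \<Rightarrow> 'x set \<Rightarrow> 'm::ab_group_add"
  where "koszul X u \<sigma> = (\<Sum>j\<in>-\<sigma>. signed (pos j \<sigma>) (X j (u (insert j \<sigma>))))"

lemma pos_insert:
  fixes j :: "'x::finite"
  assumes "j \<notin> \<sigma>"
  shows "pos l (insert j \<sigma>) = pos l \<sigma> + (if to_nat j < to_nat l then 1 else 0)"
proof -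
  have "{i \<in> insert j \<sigma>. to_nat i < to_nat l}
      = (if to_nat j < to_nat l then insert j {i \<in> \<sigma>. to_nat i < to_nat l} else {i \<in> \<sigma>. to_nat i < to_nat l})"
    by auto
  thus ?thesis using assms by (simp add: pos_def)
qed

lemma signed_swap:
  fixes j l :: "'x::finite"
  assumes "j \<notin> \<sigma>" "l \<notin> \<sigma>" "j \<noteq> l"
  shows "signed (pos j \<sigma> + pos l (insert j \<sigma>)) v = - signed (pos l \<sigma> + pos j (insert l \<sigma>)) v"
proof -
  have "to_nat j \<noteq> to_nat l" using assms by simp
  hence "to_nat j < to_nat l \<or> to_nat l < to_nat j" by linarith
  thus ?thesis by (auto simp: pos_insert assms signed_def)
qed

lemma koszul_koszul:
  assumes add: "\<And>j. additive (X j)" and comm: "\<And>i j v. X i (X j v) = X j (X i v)"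
  shows "koszul X (koszul X u) \<sigma> = 0"
proof -
  have X: "X j (signed n v) = signed n (X j v)" for j n v
    using additive.minus[OF add] by (auto simp: signed_def)
  \<comment> \<open>The summands of the double sum cancel in pairs, also in characteristic 2.\<close>
  define T where "T j l = signed (pos j \<sigma> + pos l (insert j \<sigma>)) (X j (X l (u (insert j (insert l \<sigma>)))))" for j l
  have anti: "T j l = - T l j" if "j \<notin> \<sigma>" "l \<notin> \<sigma>" "j \<noteq> l" for j l
    unfolding T_def by (subst signed_swap[OF that], subst comm, subst insert_commute) simp
  have "koszul X (koszul X u) \<sigma> = (\<Sum>j\<in>-\<sigma>. \<Sum>l\<in>-insert j \<sigma>. T j l)"
    unfolding koszul_def T_def
    by (simp add: additive.sum[OF add] signed_sum X insert_commute)
  also have "\<dots> = (\<Sum>(j,l)\<in>Sigma (-\<sigma>) (\<lambda>j. -insert j \<sigma>). T j l)"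
    by (rule sum.Sigma) auto
  also have "Sigma (-\<sigma>) (\<lambda>j. -insert j \<sigma>)
     = {(j,l). j \<notin> \<sigma> \<and> l \<notin> \<sigma> \<and> to_nat j < to_nat l} \<union> {(j,l). j \<notin> \<sigma> \<and> l \<notin> \<sigma> \<and> to_nat l < to_nat j}"
    (is "_ = ?A \<union> ?B") by (auto simp: not_less le_less)
  also have "(\<Sum>(j,l)\<in>?A \<union> ?B. T j l) = (\<Sum>(j,l)\<in>?A. T j l) + (\<Sum>(j,l)\<in>?B. T j l)"
    by (rule sum.union_disjoint) auto
  also have "(\<Sum>(j,l)\<in>?B. T j l) = (\<Sum>(j,l)\<in>?A. T l j)"
    by (rule sum.reindex_bij_witness[of _ prod.swap prod.swap]) auto
  also have "\<dots> = (\<Sum>(j,l)\<in>?A. - T j l)"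
    by (intro sum.cong) (auto intro!: anti)
  also have "\<dots> = - (\<Sum>(j,l)\<in>?A. T j l)" by (simp add: sum_negf case_prod_unfold)
  finally show ?thesis by simp
qed

lemma koszul_add:
  "(\<And>j. additive (X j)) \<Longrightarrow> koszul X (u + v) = koszul X u + koszul X v"
  by (auto simp: koszul_def fun_eq_iff additive.add sum.distrib)

lemma koszul_diff:
  "(\<And>j. additive (X j)) \<Longrightarrow> koszul X (u - v) = koszul X u - koszul X v"
  by (auto simp: koszul_def fun_eq_iff additive.diff sum_subtractf)

lemma koszul_zero:
  "(\<And>j. additive (X j)) \<Longrightarrow> koszul X 0 = 0"
  by (auto simp: koszul_def fun_eq_iff additive.zero)

text \<open>
  Chains of a simplicial complex \<open>\<Delta>\<close> that are supported on the faces with \<open>q\<close> vertices, so that the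
  degree is one more than the dimension of the faces and the empty face counts. The
  homology in degree \<open>q\<close> is the reduced homology of \<open>\<Delta>\<close> in dimension \<open>q - 1\<close>.
\<close>

definition face_chains :: "'x set set \<Rightarrow> nat \<Rightarrow> ('x::finite set \<Rightarrow> 'm::zero) set"
  where "face_chains \<Delta> q = {v. \<forall>\<sigma>. v \<sigma> \<noteq> 0 \<longrightarrow> \<sigma> \<in> \<Delta> \<and> card \<sigma> = q}"

abbreviation bd :: "('x::finite set \<Rightarrow> 'm::ab_group_add) \<Rightarrow> 'x set \<Rightarrow> 'm"
  where "bd \<equiv> koszul (\<lambda>_ v. v)"

definition cycles :: "'x set set \<Rightarrow> nat \<Rightarrow> ('x::finite set \<Rightarrow> 'm::ab_group_add) set"
  where "cycles \<Delta> q = {v \<in> face_chains \<Delta> q. bd v = 0}"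

definition boundaries :: "'x set set \<Rightarrow> nat \<Rightarrow> ('x::finite set \<Rightarrow> 'm::ab_group_add) set"
  where "boundaries \<Delta> q = bd ` face_chains \<Delta> (Suc q)"

definition cone_point :: "'x set set \<Rightarrow> 'x \<Rightarrow> bool"
  where "cone_point \<Delta> j \<longleftrightarrow> (\<forall>\<sigma>\<in>\<Delta>. insert j \<sigma> \<in> \<Delta>)"

lemma additive_id: "additive (\<lambda>v. v :: 'm::ab_group_add)"
  by (simp add: additive_def)

lemma bd_bd: "bd (bd v) = 0"
  by (rule ext, simp only: zero_fun_apply, rule koszul_koszul) (auto simp: additive_id)

lemma bd_face_chains:
  assumes "\<And>\<sigma> \<tau>. \<sigma> \<in> \<Delta> \<Longrightarrow> \<tau> \<subseteq> \<sigma> \<Longrightarrow> \<tau> \<in> \<Delta>" "v \<in> face_chains \<Delta> (Suc q)"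
  shows "bd v \<in> face_chains \<Delta> q"
  unfolding face_chains_def
proof safe
  fix \<sigma> assume "bd v \<sigma> \<noteq> 0"
  then obtain j where j: "j \<in> -\<sigma>" "v (insert j \<sigma>) \<noteq> 0"
    unfolding koszul_def by (metis (no_types, lifting) signed_simps(1) sum.neutral)
  hence "insert j \<sigma> \<in> \<Delta>" "card (insert j \<sigma>) = Suc q" using assms(2) by (auto simp: face_chains_def)
  thus "\<sigma> \<in> \<Delta>" "card \<sigma> = q" using assms(1) j by auto
qed

lemma cone_cycles_subset_boundaries:
  fixes \<Delta> :: "'x::finite set set"
  assumes cone: "cone_point \<Delta> j"
  shows "cycles \<Delta> q \<subseteq> (boundaries \<Delta> q :: ('x set \<Rightarrow> 'm::ab_group_add) set)"
proof
  fix z :: "'x set \<Rightarrow> 'm" assume z: "z \<in> cycles \<Delta> q"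
  \<comment> \<open>\<open>y\<close> is the cone over \<open>z\<close> with apex \<open>j\<close>.\<close>
  define y where "y \<sigma> = (if j \<in> \<sigma> then signed (pos j (\<sigma> - {j})) (z (\<sigma> - {j})) else 0)" for \<sigma>
  have "y \<in> face_chains \<Delta> (Suc q)"
    unfolding face_chains_def
  proof (intro CollectI allI impI)
    fix \<sigma> assume "y \<sigma> \<noteq> 0"
    hence j: "j \<in> \<sigma>" "z (\<sigma> - {j}) \<noteq> 0" by (auto simp: y_def split: if_splits)
    hence "\<sigma> - {j} \<in> \<Delta>" "card (\<sigma> - {j}) = q" using z by (auto simp: cycles_def face_chains_def)
    moreover from this(1) have "insert j (\<sigma> - {j}) \<in> \<Delta>" using cone unfolding cone_point_def by blast
    moreover have "insert j (\<sigma> - {j}) = \<sigma>" using j by auto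
    moreover have "card \<sigma> = Suc (card (\<sigma> - {j}))" using j(1) by (intro card.remove) auto
    ultimately show "\<sigma> \<in> \<Delta> \<and> card \<sigma> = Suc q" by metis
  qed
  moreover have "bd y = z"
  proof
    fix \<sigma>
    show "bd y \<sigma> = z \<sigma>"
    proof (cases "j \<in> \<sigma>")
      case False
      have "bd y \<sigma> = (\<Sum>l\<in>-\<sigma>. if l = j then z \<sigma> else 0)"
        unfolding koszul_def using False by (intro sum.cong) (auto simp: y_def)
      thus ?thesis using False by simp
    next
      case True
      define \<tau> where "\<tau> = \<sigma> - {j}"
      have \<tau>: "j \<notin> \<tau>" "\<sigma> = insert j \<tau>" "-\<tau> = insert j (-\<sigma>)" using True by (auto simp: \<tau>_def)
      have "0 = bd z \<tau>" using z by (simp add: cycles_def)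
      also have "\<dots> = signed (pos j \<tau>) (z \<sigma>) + (\<Sum>l\<in>-\<sigma>. signed (pos l \<tau>) (z (insert l \<tau>)))"
        unfolding koszul_def \<tau>(3) using True by (subst sum.insert) (auto simp: \<tau>(2))
      finally have "signed (pos j \<tau>) (z \<sigma>) = - (\<Sum>l\<in>-\<sigma>. signed (pos l \<tau>) (z (insert l \<tau>)))"
        by (simp add: eq_neg_iff_add_eq_0)
      hence "signed (pos j \<tau>) (signed (pos j \<tau>) (z \<sigma>))
          = signed (pos j \<tau>) (- (\<Sum>l\<in>-\<sigma>. signed (pos l \<tau>) (z (insert l \<tau>))))" by (rule arg_cong)
      hence "z \<sigma> = (\<Sum>l\<in>-\<sigma>. - signed (pos j \<tau> + pos l \<tau>) (z (insert l \<tau>)))"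
        by (simp add: signed_sum sum_negf del: signed_simps(5)) (simp add: signed_sum sum_negf)
      also have "\<dots> = bd y \<sigma>"
        unfolding koszul_def
      proof (rule sum.cong)
        fix l assume l: "l \<in> - \<sigma>"
        hence l': "l \<notin> \<tau>" "l \<noteq> j" "insert l \<sigma> - {j} = insert l \<tau>" using \<tau> by auto
        have "to_nat j \<noteq> to_nat l" using l' by simp
        hence "to_nat j < to_nat l \<or> to_nat l < to_nat j" by linarith
        thus "- signed (pos j \<tau> + pos l \<tau>) (z (insert l \<tau>)) = signed (pos l \<sigma>) (y (insert l \<sigma>))"
          using \<tau> l' by (auto simp: y_def pos_insert signed_def)
      qed simp
      finally show ?thesis by simp
    qed
  qed
  ultimately show "z \<in> boundaries \<Delta> q" by (auto simp: boundaries_def)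
qed

section \<open>Koszul complexes of submodules of free modules\<close>

interpretation free_mod: module free_scale
  by (rule module_free_scale)

text \<open>
  Divisibility of monomials in terms of their exponents.
\<close>

definition divides :: "('x \<Rightarrow>\<^sub>0 nat) \<Rightarrow> ('x \<Rightarrow>\<^sub>0 nat) \<Rightarrow> bool"
  where "divides e m \<longleftrightarrow> (\<forall>x. Poly_Mapping.lookup e x \<le> Poly_Mapping.lookup m x)"

lemma divides_add [simp]: "divides e (e + m)" "divides e (m + e)"
  by (auto simp: divides_def lookup_add)

lemma divides_iff: "divides e m \<longleftrightarrow> (\<exists>d. m = d + e)"
proof
  assume "divides e m"
  hence "m = (m - e) + e" by (intro poly_mapping_eqI) (auto simp: divides_def lookup_add lookup_minus)
  thus "\<exists>d. m = d + e" by blast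
qed auto

lemma divides_minus_add: "divides e m \<Longrightarrow> m - e + e = m"
  by (auto simp: divides_iff)

lemma minus_eq_iff_divides: "divides e m \<Longrightarrow> m - e = d \<longleftrightarrow> m = d + e"
  by (auto simp: divides_iff)

lemma divides_zero_iff: "divides e 0 \<longleftrightarrow> e = 0"
  by (auto simp: divides_def intro: poly_mapping_eqI)

lemma poly_mapping_sum_single: "p = (\<Sum>k\<in>Poly_Mapping.keys p. Poly_Mapping.single k (Poly_Mapping.lookup p k))"
proof (rule poly_mapping_eqI)
  fix k
  show "Poly_Mapping.lookup p k = Poly_Mapping.lookup (\<Sum>k\<in>Poly_Mapping.keys p. Poly_Mapping.single k (Poly_Mapping.lookup p k)) k"
    by (auto simp: lookup_sum lookup_single when_def in_keys_iff)
qed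

lemma lookup_single_mult:
  fixes p :: "('x, 'k::comm_ring_1) mpoly"
  shows "Poly_Mapping.lookup (Poly_Mapping.single e c * p) m
    = (if divides e m then c * Poly_Mapping.lookup p (m - e) else 0)"
proof -
  have "Poly_Mapping.single e c * p
      = (\<Sum>k\<in>Poly_Mapping.keys p. Poly_Mapping.single (e + k) (c * Poly_Mapping.lookup p k))"
    by (subst poly_mapping_sum_single[of p]) (simp add: sum_distrib_left mult_single)
  hence "Poly_Mapping.lookup (Poly_Mapping.single e c * p) m
     = (\<Sum>k\<in>Poly_Mapping.keys p. if e + k = m then c * Poly_Mapping.lookup p k else 0)"
    by (simp add: lookup_sum lookup_single when_def)
  also have "\<dots> = (if divides e m then c * Poly_Mapping.lookup p (m - e) else 0)"
  proof (cases "divides e m")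
    case True
    have eq: "e + k = m \<longleftrightarrow> k = m - e" for k
      using minus_eq_iff_divides[OF True, of k] by (auto simp: add.commute)
    show ?thesis using True unfolding eq by (auto simp: in_keys_iff)
  next
    case False
    hence "e + k \<noteq> m" for k by auto
    thus ?thesis using False by simp
  qed
  finally show ?thesis .
qed

lemma lookup_mult_at_zero:
  fixes p q :: "('x, 'k::comm_ring_1) mpoly"
  shows "Poly_Mapping.lookup (p * q) 0 = Poly_Mapping.lookup p 0 * Poly_Mapping.lookup q 0"
proof -
  have "p * q = (\<Sum>k\<in>Poly_Mapping.keys p. Poly_Mapping.single k (Poly_Mapping.lookup p k) * q)"
    by (subst poly_mapping_sum_single[of p]) (simp add: sum_distrib_right)
  thus ?thesis
    by (auto simp: lookup_sum lookup_single_mult divides_zero_iff in_keys_iff)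
qed

text \<open>
  The exponent of the squarefree monomial \<open>\<Prod>x\<in>\<sigma>. x\<close>.
\<close>

definition exponent :: "'x::finite set \<Rightarrow> ('x \<Rightarrow>\<^sub>0 nat)"
  where "exponent \<sigma> = (\<Sum>x\<in>\<sigma>. Poly_Mapping.single x 1)"

lemma lookup_exponent: "Poly_Mapping.lookup (exponent \<sigma>) x = (if x \<in> \<sigma> then 1 else 0)"
  by (simp add: exponent_def lookup_sum lookup_single when_def)

lemma divides_exponent_iff: "divides (exponent \<sigma>) a \<longleftrightarrow> (\<forall>x\<in>\<sigma>. 0 < Poly_Mapping.lookup a x)"
  unfolding divides_def lookup_exponent by (metis One_nat_def Suc_leI less_eq_Suc_le zero_le)

lemma exponent_insert: "j \<notin> \<sigma> \<Longrightarrow> exponent (insert j \<sigma>) = exponent \<sigma> + Poly_Mapping.single j 1"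
  by (simp add: exponent_def add.commute)

lemma exponent_empty [simp]: "exponent {} = 0"
  by (simp add: exponent_def)

text \<open>
  The coefficient of the monomial \<open>m\<close> in the \<open>b\<close>-th coordinate of \<open>f\<close>.
\<close>

definition coef :: "('b \<Rightarrow>\<^sub>0 ('x, 'k::zero) mpoly) \<Rightarrow> 'b \<Rightarrow> ('x \<Rightarrow>\<^sub>0 nat) \<Rightarrow> 'k"
  where "coef f b m = Poly_Mapping.lookup (Poly_Mapping.lookup f b) m"

lemma coef_eqI: "(\<And>b m. coef f b m = coef g b m) \<Longrightarrow> f = g"
  unfolding coef_def by (intro poly_mapping_eqI) simp

lemma coef_simps [simp]:
  "coef 0 b m = 0" "coef (f + g) b m = coef f b m + coef g b m"
  for f :: "'b \<Rightarrow>\<^sub>0 ('x, 'k::comm_ring_1) mpoly"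
  by (simp_all add: coef_def lookup_add)

lemma coef_diff [simp]: "coef (f - g) b m = coef f b m - coef g b m"
  for f :: "'b \<Rightarrow>\<^sub>0 ('x, 'k::comm_ring_1) mpoly"
  by (simp add: coef_def lookup_minus)

lemma coef_sum: "coef (sum f A) b m = (\<Sum>i\<in>A. coef (f i) b m)"
  for f :: "'i \<Rightarrow> 'b \<Rightarrow>\<^sub>0 ('x, 'k::comm_ring_1) mpoly"
  by (simp add: coef_def lookup_sum)

lemma coef_scale: "coef (free_scale (Poly_Mapping.single e c) f) b m
    = (if divides e m then c * coef f b (m - e) else 0)"
  for f :: "'b \<Rightarrow>\<^sub>0 ('x, 'k::comm_ring_1) mpoly"
  by (simp add: coef_def lookup_free_scale lookup_single_mult)

lemma coef_const: "coef (free_scale (const c) f) b m = c * coef f b m"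
  for f :: "'b \<Rightarrow>\<^sub>0 ('x, 'k::comm_ring_1) mpoly"
proof -
  have "divides 0 m" by (simp add: divides_def)
  thus ?thesis by (simp add: coef_scale)
qed

lemma coef_single: "coef (Poly_Mapping.single b' (Poly_Mapping.single m' c)) b m = (if b = b' \<and> m = m' then c else 0)"
  by (auto simp: coef_def lookup_single when_def)

text \<open>
  Multiplication by the variable \<open>j\<close> on a free module.
\<close>

definition var :: "'x \<Rightarrow> ('b \<Rightarrow>\<^sub>0 ('x, 'k::comm_ring_1) mpoly) \<Rightarrow> ('b \<Rightarrow>\<^sub>0 ('x, 'k) mpoly)"
  where "var j = free_scale (monomial (Poly_Mapping.single j 1))"

lemma var_additive: "additive (var j)"
  by (simp only: additive_def var_def free_mod.scale_right_distrib simp_thms)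

lemma var_commute: "var i (var j f) = var j (var i f)"
  unfolding var_def by (rule free_mod.scale_left_commute)

lemma free_scale_const_1 [simp]: "free_scale (const 1) f = f"
  by (metis free_mod.scale_one single_one)

interpretation const_space: vector_space "\<lambda>c :: 'k::field. free_scale (const c :: ('x, 'k) mpoly)"
  by unfold_locales
    (simp_all add: free_mod.scale_right_distrib single_add free_mod.scale_left_distrib mult_single)

definition fam_scale :: "'k::field \<Rightarrow> ('a \<Rightarrow> 'b \<Rightarrow>\<^sub>0 ('x, 'k) mpoly) \<Rightarrow> ('a \<Rightarrow> 'b \<Rightarrow>\<^sub>0 ('x, 'k) mpoly)"
  where "fam_scale c u = (\<lambda>\<sigma>. free_scale (const c) (u \<sigma>))"

lemma fam_scale_apply [simp]: "fam_scale c u \<sigma> = free_scale (const c) (u \<sigma>)"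
  by (simp add: fam_scale_def)

interpretation fam_space: vector_space fam_scale
  by unfold_locales
    (auto simp: fun_eq_iff const_space.scale_right_distrib const_space.scale_left_distrib mult_single)

text \<open>
  The Koszul complex of a submodule \<open>M\<close> of a free module: chains of degree \<open>q\<close> are families of
  elements of \<open>M\<close> that vanish outside the sets of cardinality \<open>q\<close>.
\<close>

abbreviation kd :: "('x::finite set \<Rightarrow> 'b \<Rightarrow>\<^sub>0 ('x, 'k::comm_ring_1) mpoly) \<Rightarrow> 'x set \<Rightarrow> 'b \<Rightarrow>\<^sub>0 ('x, 'k) mpoly"
  where "kd \<equiv> koszul var"

definition kchains :: "('b \<Rightarrow>\<^sub>0 ('x, 'k::comm_ring_1) mpoly) set \<Rightarrow> nat \<Rightarrow> ('x::finite set \<Rightarrow> 'b \<Rightarrow>\<^sub>0 ('x, 'k) mpoly) set"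
  where "kchains M q = {u. \<forall>\<sigma>. u \<sigma> \<in> M \<and> (card \<sigma> \<noteq> q \<longrightarrow> u \<sigma> = 0)}"

definition kcycles :: "('b \<Rightarrow>\<^sub>0 ('x, 'k::comm_ring_1) mpoly) set \<Rightarrow> nat \<Rightarrow> ('x::finite set \<Rightarrow> 'b \<Rightarrow>\<^sub>0 ('x, 'k) mpoly) set"
  where "kcycles M q = {u \<in> kchains M q. kd u = 0}"

definition kbounds :: "('b \<Rightarrow>\<^sub>0 ('x, 'k::comm_ring_1) mpoly) set \<Rightarrow> nat \<Rightarrow> ('x::finite set \<Rightarrow> 'b \<Rightarrow>\<^sub>0 ('x, 'k) mpoly) set"
  where "kbounds M q = kd ` kchains M (Suc q)"

lemma kd_kd: "kd (kd u) = 0"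
  by (rule ext, simp only: zero_fun_apply, rule koszul_koszul) (auto simp: var_additive var_commute)

lemmas kd_add = koszul_add[of var, OF var_additive]
lemmas kd_diff = koszul_diff[of var, OF var_additive]
lemmas kd_zero = koszul_zero[of var, OF var_additive]

lemma kd_module_hom:
  assumes "module_hom free_scale free_scale D"
  shows "kd (D \<circ> u) = D \<circ> kd u"
proof -
  interpret D: module_hom free_scale free_scale D by fact
  show ?thesis
    by (auto simp: koszul_def fun_eq_iff D.sum signed_def D.neg D.scale var_def intro!: sum.cong)
qed

lemma module_hom_scale_const: "module_hom free_scale free_scale (free_scale r :: ('b \<Rightarrow>\<^sub>0 'r::comm_ring_1) \<Rightarrow> _)"
  using free_mod.module_hom_scale_self .

lemma kd_scale: "kd (fam_scale c u) = fam_scale c (kd u)"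
  using kd_module_hom[OF module_hom_scale_const, of "const c" u] by (simp add: fam_scale_def comp_def)

abbreviation submodule :: "('b \<Rightarrow>\<^sub>0 'r::comm_ring_1) set \<Rightarrow> bool"
  where "submodule M \<equiv> module.subspace free_scale M"

lemma signed_mem: "submodule M \<Longrightarrow> f \<in> M \<Longrightarrow> signed n f \<in> M"
  by (auto simp: signed_def free_mod.subspace_neg)

lemma kd_mem:
  assumes "submodule M" "\<And>\<sigma>. u \<sigma> \<in> M" shows "kd u \<sigma> \<in> M"
  unfolding koszul_def var_def using assms
  by (intro free_mod.subspace_sum signed_mem free_mod.subspace_scale)

lemma kd_kchains:
  assumes "submodule M" "u \<in> kchains M (Suc q)" shows "kd u \<in> kchains M q"
proof -
  have "kd u \<sigma> = 0" if "card \<sigma> \<noteq> q" for \<sigma>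
    unfolding koszul_def
  proof (intro sum.neutral ballI)
    fix j assume "j \<in> -\<sigma>"
    hence "u (insert j \<sigma>) = 0" using assms(2) that by (auto simp: kchains_def)
    thus "signed (pos j \<sigma>) (var j (u (insert j \<sigma>))) = 0" by (simp add: additive.zero[OF var_additive])
  qed
  moreover have "kd u \<sigma> \<in> M" for \<sigma> using assms by (intro kd_mem) (auto simp: kchains_def)
  ultimately show ?thesis by (auto simp: kchains_def)
qed

lemma kd_kchains_0:
  assumes "u \<in> kchains M 0" shows "kd u = 0"
proof
  fix \<sigma>
  have "u (insert j \<sigma>) = 0" for j using assms by (auto simp: kchains_def)
  thus "kd u \<sigma> = 0 \<sigma>" by (simp add: koszul_def additive.zero[OF var_additive])
qed

lemma subspace_kchains:
  fixes M :: "('b \<Rightarrow>\<^sub>0 ('x::finite, 'k::field) mpoly) set"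
  assumes "submodule M"
  shows "fam_space.subspace (kchains M q)"
  by (rule fam_space.subspaceI)
    (auto simp: kchains_def free_mod.subspace_0[OF assms] free_mod.subspace_add[OF assms] free_mod.subspace_scale[OF assms])

lemma kd_hom: "module_hom fam_scale fam_scale kd"
  by unfold_locales (auto simp: kd_add kd_scale)

lemma subspace_kbounds:
  fixes M :: "('b \<Rightarrow>\<^sub>0 ('x::finite, 'k::field) mpoly) set"
  assumes "submodule M"
  shows "fam_space.subspace (kbounds M q)"
  unfolding kbounds_def by (intro module_hom.subspace_image[OF kd_hom] subspace_kchains assms)

lemma subspace_kcycles:
  fixes M :: "('b \<Rightarrow>\<^sub>0 ('x::finite, 'k::field) mpoly) set"
  assumes "submodule M"
  shows "fam_space.subspace (kcycles M q)"
proof -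
  have "kcycles M q = kchains M q \<inter> {u. kd u = 0}" by (auto simp: kcycles_def)
  thus ?thesis
    by (simp add: fam_space.subspace_inter subspace_kchains[OF assms] module_hom.subspace_kernel[OF kd_hom])
qed

section \<open>Multigraded decomposition of the Koszul complex\<close>

text \<open>
  The degrees of the multigrading are pairs \<open>(b, a)\<close> of a basis element and an exponent. A chain is
  homogeneous of degree \<open>(b, a)\<close> if its value at \<open>\<sigma>\<close> is a scalar multiple of the monomial \<open>x\<^bsup>a - \<sigma>\<^esup>\<close> in the
  \<open>b\<close>-th coordinate. Such a chain is a function from sets of variables to \<open>k\<close>; \<open>component\<close> and
  \<open>inject\<close> are the projection to these functions and the inclusion.
\<close>

definition component :: "'b \<times> ('x \<Rightarrow>\<^sub>0 nat) \<Rightarrow> ('x::finite set \<Rightarrow> 'b \<Rightarrow>\<^sub>0 ('x, 'k::zero) mpoly) \<Rightarrow> 'x set \<Rightarrow> 'k"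
  where "component i u \<sigma> = (if divides (exponent \<sigma>) (snd i) then coef (u \<sigma>) (fst i) (snd i - exponent \<sigma>) else 0)"

definition inject :: "'b \<times> ('x \<Rightarrow>\<^sub>0 nat) \<Rightarrow> ('x::finite set \<Rightarrow> 'k::zero) \<Rightarrow> 'x set \<Rightarrow> 'b \<Rightarrow>\<^sub>0 ('x, 'k) mpoly"
  where "inject i v \<sigma> = (if divides (exponent \<sigma>) (snd i)
    then Poly_Mapping.single (fst i) (Poly_Mapping.single (snd i - exponent \<sigma>) (v \<sigma>)) else 0)"

text \<open>
  The submodule spanned by the monomials \<open>m\<close> in coordinate \<open>b\<close> with \<open>(b, m) \<in> A\<close>. Both free modules
  and monomial ideals are of this form.
\<close>

definition mon_sub :: "('b \<times> ('x \<Rightarrow>\<^sub>0 nat)) set \<Rightarrow> ('b \<Rightarrow>\<^sub>0 ('x, 'k::zero) mpoly) set"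
  where "mon_sub A = {f. \<forall>b m. coef f b m \<noteq> 0 \<longrightarrow> (b, m) \<in> A}"

text \<open>
  The upper Koszul simplicial complex of \<open>mon_sub A\<close> in degree \<open>i\<close>.
\<close>

definition koszul_complex :: "('b \<times> ('x \<Rightarrow>\<^sub>0 nat)) set \<Rightarrow> 'b \<times> ('x \<Rightarrow>\<^sub>0 nat) \<Rightarrow> 'x::finite set set"
  where "koszul_complex A i = {\<sigma>. divides (exponent \<sigma>) (snd i) \<and> (fst i, snd i - exponent \<sigma>) \<in> A}"

lemma coef_inject:
  "coef (inject i v \<sigma>) b m = (if i = (b, m + exponent \<sigma>) then v \<sigma> else 0)"
  for v :: "'x::finite set \<Rightarrow> 'k::comm_ring_1"
proof (cases "divides (exponent \<sigma>) (snd i)")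
  case True
  thus ?thesis using minus_eq_iff_divides[OF True, of m]
    by (cases i) (auto simp: inject_def coef_single)
next
  case False
  hence "i \<noteq> (b, m + exponent \<sigma>)" by auto
  thus ?thesis using False by (simp add: inject_def)
qed

lemma component_add: "component i (u + v) = component i u + component i v"
  for u :: "'x::finite set \<Rightarrow> 'b \<Rightarrow>\<^sub>0 ('x, 'k::comm_ring_1) mpoly"
  by (auto simp: component_def fun_eq_iff)

lemma component_hom: "module_hom fam_scale fun_scale (component i)"
  by unfold_locales (auto simp: component_add fun_eq_iff component_def coef_const)

lemma inject_hom: "module_hom fun_scale fam_scale (inject i)"
  by unfold_locales (auto intro!: coef_eqI simp: coef_inject coef_const fun_eq_iff)

lemma component_inject:
  fixes v :: "'x::finite set \<Rightarrow> 'k::comm_ring_1"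
  assumes "\<And>\<sigma>. v \<sigma> \<noteq> 0 \<Longrightarrow> divides (exponent \<sigma>) (snd i)"
  shows "component i' (inject i v) = (if i = i' then v else 0)"
  using assms by (cases i; cases i') (auto simp: fun_eq_iff component_def coef_inject divides_minus_add)

lemma component_kd: "component i (kd u) = bd (component i u)"
  for u :: "'x::finite set \<Rightarrow> 'b \<Rightarrow>\<^sub>0 ('x, 'k::comm_ring_1) mpoly"
proof
  fix \<sigma>
  have signed_coef: "coef (signed n f) b m = signed n (coef f b m)" for n b m and f :: "'b \<Rightarrow>\<^sub>0 ('x, 'k) mpoly"
    using coef_diff[of 0 f b m] by (simp add: signed_def)
  obtain b a where i: "i = (b, a)" by force
  show "component i (kd u) \<sigma> = bd (component i u) \<sigma>"
  proof (cases "divides (exponent \<sigma>) a")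
    case True
    have "coef (var j (u (insert j \<sigma>))) b (a - exponent \<sigma>) = component i u (insert j \<sigma>)" if "j \<notin> \<sigma>" for j
    proof -
      obtain m where m: "a = m + exponent \<sigma>" using True divides_iff by blast
      have "divides (exponent (insert j \<sigma>)) a \<longleftrightarrow> divides (Poly_Mapping.single j 1) m"
        using that by (auto simp: exponent_insert m divides_def lookup_add)
      moreover have "a - exponent (insert j \<sigma>) = m - Poly_Mapping.single j 1"
        using that by (intro poly_mapping_eqI) (simp add: exponent_insert m lookup_minus lookup_add)
      ultimately show ?thesis
        unfolding var_def by (simp add: coef_scale component_def i m)
    qed
    thus ?thesis using True
      by (auto simp: i component_def[of _ "kd u"] koszul_def coef_sum signed_coef intro!: sum.cong)
  next
    case False
    hence "\<not> divides (exponent (insert j \<sigma>)) a" if "j \<notin> \<sigma>" for j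
      by (auto simp: divides_exponent_iff)
    thus ?thesis using False by (auto simp: i component_def koszul_def intro!: sum.neutral[symmetric])
  qed
qed

lemma inject_component:
  fixes u :: "'x::finite set \<Rightarrow> 'b \<Rightarrow>\<^sub>0 ('x, 'k::comm_ring_1) mpoly"
  shows "\<exists>T. finite T \<and> u = (\<Sum>i\<in>T. inject i (component i u)) \<and> (\<forall>i\<in>-T. component i u = 0)"
proof -
  define T where "T = (\<Union>\<sigma>. \<Union>b\<in>Poly_Mapping.keys (u \<sigma>). (\<lambda>m. (b, m + exponent \<sigma>)) ` Poly_Mapping.keys (Poly_Mapping.lookup (u \<sigma>) b))"
  have fin: "finite T" by (auto simp: T_def)
  have mem: "(b, m + exponent \<sigma>) \<in> T" if "coef (u \<sigma>) b m \<noteq> 0" for \<sigma> b m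
  proof -
    have "b \<in> Poly_Mapping.keys (u \<sigma>)" "m \<in> Poly_Mapping.keys (Poly_Mapping.lookup (u \<sigma>) b)"
      using that by (auto simp: coef_def in_keys_iff)
    thus ?thesis unfolding T_def by blast
  qed
  have "u = (\<Sum>i\<in>T. inject i (component i u))"
  proof (rule ext, rule coef_eqI)
    fix \<sigma> b m
    have "coef ((\<Sum>i\<in>T. inject i (component i u)) \<sigma>) b m
       = (\<Sum>i\<in>T. if i = (b, m + exponent \<sigma>) then component i u \<sigma> else 0)"
      by (simp add: sum_fun_apply coef_sum coef_inject)
    also have "\<dots> = (if (b, m + exponent \<sigma>) \<in> T then component (b, m + exponent \<sigma>) u \<sigma> else 0)"
      using sum.delta[OF fin, of "(b, m + exponent \<sigma>)" "\<lambda>i. component i u \<sigma>"] by simp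
    also have "component (b, m + exponent \<sigma>) u \<sigma> = coef (u \<sigma>) b m"
      by (simp add: component_def)
    also have "(if (b, m + exponent \<sigma>) \<in> T then coef (u \<sigma>) b m else 0) = coef (u \<sigma>) b m"
      using mem[of \<sigma> b m] by auto
    finally show "coef (u \<sigma>) b m = coef ((\<Sum>i\<in>T. inject i (component i u)) \<sigma>) b m" by simp
  qed
  moreover have "component i u = 0" if "i \<notin> T" for i
  proof
    fix \<sigma>
    show "component i u \<sigma> = 0 \<sigma>"
    proof (cases "divides (exponent \<sigma>) (snd i)")
      case True
      hence "i = (fst i, snd i - exponent \<sigma> + exponent \<sigma>)" by (simp add: divides_minus_add)
      hence "coef (u \<sigma>) (fst i) (snd i - exponent \<sigma>) = 0" using mem[of \<sigma> "fst i" "snd i - exponent \<sigma>"] that by auto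
      thus ?thesis by (simp add: component_def)
    qed (simp add: component_def)
  qed
  ultimately show ?thesis using fin by blast
qed

definition up_closed :: "('b \<times> ('x \<Rightarrow>\<^sub>0 nat)) set \<Rightarrow> bool"
  where "up_closed A \<longleftrightarrow> (\<forall>b m d. (b, m) \<in> A \<longrightarrow> (b, m + d) \<in> A)"

lemma mon_subI: "(\<And>b m. coef f b m \<noteq> 0 \<Longrightarrow> (b, m) \<in> A) \<Longrightarrow> f \<in> mon_sub A"
  by (auto simp: mon_sub_def)

lemma mon_subD: "f \<in> mon_sub A \<Longrightarrow> coef f b m \<noteq> 0 \<Longrightarrow> (b, m) \<in> A"
  by (auto simp: mon_sub_def)

lemma submodule_mon_sub:
  assumes A: "up_closed A"
  shows "submodule (mon_sub A :: ('b \<Rightarrow>\<^sub>0 ('x, 'k::comm_ring_1) mpoly) set)"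
proof (rule free_mod.subspaceI)
  show "(0 :: 'b \<Rightarrow>\<^sub>0 ('x, 'k) mpoly) \<in> mon_sub A" by (rule mon_subI) simp
next
  fix f g :: "'b \<Rightarrow>\<^sub>0 ('x, 'k) mpoly" assume "f \<in> mon_sub A" "g \<in> mon_sub A"
  thus "f + g \<in> mon_sub A"
    unfolding mon_sub_def by (auto, metis add.left_neutral)
next
  fix r :: "('x, 'k) mpoly" and f :: "'b \<Rightarrow>\<^sub>0 ('x, 'k) mpoly" assume f: "f \<in> mon_sub A"
  have "free_scale r f = (\<Sum>k\<in>Poly_Mapping.keys r. free_scale (Poly_Mapping.single k (Poly_Mapping.lookup r k)) f)"
    by (subst poly_mapping_sum_single[of r]) (rule free_mod.scale_sum_left)
  hence eq: "coef (free_scale r f) b m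
      = (\<Sum>k\<in>Poly_Mapping.keys r. if divides k m then Poly_Mapping.lookup r k * coef f b (m - k) else 0)" for b m
    by (simp add: coef_sum coef_scale)
  show "free_scale r f \<in> mon_sub A"
  proof (rule mon_subI)
    fix b m assume "coef (free_scale r f) b m \<noteq> 0"
    then obtain k where "(if divides k m then Poly_Mapping.lookup r k * coef f b (m - k) else 0) \<noteq> 0"
      unfolding eq by (rule sum.not_neutral_contains_not_neutral)
    hence "divides k m" "coef f b (m - k) \<noteq> 0" by (auto split: if_splits)
    hence "(b, m - k + k) \<in> A" using f A unfolding up_closed_def mon_sub_def by blast
    thus "(b, m) \<in> A" using \<open>divides k m\<close> by (simp add: divides_minus_add)
  qed
qed

lemma free_on_eq_mon_sub: "free_on B = mon_sub (B \<times> UNIV)"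
proof -
  have "Poly_Mapping.keys f \<subseteq> B \<longleftrightarrow> (\<forall>b m. coef f b m \<noteq> 0 \<longrightarrow> b \<in> B)" for f :: "'a \<Rightarrow>\<^sub>0 ('x, 'k::comm_ring_1) mpoly"
  proof -
    have "b \<in> Poly_Mapping.keys f \<longleftrightarrow> (\<exists>m. coef f b m \<noteq> 0)" for b
      by (metis coef_def in_keys_iff lookup_zero poly_mapping_eqI)
    thus ?thesis by blast
  qed
  thus ?thesis by (auto simp: free_on_def mon_sub_def)
qed

lemma koszul_complex_down_closed:
  assumes A: "up_closed A" and "\<sigma> \<in> koszul_complex A i" "\<tau> \<subseteq> \<sigma>"
  shows "\<tau> \<in> koszul_complex A i"
proof -
  obtain d where d: "snd i = d + exponent \<sigma>" "(fst i, d) \<in> A"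
    using assms(2) by (auto simp: koszul_complex_def divides_iff)
  have "exponent \<sigma> = exponent (\<sigma> - \<tau>) + exponent \<tau>"
    using assms(3) by (intro poly_mapping_eqI) (auto simp: lookup_add lookup_exponent)
  hence "snd i = (d + exponent (\<sigma> - \<tau>)) + exponent \<tau>" by (simp add: d add.assoc)
  thus ?thesis using A d by (auto simp: koszul_complex_def up_closed_def)
qed

lemma face_chains_divides: "v \<in> face_chains (koszul_complex A i) q \<Longrightarrow> v \<sigma> \<noteq> 0 \<Longrightarrow> divides (exponent \<sigma>) (snd i)"
  by (auto simp: face_chains_def koszul_complex_def)

lemma component_face_chains:
  "u \<in> kchains (mon_sub A) q \<Longrightarrow> component i u \<in> face_chains (koszul_complex A i) q"
  for u :: "'x::finite set \<Rightarrow> 'b \<Rightarrow>\<^sub>0 ('x, 'k::comm_ring_1) mpoly"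
  unfolding face_chains_def kchains_def
  by (auto simp: component_def koszul_complex_def mon_sub_def split: if_splits)

lemma inject_kchains:
  fixes v :: "'x::finite set \<Rightarrow> 'k::comm_ring_1"
  assumes "v \<in> face_chains (koszul_complex A i) q"
  shows "inject i v \<in> kchains (mon_sub A) q"
  unfolding kchains_def
proof (intro CollectI allI conjI impI)
  fix \<sigma> show "inject i v \<sigma> \<in> mon_sub A"
    using assms by (intro mon_subI) (auto simp: coef_inject face_chains_def koszul_complex_def split: if_splits)
next
  fix \<sigma> :: "'x set" assume "card \<sigma> \<noteq> q"
  hence "v \<sigma> = 0" using assms by (auto simp: face_chains_def)
  thus "inject i v \<sigma> = 0" by (simp add: inject_def)
qed

lemma component_eqI:
  fixes u v :: "'x::finite set \<Rightarrow> 'b \<Rightarrow>\<^sub>0 ('x, 'k::comm_ring_1) mpoly"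
  assumes "\<And>i. component i u = component i v"
  shows "u = v"
proof (rule ext, rule coef_eqI)
  fix \<sigma> b m
  show "coef (u \<sigma>) b m = coef (v \<sigma>) b m"
    using fun_cong[OF assms[of "(b, m + exponent \<sigma>)"], of \<sigma>] by (simp add: component_def)
qed

lemma bd_hom: "module_hom fun_scale fun_scale (bd :: ('x::finite set \<Rightarrow> 'k::field) \<Rightarrow> _)"
proof unfold_locales
  show "bd (u + v) = bd u + bd v" for u v :: "'x set \<Rightarrow> 'k" by (rule koszul_add[OF additive_id])
  show "bd (fun_scale c u) = fun_scale c (bd u)" for c and u :: "'x set \<Rightarrow> 'k"
    by (auto simp: koszul_def fun_eq_iff signed_def sum_distrib_left intro!: sum.cong)
qed

lemma kd_inject:
  fixes v :: "'x::finite set \<Rightarrow> 'k::field"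
  assumes A: "up_closed A" and v: "v \<in> face_chains (koszul_complex A i) (Suc q)"
  shows "kd (inject i v) = inject i (bd v)"
proof (rule component_eqI)
  fix i'
  have "bd v \<in> face_chains (koszul_complex A i) q"
    by (intro bd_face_chains v) (rule koszul_complex_down_closed[OF A])
  thus "component i' (kd (inject i v)) = component i' (inject i (bd v))"
    using v by (simp add: module_hom.zero[OF bd_hom] component_kd component_inject face_chains_divides)
qed

lemma subspace_face_chains: "fun_space.subspace (face_chains \<Delta> q)"
  by (rule fun_space.subspaceI) (auto simp: face_chains_def, metis add.left_neutral, metis add.left_neutral)

lemma subspace_boundaries: "fun_space.subspace (boundaries \<Delta> q)"
  unfolding boundaries_def by (rule module_hom.subspace_image[OF bd_hom subspace_face_chains])

lemma subspace_cycles: "fun_space.subspace (cycles \<Delta> q :: ('x::finite set \<Rightarrow> 'k::field) set)"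
proof -
  have "cycles \<Delta> q = face_chains \<Delta> q \<inter> {u :: 'x::finite set \<Rightarrow> 'k::field. bd u = 0}" by (auto simp: cycles_def)
  thus ?thesis
    by (simp add: fun_space.subspace_inter subspace_face_chains module_hom.subspace_kernel[OF bd_hom])
qed

lemma boundaries_subset_cycles:
  assumes "up_closed A"
  shows "boundaries (koszul_complex A i) q \<subseteq> cycles (koszul_complex A i) q"
  unfolding boundaries_def cycles_def
  using bd_face_chains[of "koszul_complex A i", OF koszul_complex_down_closed[OF assms]] by (auto simp: bd_bd)

lemma component_kcycles: "u \<in> kcycles (mon_sub A) q \<Longrightarrow> component i u \<in> cycles (koszul_complex A i) q"
  for u :: "'x::finite set \<Rightarrow> 'b \<Rightarrow>\<^sub>0 ('x, 'k::field) mpoly"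
  by (auto simp: kcycles_def cycles_def component_face_chains module_hom.zero[OF component_hom] simp flip: component_kd)

lemma component_kbounds: "u \<in> kbounds (mon_sub A) q \<Longrightarrow> component i u \<in> boundaries (koszul_complex A i) q"
  for u :: "'x::finite set \<Rightarrow> 'b \<Rightarrow>\<^sub>0 ('x, 'k::field) mpoly"
  by (auto simp: kbounds_def boundaries_def component_kd component_face_chains)

lemma inject_boundaries:
  fixes v :: "'x::finite set \<Rightarrow> 'k::field"
  assumes "up_closed A" "v \<in> boundaries (koszul_complex A i) q"
  shows "inject i v \<in> kbounds (mon_sub A) q"
  using assms by (auto simp: boundaries_def kbounds_def inject_kchains simp flip: kd_inject)

lemma inject_cycles:
  fixes v :: "'x::finite set \<Rightarrow> 'k::field"
  assumes A: "up_closed A" and v: "v \<in> cycles (koszul_complex A i) q"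
  shows "inject i v \<in> kcycles (mon_sub A) q"
proof -
  have c: "v \<in> face_chains (koszul_complex A i) q" "bd v = 0" using v by (auto simp: cycles_def)
  have "kd (inject i v) = 0"
  proof (cases q)
    case 0
    thus ?thesis using inject_kchains[OF c(1)] kd_kchains_0 by blast
  next
    case (Suc q')
    thus ?thesis using kd_inject[OF A, of v i q'] c by (simp add: module_hom.zero[OF inject_hom])
  qed
  thus ?thesis using inject_kchains[OF c(1)] by (auto simp: kcycles_def)
qed

text \<open>
  The Koszul homology of a monomial submodule is the direct sum of the homologies of its upper
  Koszul complexes, provided that all but finitely many of these homologies vanish.
\<close>

theorem has_qdim_koszul_mon_sub:
  fixes A :: "('b \<times> ('x::finite \<Rightarrow>\<^sub>0 nat)) set"
  assumes A: "up_closed A" and E: "finite E"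
    and triv: "\<And>i. i \<notin> E \<Longrightarrow> cycles (koszul_complex A i) q \<subseteq> (boundaries (koszul_complex A i) q :: ('x set \<Rightarrow> 'k::field) set)"
  shows "has_qdim fam_scale (kcycles (mon_sub A) q) (kbounds (mon_sub A) q :: ('x set \<Rightarrow> 'b \<Rightarrow>\<^sub>0 ('x, 'k::field) mpoly) set)
    (\<Sum>i\<in>E. quotient_dim fun_scale (cycles (koszul_complex A i) q) (boundaries (koszul_complex A i) q :: ('x set \<Rightarrow> 'k) set))"
proof (rule has_qdim_direct_sum[where \<pi> = component and \<iota> = inject
      and Z' = "\<lambda>i. cycles (koszul_complex A i) q" and W' = "\<lambda>i. boundaries (koszul_complex A i) q"])
  show "vector_space (fam_scale :: 'k \<Rightarrow> ('x set \<Rightarrow> 'b \<Rightarrow>\<^sub>0 ('x, 'k) mpoly) \<Rightarrow> _)" ..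
  show "vector_space (fun_scale :: 'k \<Rightarrow> ('x set \<Rightarrow> 'k) \<Rightarrow> _)" ..
  show "component b (inject a z) = (if a = b then z else 0)"
    if "z \<in> cycles (koszul_complex A a) q" for z :: "'x set \<Rightarrow> 'k" and a b
    using that by (intro component_inject) (auto simp: cycles_def face_chains_divides)
  show "\<exists>T. finite T \<and> z = (\<Sum>a\<in>T. inject a (component a z))" for z :: "'x set \<Rightarrow> 'b \<Rightarrow>\<^sub>0 ('x, 'k) mpoly"
    using inject_component by blast
  show "has_qdim fun_scale (cycles (koszul_complex A i) q) (boundaries (koszul_complex A i) q :: ('x set \<Rightarrow> 'k) set)
    (quotient_dim fun_scale (cycles (koszul_complex A i) q) (boundaries (koszul_complex A i) q :: ('x set \<Rightarrow> 'k) set))" for i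
    by (intro has_qdim_fun subspace_boundaries boundaries_subset_cycles A)
qed (auto intro!: component_hom inject_hom subspace_kcycles subspace_kbounds submodule_mon_sub A E
      subspace_cycles subspace_boundaries component_kbounds component_kcycles inject_boundaries inject_cycles triv[THEN subsetD])

lemma kbounds_mon_subI:
  fixes u :: "'x::finite set \<Rightarrow> 'b \<Rightarrow>\<^sub>0 ('x, 'k::field) mpoly"
  assumes A: "up_closed A" and "\<And>i. component i u \<in> boundaries (koszul_complex A i) q"
  shows "u \<in> kbounds (mon_sub A) q"
proof -
  obtain T where T: "u = (\<Sum>i\<in>T. inject i (component i u))" using inject_component by blast
  show ?thesis
    by (subst T) (intro fam_space.subspace_sum subspace_kbounds submodule_mon_sub A inject_boundaries assms(2))
qed

text \<open>
  Reduction modulo the ideal generated by the variables: the constant coefficients.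
\<close>

definition red :: "('b \<Rightarrow>\<^sub>0 ('x, 'k::zero) mpoly) \<Rightarrow> 'b \<Rightarrow> 'k"
  where "red f b = coef f b 0"

lemma up_closed_Times: "up_closed (B \<times> UNIV)"
  by (auto simp: up_closed_def)

lemma submodule_free_on: "submodule (free_on B :: ('b \<Rightarrow>\<^sub>0 ('x, 'k::comm_ring_1) mpoly) set)"
  unfolding free_on_eq_mon_sub by (intro submodule_mon_sub up_closed_Times)

text \<open>
  For a free module, the upper Koszul complex in degree \<open>(b, a)\<close> is the full simplex on the support
  of \<open>a\<close>, or empty if \<open>b \<notin> B\<close>. It has a cone point unless \<open>a = 0\<close>, so the
  Koszul complex is exact in positive degrees, and in degree \<open>0\<close> the homology is given by \<open>red\<close>.
\<close>

lemma kcycles_free_on_exact: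
  fixes u :: "'x::finite set \<Rightarrow> 'b \<Rightarrow>\<^sub>0 ('x, 'k::field) mpoly"
  assumes u: "u \<in> kcycles (free_on B) q" and q: "q = 0 \<Longrightarrow> red (u {}) = 0"
  shows "u \<in> kbounds (free_on B) q"
  unfolding free_on_eq_mon_sub
proof (intro kbounds_mon_subI up_closed_Times)
  fix i :: "'b \<times> ('x \<Rightarrow>\<^sub>0 nat)"
  let ?\<Delta> = "koszul_complex (B \<times> UNIV) i"
  have cyc: "component i u \<in> cycles ?\<Delta> q"
    using u unfolding free_on_eq_mon_sub by (rule component_kcycles)
  show "component i u \<in> boundaries ?\<Delta> q"
  proof (cases "snd i = 0")
    case True
    have "component i u \<sigma> = 0" for \<sigma>
    proof (rule ccontr)
      assume nz: "component i u \<sigma> \<noteq> 0"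
      hence "divides (exponent \<sigma>) 0" "card \<sigma> = q"
        using cyc True by (auto simp: cycles_def face_chains_def koszul_complex_def)
      hence "\<sigma> = {}" "q = 0" by (auto simp: divides_exponent_iff)
      thus False using nz fun_cong[OF q, of "fst i"] by (auto simp: component_def True red_def split: if_splits)
    qed
    hence "component i u = 0" by auto
    thus ?thesis by (simp add: fun_space.subspace_0 subspace_boundaries)
  next
    case False
    then obtain j where "Poly_Mapping.lookup (snd i) j \<noteq> 0" by (metis lookup_zero poly_mapping_eqI)
    hence "cone_point ?\<Delta> j"
      by (auto simp: cone_point_def koszul_complex_def divides_exponent_iff)
    thus ?thesis using cone_cycles_subset_boundaries cyc by blast
  qed
qed

section \<open>Dimension shifting\<close>

lemma kchains_lift:
  assumes "z \<in> kchains (D ` F) q" "0 \<in> F" "D 0 = 0"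
  obtains u where "u \<in> kchains F q" "D \<circ> u = z"
proof -
  have "\<exists>f. f \<in> F \<and> D f = z \<sigma> \<and> (card \<sigma> \<noteq> q \<longrightarrow> f = 0)" for \<sigma>
  proof (cases "card \<sigma> = q")
    case True
    have "z \<sigma> \<in> D ` F" using assms(1) by (simp add: kchains_def)
    then obtain f where "f \<in> F" "z \<sigma> = D f" by blast
    thus ?thesis using True by (intro exI[of _ f]) simp
  next
    case False
    hence "z \<sigma> = 0" using assms(1) by (simp add: kchains_def)
    thus ?thesis using assms(2,3) by (intro exI[of _ 0]) simp
  qed
  then obtain u where "\<And>\<sigma>. u \<sigma> \<in> F \<and> D (u \<sigma>) = z \<sigma> \<and> (card \<sigma> \<noteq> q \<longrightarrow> u \<sigma> = 0)" by metis
  thus thesis by (intro that[of u]) (auto simp: kchains_def)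
qed

lemma submodule_image: "module_hom free_scale free_scale D \<Longrightarrow> submodule M \<Longrightarrow> submodule (D ` M)"
  by (rule module_hom.subspace_image)

lemma submodule_kernel:
  assumes "module_hom free_scale free_scale D" "submodule M"
  shows "submodule {u \<in> M. D u = 0}"
proof -
  have "{u \<in> M. D u = 0} = M \<inter> {u. D u = 0}" by auto
  thus ?thesis using free_mod.subspace_inter[OF assms(2) module_hom.subspace_kernel[OF assms(1)]] by simp
qed

lemma fam_hom_comp:
  assumes "module_hom free_scale free_scale D"
  shows "D \<circ> (u + v) = (D \<circ> u) + (D \<circ> v)" "D \<circ> (u - v) = (D \<circ> u) - (D \<circ> v)"
    "D \<circ> fam_scale c u = fam_scale c (D \<circ> u)" "D \<circ> 0 = 0"
  by (auto simp: fun_eq_iff module_hom.add[OF assms] module_hom.diff[OF assms]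
      module_hom.scale[OF assms] module_hom.zero[OF assms])

text \<open>
  The connecting homomorphism of \<open>0 \<rightarrow> L \<rightarrow> F \<rightarrow> M \<rightarrow> 0\<close> maps the homology of \<open>M\<close> in degree \<open>q + 1\<close> onto
  the kernel of \<open>H\<^sub>q(L) \<rightarrow> H\<^sub>q(F)\<close>, injectively because \<open>H\<^bsub>q+1\<^esub>(F) = 0\<close>.
  For \<open>q = 0\<close> this kernel is not all of \<open>H\<^sub>0(L)\<close>, therefore it is kept in the statement.
\<close>

lemma has_qdim_shift:
  fixes D :: "('b \<Rightarrow>\<^sub>0 ('x::finite, 'k::field) mpoly) \<Rightarrow> ('c \<Rightarrow>\<^sub>0 ('x, 'k) mpoly)"
  assumes D: "module_hom free_scale free_scale D"
    and F: "F = free_on B" and M: "M = D ` F" and L: "L = {u \<in> F. D u = 0}"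
    and "has_qdim fam_scale (kcycles M (Suc q)) (kbounds M (Suc q)) n"
  shows "has_qdim fam_scale (kcycles L q \<inter> kbounds F q) (kbounds L q) n"
proof -
  have sF: "submodule F" using F submodule_free_on by blast
  have sM: "submodule M" using submodule_image[OF D sF] M by simp
  have sL: "submodule L" using submodule_kernel[OF D sF] L by simp
  have LF: "L \<subseteq> F" using L by auto
  note comp = fam_hom_comp[OF D]
  have kD: "kd (D \<circ> u) = D \<circ> kd u" for u using kd_module_hom[OF D] .
  have L_iff: "u \<in> kchains L p \<longleftrightarrow> u \<in> kchains F p \<and> D \<circ> u = 0" for u p
    by (auto simp: kchains_def L fun_eq_iff)
  have M_in: "D \<circ> u \<in> kchains M p" if "u \<in> kchains F p" for u p
    using that module_hom.zero[OF D] by (auto simp: kchains_def M)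
  have M_lift: "\<exists>u\<in>kchains F p. D \<circ> u = z" if "z \<in> kchains M p" for z p
    using kchains_lift[of z D F p] that M free_mod.subspace_0[OF sF] module_hom.zero[OF D] by metis
  define P where "P z w \<longleftrightarrow> (\<exists>u\<in>kchains F (Suc q). D \<circ> u = z \<and> kd u = w)" for z w
  show ?thesis
  proof (rule has_qdim_transport[where P = P, OF _ _ _ _ _ _ _ _ _ assms(5)])
    show "vector_space (fam_scale :: 'k \<Rightarrow> ('x set \<Rightarrow> 'b \<Rightarrow>\<^sub>0 ('x, 'k) mpoly) \<Rightarrow> _)"
      "vector_space (fam_scale :: 'k \<Rightarrow> ('x set \<Rightarrow> 'c \<Rightarrow>\<^sub>0 ('x, 'k) mpoly) \<Rightarrow> _)" by unfold_locales
    show "fam_space.subspace (kcycles M (Suc q))" "fam_space.subspace (kbounds L q)"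
      "fam_space.subspace (kcycles L q \<inter> kbounds F q)"
      by (intro subspace_kcycles subspace_kbounds fam_space.subspace_inter sM sL sF)+
    show "linear_rel fam_scale fam_scale P"
      unfolding linear_rel_def
    proof (intro conjI allI impI)
      have z: "0 \<in> kchains F (Suc q)" by (rule fam_space.subspace_0[OF subspace_kchains[OF sF]])
      show "P 0 0" unfolding P_def by (rule bexI[OF _ z]) (simp add: comp kd_zero)
    next
      fix x y x' y' assume "P x y" "P x' y'"
      then obtain u u' where "u \<in> kchains F (Suc q)" "D \<circ> u = x" "kd u = y"
        "u' \<in> kchains F (Suc q)" "D \<circ> u' = x'" "kd u' = y'" by (auto simp: P_def)
      thus "P (x + x') (y + y')" unfolding P_def
        by (intro bexI[of _ "u + u'"] fam_space.subspace_add[OF subspace_kchains[OF sF]]) (auto simp: comp kd_add)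
    next
      fix c x y assume "P x y"
      then obtain u where "u \<in> kchains F (Suc q)" "D \<circ> u = x" "kd u = y" by (auto simp: P_def)
      thus "P (fam_scale c x) (fam_scale c y)" unfolding P_def
        by (intro bexI[of _ "fam_scale c u"] fam_space.subspace_scale[OF subspace_kchains[OF sF]]) (auto simp: comp kd_scale)
    qed
  next
    fix z assume z: "z \<in> kcycles M (Suc q)"
    then obtain u where u: "u \<in> kchains F (Suc q)" "D \<circ> u = z" using M_lift by (auto simp: kcycles_def)
    have "kd u \<in> kchains F q" using kd_kchains[OF sF u(1)] .
    moreover have "D \<circ> kd u = 0" using kD[of u] z u by (simp add: kcycles_def)
    ultimately have "kd u \<in> kcycles L q \<inter> kbounds F q" using u by (auto simp: kcycles_def L_iff kd_kd kbounds_def)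
    thus "\<exists>z'\<in>kcycles L q \<inter> kbounds F q. P z z'" using u by (auto simp: P_def)
  next
    fix w assume w: "w \<in> kcycles L q \<inter> kbounds F q"
    then obtain u where u: "u \<in> kchains F (Suc q)" "w = kd u" by (auto simp: kbounds_def)
    have "kd (D \<circ> u) = 0" using w by (simp add: kD u(2)[symmetric] kcycles_def L_iff)
    thus "\<exists>z\<in>kcycles M (Suc q). P z w" using u M_in[OF u(1)] by (auto simp: P_def kcycles_def)
  next
    fix z w assume z: "z \<in> kcycles M (Suc q)" and w: "w \<in> kcycles L q \<inter> kbounds F q" and "P z w"
    then obtain u where u: "u \<in> kchains F (Suc q)" "D \<circ> u = z" "kd u = w" by (auto simp: P_def)
    show "z \<in> kbounds M (Suc q) \<longleftrightarrow> w \<in> kbounds L q"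
    proof
      assume "z \<in> kbounds M (Suc q)"
      then obtain y where y: "y \<in> kchains M (Suc (Suc q))" "z = kd y" by (auto simp: kbounds_def)
      then obtain y' where y': "y' \<in> kchains F (Suc (Suc q))" "D \<circ> y' = y" using M_lift by blast
      have "u - kd y' \<in> kchains L (Suc q)"
        unfolding L_iff using fam_space.subspace_diff[OF subspace_kchains[OF sF] u(1) kd_kchains[OF sF y'(1)]]
          y y' u kD[of y'] by (simp add: comp)
      moreover have "kd (u - kd y') = w" using u by (simp add: kd_diff kd_kd)
      ultimately show "w \<in> kbounds L q" unfolding kbounds_def by blast
    next
      assume "w \<in> kbounds L q"
      then obtain v where v: "v \<in> kchains L (Suc q)" "w = kd v" by (auto simp: kbounds_def)
      have "u - v \<in> kcycles F (Suc q)"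
        unfolding kcycles_def using fam_space.subspace_diff[OF subspace_kchains[OF sF] u(1)] v u
        by (auto simp: L_iff kd_diff)
      hence "u - v \<in> kbounds F (Suc q)" unfolding F by (rule kcycles_free_on_exact) simp
      then obtain y' where y': "y' \<in> kchains F (Suc (Suc q))" "u - v = kd y'" by (auto simp: kbounds_def)
      have "z = D \<circ> (u - v)" using u v by (simp add: comp L_iff)
      also have "\<dots> = kd (D \<circ> y')" using y' kD by simp
      finally show "z \<in> kbounds M (Suc q)" using M_in[OF y'(1)] by (auto simp: kbounds_def)
    qed
  qed
qed

lemma has_qdim_iterated_shift:
  fixes D :: "nat \<Rightarrow> (nat \<Rightarrow>\<^sub>0 ('x::finite, 'k::field) mpoly) \<Rightarrow> (nat \<Rightarrow>\<^sub>0 ('x, 'k) mpoly)"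
  assumes D: "\<And>j. module_hom free_scale free_scale (D j)"
    and exact: "\<And>j. D (Suc j) ` free_on (B (Suc j)) = {u \<in> free_on (B j). D j u = 0}"
    and n: "has_qdim fam_scale (kcycles (D 0 ` free_on (B 0)) (q + j)) (kbounds (D 0 ` free_on (B 0)) (q + j)) n"
    and q: "q > 0"
  shows "has_qdim fam_scale (kcycles (D j ` free_on (B j)) q) (kbounds (D j ` free_on (B j)) q) n"
  using n q
proof (induction j arbitrary: q)
  case 0
  thus ?case by simp
next
  case (Suc j)
  let ?L = "{u \<in> free_on (B j). D j u = 0}"
  have "has_qdim fam_scale (kcycles (D j ` free_on (B j)) (Suc q)) (kbounds (D j ` free_on (B j)) (Suc q)) n"
    by (rule Suc.IH) (use Suc.prems in simp_all)
  from has_qdim_shift[OF D refl refl refl this]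
  have "has_qdim fam_scale (kcycles ?L q \<inter> kbounds (free_on (B j)) q) (kbounds ?L q) n" .
  moreover have "kcycles ?L q \<subseteq> kbounds (free_on (B j)) q"
  proof
    fix u assume "u \<in> kcycles ?L q"
    hence "u \<in> kcycles (free_on (B j)) q" by (auto simp: kcycles_def kchains_def)
    thus "u \<in> kbounds (free_on (B j)) q" using Suc.prems by (intro kcycles_free_on_exact) auto
  qed
  hence "kcycles ?L q \<inter> kbounds (free_on (B j)) q = kcycles ?L q" by blast
  ultimately show ?case unfolding exact by (simp only:)
qed

section \<open>Tensor products with the residue field\<close>

lemma red_simps [simp]: "red 0 = 0" "red (f + g) = red f + red g" "red (f - g) = red f - red g"
  for f :: "'b \<Rightarrow>\<^sub>0 ('x, 'k::comm_ring_1) mpoly"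
  by (auto simp: red_def fun_eq_iff)

lemma red_scale: "red (free_scale r f) = (\<lambda>b. Poly_Mapping.lookup r 0 * red f b)"
  for f :: "'b \<Rightarrow>\<^sub>0 ('x, 'k::comm_ring_1) mpoly"
  by (auto simp: red_def coef_def lookup_free_scale lookup_mult_at_zero)

lemma red_sum: "red (sum f A) = (\<Sum>i\<in>A. red (f i))"
  for f :: "'i \<Rightarrow> 'b \<Rightarrow>\<^sub>0 ('x, 'k::comm_ring_1) mpoly"
  by (induction A rule: infinite_finite_induct) auto

lemma single_Suc_0_neq_0 [simp]: "Poly_Mapping.single j (Suc 0) \<noteq> 0"
  by (metis lookup_single_eq lookup_zero nat.distinct(1))

lemma red_var: "red (var j f) = 0"
  by (auto simp: var_def red_scale lookup_single when_def fun_eq_iff)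

lemma red_signed: "red f = 0 \<Longrightarrow> red (signed n f) = 0"
  for f :: "'b \<Rightarrow>\<^sub>0 ('x, 'k::comm_ring_1) mpoly"
  using red_simps(3)[of 0 f] by (simp add: signed_def)

lemma red_kd: "red (kd v \<sigma>) = 0"
  unfolding koszul_def red_sum by (intro sum.neutral ballI red_signed red_var)

text \<open>
  An element as a Koszul chain of degree \<open>0\<close>.
\<close>

definition at_empty :: "'m::zero \<Rightarrow> 'x set \<Rightarrow> 'm"
  where "at_empty f \<sigma> = (if \<sigma> = {} then f else 0)"

lemma at_empty_empty [simp]: "at_empty f {} = f"
  by (simp add: at_empty_def)

lemma kchains_0_iff:
  assumes "submodule M"
  shows "w \<in> kchains M 0 \<longleftrightarrow> (\<exists>f\<in>M. w = at_empty f)"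
proof
  assume w: "w \<in> kchains M 0"
  hence "w \<sigma> = at_empty (w {}) \<sigma>" for \<sigma> by (auto simp: kchains_def at_empty_def)
  hence "w = at_empty (w {})" by blast
  thus "\<exists>f\<in>M. w = at_empty f" using w by (auto simp: kchains_def)
next
  assume "\<exists>f\<in>M. w = at_empty f"
  thus "w \<in> kchains M 0" by (auto simp: kchains_def at_empty_def free_mod.subspace_0[OF assms] split: if_splits)
qed

lemma kcycles_0: "kcycles M 0 = kchains M 0"
  by (auto simp: kcycles_def kd_kchains_0)

lemma at_empty_kbounds_free_on:
  fixes f :: "'b \<Rightarrow>\<^sub>0 ('x::finite, 'k::field) mpoly"
  assumes "f \<in> free_on B"
  shows "at_empty f \<in> kbounds (free_on B) 0 \<longleftrightarrow> red f = 0"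
proof
  assume "at_empty f \<in> kbounds (free_on B) 0"
  then obtain v where "at_empty f = kd v" by (auto simp: kbounds_def)
  hence "f = kd v {}" by (metis at_empty_empty)
  thus "red f = 0" by (simp add: red_kd)
next
  assume "red f = 0"
  thus "at_empty f \<in> kbounds (free_on B) 0"
    using assms by (intro kcycles_free_on_exact) (auto simp: kcycles_0 kchains_0_iff[OF submodule_free_on] at_empty_def)
qed

text \<open>
  An element of a free module whose constant coefficients vanish is a combination of the variables.
\<close>

lemma red_eq_0_obtain:
  fixes f :: "'b \<Rightarrow>\<^sub>0 ('x::finite, 'k::field) mpoly"
  assumes "f \<in> free_on B" "red f = 0"
  obtains v where "\<And>j. v j \<in> free_on B" "f = (\<Sum>j\<in>UNIV. var j (v j))"
proof -
  obtain v where v: "v \<in> kchains (free_on B) (Suc 0)" "at_empty f = kd v"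
    using at_empty_kbounds_free_on[OF assms(1)] assms(2) by (auto simp: kbounds_def)
  have "f = kd v {}" using v(2) by (metis at_empty_empty)
  also have "\<dots> = (\<Sum>j\<in>UNIV. var j (v {j}))" by (simp add: koszul_def pos_def signed_def)
  finally show thesis using v(1) by (intro that[of "\<lambda>j. v {j}"]) (auto simp: kchains_def)
qed

lemma red_hom_eq_0:
  fixes D :: "('b \<Rightarrow>\<^sub>0 ('x::finite, 'k::field) mpoly) \<Rightarrow> ('c \<Rightarrow>\<^sub>0 ('x, 'k) mpoly)"
  assumes D: "module_hom free_scale free_scale D" and "red f = 0"
  shows "red (D f) = 0"
proof -
  obtain v where "f = (\<Sum>j\<in>UNIV. var j (v j))"
    using red_eq_0_obtain[of f UNIV] assms(2) by (auto simp: free_on_def)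
  hence "D f = (\<Sum>j\<in>UNIV. var j (D (v j)))"
    by (simp add: module_hom.sum[OF D] var_def module_hom.scale[OF D])
  thus ?thesis by (simp add: red_sum red_var)
qed

text \<open>
  The linear map \<open>f \<otimes> c \<mapsto> c f\<close>. It does not respect the relations of the tensor product with the
  residue field, but \<open>red \<circ> tensor_val\<close> does, and identifies \<open>F \<otimes> k\<close> with \<open>F/mF\<close>, where \<open>m\<close> is the ideal
  generated by the variables.
\<close>

definition tensor_val :: "(('b \<Rightarrow>\<^sub>0 ('x, 'k::comm_ring_1) mpoly) \<times> 'k \<Rightarrow>\<^sub>0 ('x, 'k) mpoly) \<Rightarrow> ('b \<Rightarrow>\<^sub>0 ('x, 'k) mpoly)"
  where "tensor_val t = (\<Sum>p\<in>Poly_Mapping.keys t. free_scale (Poly_Mapping.lookup t p * const (snd p)) (fst p))"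

lemma tensor_val_superset:
  "finite T \<Longrightarrow> Poly_Mapping.keys t \<subseteq> T \<Longrightarrow>
    tensor_val t = (\<Sum>p\<in>T. free_scale (Poly_Mapping.lookup t p * const (snd p)) (fst p))"
  unfolding tensor_val_def by (intro sum.mono_neutral_left) (auto simp: in_keys_iff)

lemma tensor_val_hom:
  "module_hom free_scale free_scale
    (tensor_val :: (('b \<Rightarrow>\<^sub>0 ('x, 'k::comm_ring_1) mpoly) \<times> 'k \<Rightarrow>\<^sub>0 ('x, 'k) mpoly) \<Rightarrow> _)"
proof unfold_locales
  fix t u :: "('b \<Rightarrow>\<^sub>0 ('x, 'k) mpoly) \<times> 'k \<Rightarrow>\<^sub>0 ('x, 'k) mpoly"
  let ?T = "Poly_Mapping.keys t \<union> Poly_Mapping.keys u"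
  have "Poly_Mapping.keys (t + u) \<subseteq> ?T" by (rule keys_add)
  thus "tensor_val (t + u) = tensor_val t + tensor_val u"
    by (simp add: tensor_val_superset[of ?T] lookup_add distrib_right free_mod.scale_left_distrib sum.distrib)
next
  fix r and t :: "('b \<Rightarrow>\<^sub>0 ('x, 'k) mpoly) \<times> 'k \<Rightarrow>\<^sub>0 ('x, 'k) mpoly"
  have "Poly_Mapping.keys (free_scale r t) \<subseteq> Poly_Mapping.keys t"
    by (auto simp: in_keys_iff lookup_free_scale)
  thus "tensor_val (free_scale r t) = free_scale r (tensor_val t)"
    by (simp add: tensor_val_superset[of "Poly_Mapping.keys t"] lookup_free_scale mult.assoc
        flip: free_mod.scale_sum_right free_mod.scale_scale)
qed

lemmas tensor_val_simps = module_hom.add[OF tensor_val_hom] module_hom.diff[OF tensor_val_hom]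
  module_hom.scale[OF tensor_val_hom] module_hom.zero[OF tensor_val_hom] module_hom.sum[OF tensor_val_hom]

lemma tensor_val_single: "tensor_val (Poly_Mapping.single (f, c) r) = free_scale (r * const c) f"
  by (subst tensor_val_superset[of "{(f, c)}"]) auto

lemma tensor_val_single_1: "tensor_val (Poly_Mapping.single (f, c) 1) = free_scale (const c) f"
  by (simp add: tensor_val_single)

lemma tensor_val_mem:
  assumes "submodule F" "t \<in> free_on (F \<times> UNIV)"
  shows "tensor_val t \<in> F"
  unfolding tensor_val_def using assms
  by (intro free_mod.subspace_sum free_mod.subspace_scale) (auto simp: free_on_def)

lemma tensor_val_tensor_map:
  assumes D: "module_hom free_scale free_scale D"
  shows "tensor_val (tensor_map D t) = D (tensor_val t)"
proof -
  have "tensor_val (tensor_map D t)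
     = (\<Sum>(f, c)\<in>Poly_Mapping.keys t. free_scale (Poly_Mapping.lookup t (f, c) * const c) (D f))"
    unfolding tensor_map_def tensor_val_simps by (auto simp: tensor_val_single intro!: sum.cong)
  also have "\<dots> = D (tensor_val t)"
    by (auto simp: tensor_val_def module_hom.sum[OF D] module_hom.scale[OF D] intro!: sum.cong)
  finally show ?thesis .
qed

lemma tensor_map_single: "tensor_map D (Poly_Mapping.single (f, c) r) = Poly_Mapping.single (D f, c) r"
  by (cases "r = 0") (auto simp: tensor_map_def)

lemma tensor_map_mem:
  fixes t :: "('b \<Rightarrow>\<^sub>0 ('x, 'k::comm_ring_1) mpoly) \<times> 'k \<Rightarrow>\<^sub>0 ('x, 'k) mpoly"
  assumes "D ` F \<subseteq> F'" "t \<in> free_on (F \<times> UNIV)"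
  shows "tensor_map D t \<in> free_on (F' \<times> UNIV)"
proof -
  have "Poly_Mapping.single (D (fst p), snd p) (Poly_Mapping.lookup t p) \<in> free_on (F' \<times> UNIV)"
    if "p \<in> Poly_Mapping.keys t" for p
  proof -
    have "fst p \<in> F" using assms(2) that by (auto simp: free_on_def)
    thus ?thesis using assms(1) by (auto simp: free_on_def)
  qed
  thus ?thesis
    unfolding tensor_map_def case_prod_unfold
    by (intro free_mod.subspace_sum[OF submodule_free_on]) auto
qed

lemma single_free_on: "p \<in> S \<Longrightarrow> Poly_Mapping.single p r \<in> free_on S"
  by (auto simp: free_on_def)

context
  fixes F :: "('b \<Rightarrow>\<^sub>0 ('x::finite, 'k::field) mpoly) set" and N B
  assumes F: "F = free_on B" and N: "N = tensor_rel free_scale F (residue_scale :: ('x, 'k) mpoly \<Rightarrow> _) UNIV"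
begin

lemma submodule_N: "submodule N"
  unfolding N tensor_rel_def by (rule free_mod.subspace_span)

lemma F_closed: "submodule F"
  unfolding F by (rule submodule_free_on)

lemma tensor_rel_subset: "N \<subseteq> {t \<in> free_on (F \<times> UNIV). red (tensor_val t) = 0}"
proof -
  let ?K = "{t \<in> free_on (F \<times> (UNIV :: 'k set)). red (tensor_val t) = 0}"
  have K: "submodule ?K"
    by (rule free_mod.subspaceI)
      (auto simp: tensor_val_simps red_scale fun_eq_iff free_mod.subspace_0[OF submodule_free_on]
        free_mod.subspace_add[OF submodule_free_on] free_mod.subspace_scale[OF submodule_free_on])
  note cl = free_mod.subspace_add[OF F_closed] free_mod.subspace_scale[OF F_closed]
    free_mod.subspace_diff[OF submodule_free_on] free_mod.subspace_scale[OF submodule_free_on] single_free_on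
  show ?thesis
    unfolding N tensor_rel_def
  proof (rule free_mod.span_minimal[OF _ K], intro Un_least subsetI)
    fix t assume "t \<in> {Poly_Mapping.single (x + x', y) 1 - Poly_Mapping.single (x, y) 1 -
      Poly_Mapping.single (x', y) (1::('x, 'k) mpoly) |x x' (y::'k). x \<in> F \<and> x' \<in> F \<and> y \<in> UNIV}"
    then obtain x x' y where t: "t = Poly_Mapping.single (x + x', y) 1 - Poly_Mapping.single (x, y) 1 -
      Poly_Mapping.single (x', y) (1::('x, 'k) mpoly)"
      and mem: "x \<in> F" "x' \<in> F" by blast
    have "t \<in> free_on (F \<times> UNIV)" unfolding t using mem by (intro cl) (auto intro: cl)
    moreover have "red (tensor_val t) = 0" unfolding t
      by (simp add: tensor_val_simps tensor_val_single_1 red_scale residue_scale_def lookup_mult_at_zero algebra_simps fun_eq_iff)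
    ultimately show "t \<in> ?K" by blast
  next
    fix t assume "t \<in> {Poly_Mapping.single (x, y + y') 1 - Poly_Mapping.single (x, y) 1 -
      Poly_Mapping.single (x, y') (1::('x, 'k) mpoly) |x y (y'::'k). x \<in> F \<and> y \<in> UNIV \<and> y' \<in> UNIV}"
    then obtain x y y' where t: "t = Poly_Mapping.single (x, y + y') 1 - Poly_Mapping.single (x, y) 1 -
      Poly_Mapping.single (x, y') (1::('x, 'k) mpoly)"
      and mem: "x \<in> F" by blast
    have "t \<in> free_on (F \<times> UNIV)" unfolding t using mem by (intro cl) (auto intro: cl)
    moreover have "red (tensor_val t) = 0" unfolding t
      by (simp add: tensor_val_simps tensor_val_single_1 red_scale residue_scale_def lookup_mult_at_zero algebra_simps fun_eq_iff)
    ultimately show "t \<in> ?K" by blast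
  next
    fix t assume "t \<in> {Poly_Mapping.single (free_scale a x, y) 1 - free_scale a (Poly_Mapping.single (x, y) 1) |(a::('x, 'k) mpoly) x (y::'k). x \<in> F \<and> y \<in> UNIV}"
    then obtain a x y where t: "t = Poly_Mapping.single (free_scale a x, y) 1 - free_scale a (Poly_Mapping.single (x, y) 1)"
      and mem: "x \<in> F" by blast
    have "t \<in> free_on (F \<times> UNIV)" unfolding t using mem by (intro cl) (auto intro: cl)
    moreover have "red (tensor_val t) = 0" unfolding t
      by (simp add: tensor_val_simps tensor_val_single_1 red_scale residue_scale_def lookup_mult_at_zero algebra_simps fun_eq_iff)
    ultimately show "t \<in> ?K" by blast
  next
    fix t assume "t \<in> {Poly_Mapping.single (x, residue_scale a y) 1 - free_scale a (Poly_Mapping.single (x, y) 1) |(a::('x, 'k) mpoly) x (y::'k). x \<in> F \<and> y \<in> UNIV}"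
    then obtain a x y where t: "t = Poly_Mapping.single (x, residue_scale a y) 1 - free_scale a (Poly_Mapping.single (x, y) 1)"
      and mem: "x \<in> F" by blast
    have "t \<in> free_on (F \<times> UNIV)" unfolding t using mem by (intro cl) (auto intro: cl)
    moreover have "red (tensor_val t) = 0" unfolding t
      by (simp add: tensor_val_simps tensor_val_single_1 red_scale residue_scale_def lookup_mult_at_zero algebra_simps fun_eq_iff)
    ultimately show "t \<in> ?K" by blast
  qed
qed

lemma rel_add1: "x \<in> F \<Longrightarrow> x' \<in> F \<Longrightarrow>
    Poly_Mapping.single (x + x', y) 1 - Poly_Mapping.single (x, y) 1 - Poly_Mapping.single (x', y) 1 \<in> N"
  unfolding N tensor_rel_def by (rule free_mod.span_base) blast

lemma rel_add2: "x \<in> F \<Longrightarrow>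
    Poly_Mapping.single (x, y + y') 1 - Poly_Mapping.single (x, y) 1 - Poly_Mapping.single (x, y') 1 \<in> N"
  unfolding N tensor_rel_def by (rule free_mod.span_base) blast

lemma rel_scale1: "x \<in> F \<Longrightarrow>
    Poly_Mapping.single (free_scale a x, y) 1 - free_scale a (Poly_Mapping.single (x, y) 1) \<in> N"
  unfolding N tensor_rel_def by (rule free_mod.span_base) blast

lemma rel_scale2: "x \<in> F \<Longrightarrow>
    Poly_Mapping.single (x, residue_scale a y) 1 - free_scale a (Poly_Mapping.single (x, y) 1) \<in> N"
  unfolding N tensor_rel_def by (rule free_mod.span_base) blast

lemmas N_intros = free_mod.subspace_add[OF submodule_N] free_mod.subspace_diff[OF submodule_N]
  free_mod.subspace_scale[OF submodule_N] free_mod.subspace_neg[OF submodule_N]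

lemma rel_zero1: "Poly_Mapping.single (0, y) 1 \<in> N"
  using N_intros(4)[OF rel_add1[of 0 0 y]] free_mod.subspace_0[OF F_closed] by simp

lemma rel_zero2: "x \<in> F \<Longrightarrow> Poly_Mapping.single (x, 0) 1 \<in> N"
  using N_intros(4)[OF rel_add2[of x 0 0]] by simp

lemma rel_sum:
  assumes "finite T" "\<And>i. i \<in> T \<Longrightarrow> f i \<in> F"
  shows "Poly_Mapping.single (\<Sum>i\<in>T. f i, y) 1 - (\<Sum>i\<in>T. Poly_Mapping.single (f i, y) 1) \<in> N"
  using assms
proof (induction T rule: finite_induct)
  case empty
  thus ?case using rel_zero1 by simp
next
  case (insert i T)
  have "(Poly_Mapping.single (f i + (\<Sum>i\<in>T. f i), y) 1 - Poly_Mapping.single (f i, y) 1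
      - Poly_Mapping.single (\<Sum>i\<in>T. f i, y) 1)
    + (Poly_Mapping.single (\<Sum>i\<in>T. f i, y) 1 - (\<Sum>i\<in>T. Poly_Mapping.single (f i, y) 1)) \<in> N"
    using insert by (intro N_intros(1) rel_add1 free_mod.subspace_sum[OF F_closed]) auto
  thus ?case using insert by (simp add: algebra_simps)
qed

lemma rel_single:
  assumes "f \<in> F"
  shows "Poly_Mapping.single (f, c) r - Poly_Mapping.single (free_scale (r * const c) f, 1) 1 \<in> N"
proof -
  have "residue_scale (const c :: ('x, 'k) mpoly) 1 = c" by (simp add: residue_scale_def)
  hence "Poly_Mapping.single (f, c) 1 - free_scale (const c) (Poly_Mapping.single (f, 1) 1) \<in> N"
    using rel_scale2[OF assms, of "const c" 1] by simp
  hence "free_scale r (Poly_Mapping.single (f, c) 1 - free_scale (const c) (Poly_Mapping.single (f, 1) 1))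
    - (Poly_Mapping.single (free_scale (r * const c) f, 1) 1
        - free_scale (r * const c) (Poly_Mapping.single (f, 1) 1)) \<in> N"
    by (rule N_intros(2)[OF N_intros(3) rel_scale1[OF assms]])
  moreover have "free_scale r (Poly_Mapping.single (f, c) 1) = Poly_Mapping.single (f, c) r"
    by (rule poly_mapping_eqI) (simp add: lookup_free_scale lookup_single when_def)
  ultimately show ?thesis by (simp add: free_mod.scale_right_diff_distrib)
qed

text \<open>
  Modulo the relations, every element of the tensor product is a pure tensor \<open>f \<otimes> 1\<close>.
\<close>

lemma rel_tensor_val:
  assumes "t \<in> free_on (F \<times> UNIV)"
  shows "t - Poly_Mapping.single (tensor_val t, 1) 1 \<in> N"
proof -
  let ?g = "\<lambda>p. free_scale (Poly_Mapping.lookup t p * const (snd p)) (fst p)"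
  have K: "fst p \<in> F" if "p \<in> Poly_Mapping.keys t" for p using assms that by (auto simp: free_on_def)
  have "(\<Sum>p\<in>Poly_Mapping.keys t. Poly_Mapping.single (fst p, snd p) (Poly_Mapping.lookup t p) - Poly_Mapping.single (?g p, 1) 1) \<in> N"
    by (intro free_mod.subspace_sum[OF submodule_N] rel_single K)
  moreover have "Poly_Mapping.single (\<Sum>p\<in>Poly_Mapping.keys t. ?g p, 1) 1 - (\<Sum>p\<in>Poly_Mapping.keys t. Poly_Mapping.single (?g p, 1) 1) \<in> N"
    by (intro rel_sum free_mod.subspace_scale[OF F_closed] K) auto
  ultimately have "(\<Sum>p\<in>Poly_Mapping.keys t. Poly_Mapping.single (fst p, snd p) (Poly_Mapping.lookup t p) - Poly_Mapping.single (?g p, 1) 1)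
    - (Poly_Mapping.single (\<Sum>p\<in>Poly_Mapping.keys t. ?g p, 1) 1 - (\<Sum>p\<in>Poly_Mapping.keys t. Poly_Mapping.single (?g p, 1) 1)) \<in> N"
    by (rule N_intros(2))
  thus ?thesis by (simp add: sum_subtractf tensor_val_def flip: poly_mapping_sum_single)
qed

lemma rel_red_0:
  assumes "f \<in> F" "red f = 0"
  shows "Poly_Mapping.single (f, 1) 1 \<in> N"
proof -
  obtain v where v: "\<And>j. v j \<in> F" "f = (\<Sum>j\<in>UNIV. var j (v j))"
    using red_eq_0_obtain[of f B] assms unfolding F by blast
  have "Poly_Mapping.single (var j (v j), 1) 1 \<in> N" for j
  proof -
    let ?X = "monomial (Poly_Mapping.single j 1) :: ('x, 'k) mpoly"
    have "residue_scale ?X 1 = 0" by (simp add: residue_scale_def lookup_single when_def)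
    hence "Poly_Mapping.single (v j, 0) 1 - free_scale ?X (Poly_Mapping.single (v j, 1) 1) \<in> N"
      using rel_scale2[OF v(1), of j ?X 1] by simp
    hence "(Poly_Mapping.single (free_scale ?X (v j), 1) 1 - free_scale ?X (Poly_Mapping.single (v j, 1) 1))
      - (Poly_Mapping.single (v j, 0) 1 - free_scale ?X (Poly_Mapping.single (v j, 1) 1))
      + Poly_Mapping.single (v j, 0) 1 \<in> N"
      by (rule N_intros(1)[OF N_intros(2)[OF rel_scale1[OF v(1)]] rel_zero2[OF v(1)]])
    thus ?thesis by (simp add: var_def)
  qed
  hence "(\<Sum>j\<in>UNIV. Poly_Mapping.single (var j (v j), 1) 1) \<in> N"
    by (intro free_mod.subspace_sum[OF submodule_N])
  moreover have "Poly_Mapping.single (f, 1) 1 - (\<Sum>j\<in>UNIV. Poly_Mapping.single (var j (v j), 1) 1) \<in> N"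
    unfolding v(2) by (intro rel_sum) (auto simp: var_def intro!: free_mod.subspace_scale[OF F_closed] v)
  ultimately have "(Poly_Mapping.single (f, 1) 1 - (\<Sum>j\<in>UNIV. Poly_Mapping.single (var j (v j), 1) 1))
    + (\<Sum>j\<in>UNIV. Poly_Mapping.single (var j (v j), 1) 1) \<in> N"
    by (rule N_intros(1)[rotated])
  thus ?thesis by simp
qed

lemma tensor_rel_eq: "N = {t \<in> free_on (F \<times> UNIV). red (tensor_val t) = 0}"
proof
  show "{t \<in> free_on (F \<times> UNIV). red (tensor_val t) = 0} \<subseteq> N"
  proof safe
    fix t :: "('b \<Rightarrow>\<^sub>0 ('x, 'k) mpoly) \<times> 'k \<Rightarrow>\<^sub>0 ('x, 'k) mpoly"
    assume t: "t \<in> free_on (F \<times> UNIV)" "red (tensor_val t) = 0"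
    have "(t - Poly_Mapping.single (tensor_val t, 1) 1) + Poly_Mapping.single (tensor_val t, 1) 1 \<in> N"
      using t by (intro N_intros(1) rel_tensor_val rel_red_0 tensor_val_mem F_closed)
    thus "t \<in> N" by simp
  qed
qed (rule tensor_rel_subset)

end

lemmas tensor_rel_residue = tensor_rel_eq[OF refl refl]

lemma tensor_boundaries_eq:
  fixes d :: "nat \<Rightarrow> (nat \<Rightarrow>\<^sub>0 ('x::finite, 'k::field) mpoly) \<Rightarrow> (nat \<Rightarrow>\<^sub>0 ('x, 'k) mpoly)"
  assumes d: "module_hom free_scale free_scale (d i)" and di: "d i ` free_on (B (Suc i)) \<subseteq> free_on (B i)"
  shows "tensor_boundaries B d residue_scale UNIV i = {t \<in> free_on (free_on (B i) \<times> UNIV).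
    \<exists>g\<in>free_on (B (Suc i)). red (tensor_val t) = red (d i g)}"
proof safe
  fix t assume "t \<in> tensor_boundaries B d residue_scale UNIV i"
  then obtain u r where t: "t = tensor_map (d i) u + r" and u: "u \<in> free_on (free_on (B (Suc i)) \<times> UNIV)"
    and r: "r \<in> free_on (free_on (B i) \<times> UNIV)" "red (tensor_val r) = 0"
    by (auto simp: tensor_boundaries_def tensor_rel_residue)
  have "tensor_map (d i) u \<in> free_on (free_on (B i) \<times> UNIV)"
    by (rule tensor_map_mem[OF di u])
  thus "t \<in> free_on (free_on (B i) \<times> UNIV)" unfolding t
    by (intro free_mod.subspace_add[OF submodule_free_on] r)
  have "red (tensor_val t) = red (d i (tensor_val u))"
    unfolding t by (simp add: tensor_val_simps tensor_val_tensor_map[OF d] r)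
  thus "\<exists>g\<in>free_on (B (Suc i)). red (tensor_val t) = red (d i g)"
    using tensor_val_mem[OF submodule_free_on u] by blast
next
  fix t :: "(nat \<Rightarrow>\<^sub>0 ('x, 'k) mpoly) \<times> 'k \<Rightarrow>\<^sub>0 ('x, 'k) mpoly" and g
  assume t: "t \<in> free_on (free_on (B i) \<times> UNIV)" and g: "g \<in> free_on (B (Suc i))"
    and eq: "red (tensor_val t) = red (d i g)"
  let ?u = "Poly_Mapping.single (g, 1) 1 :: (nat \<Rightarrow>\<^sub>0 ('x, 'k) mpoly) \<times> 'k \<Rightarrow>\<^sub>0 ('x, 'k) mpoly"
  have "t - tensor_map (d i) ?u \<in> free_on (free_on (B i) \<times> UNIV)"
    using t g di by (intro free_mod.subspace_diff[OF submodule_free_on]) (auto simp: tensor_map_single intro!: single_free_on)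
  hence "t - tensor_map (d i) ?u \<in> tensor_rel free_scale (free_on (B i)) residue_scale UNIV"
    unfolding tensor_rel_residue
    by (simp add: tensor_val_simps tensor_map_single tensor_val_single_1 eq)
  moreover have "?u \<in> free_on (free_on (B (Suc i)) \<times> UNIV)" using g by (intro single_free_on) auto
  moreover have "t = tensor_map (d i) ?u + (t - tensor_map (d i) ?u)" by simp
  ultimately show "t \<in> tensor_boundaries B d residue_scale UNIV i"
    unfolding tensor_boundaries_def by blast
qed

lemma tensor_cycles_eq:
  fixes d :: "nat \<Rightarrow> (nat \<Rightarrow>\<^sub>0 ('x::finite, 'k::field) mpoly) \<Rightarrow> (nat \<Rightarrow>\<^sub>0 ('x, 'k) mpoly)"
  assumes d: "\<And>i. module_hom free_scale free_scale (d i)" and di: "\<And>i. d i ` free_on (B (Suc i)) \<subseteq> free_on (B i)"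
  shows "tensor_cycles B d residue_scale UNIV i = {t \<in> free_on (free_on (B i) \<times> UNIV).
    i > 0 \<longrightarrow> red (d (i - 1) (tensor_val t)) = 0}"
proof (cases i)
  case 0
  thus ?thesis by simp
next
  case (Suc i')
  show ?thesis
    using tensor_map_mem[OF di[of i']] by (auto simp: Suc tensor_rel_residue tensor_val_tensor_map[OF d])
qed

text \<open>
  \<open>Dm\<close> is the whole resolution \<open>\<dots> \<rightarrow> F\<^sub>1 \<rightarrow> F\<^sub>0 \<rightarrow> M\<close> with the augmentation as \<open>Dm 0\<close>, where \<open>M\<close> is embedded
  into a free module. By dimension shifting, the \<open>i\<close>-th Koszul homology of \<open>M\<close> is \<open>S/mS\<close> for \<open>S = M\<close>
  if \<open>i = 0\<close>, and \<open>(S \<inter> mF\<^bsub>i-1\<^esub>)/mS\<close> for the syzygy module \<open>S = Dm i ` F\<^sub>i\<close> if \<open>i > 0\<close>, where \<open>m\<close> is the ideal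
  generated by the variables. The map \<open>Dm i\<close> identifies the homology of \<open>F \<otimes> k\<close> in degree \<open>i\<close>
  with this quotient.
\<close>

lemma has_qdim_Tor:
  fixes Dm :: "nat \<Rightarrow> (nat \<Rightarrow>\<^sub>0 ('x::finite, 'k::field) mpoly) \<Rightarrow> (nat \<Rightarrow>\<^sub>0 ('x, 'k) mpoly)"
  fixes d
  defines "d \<equiv> \<lambda>i. Dm (Suc i)"
  assumes D: "\<And>j. module_hom free_scale free_scale (Dm j)"
    and exact: "\<And>j. Dm (Suc j) ` free_on (B (Suc j)) = {u \<in> free_on (B j). Dm j u = 0}"
    and n: "has_qdim fam_scale (kcycles (Dm 0 ` free_on (B 0)) i) (kbounds (Dm 0 ` free_on (B 0)) i) n"
  shows "has_qdim (\<lambda>c. free_scale (const c)) (tensor_cycles B d residue_scale UNIV i) (tensor_boundaries B d residue_scale UNIV i) n"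
    and "const_space.subspace (tensor_boundaries B d residue_scale (UNIV :: 'k set) i)"
proof -
  define F where "F j = (free_on (B j) :: (nat \<Rightarrow>\<^sub>0 ('x, 'k) mpoly) set)" for j
  define M where "M = Dm i ` F i"
  have sF: "submodule (F j)" for j by (simp add: F_def submodule_free_on)
  have sM: "submodule M" unfolding M_def by (rule submodule_image[OF D sF])
  \<comment> \<open>The numerator \<open>S\<close>, or \<open>S \<inter> mF\<^bsub>i-1\<^esub>\<close>, as a set of Koszul chains of degree 0.\<close>
  define C where "C = (if i = 0 then kchains M 0 else kcycles M 0 \<inter> kbounds (F (i - 1)) 0)"
  have C: "has_qdim fam_scale C (kbounds M 0) n"
  proof (cases i)
    case 0
    thus ?thesis using n by (simp add: C_def M_def F_def kcycles_0)
  next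
    case (Suc j)
    have "has_qdim fam_scale (kcycles (Dm j ` F j) (Suc 0)) (kbounds (Dm j ` F j) (Suc 0)) n"
      unfolding F_def by (rule has_qdim_iterated_shift[where D = Dm and B = B, OF D exact]) (use n Suc in simp_all)
    from has_qdim_shift[OF D F_def refl refl this]
    show ?thesis using exact[of j] by (simp add: C_def Suc M_def F_def)
  qed
  have d: "module_hom free_scale free_scale (d j)" for j by (simp add: d_def D)
  have di: "d j ` F (Suc j) \<subseteq> F j" for j using exact[of j] by (auto simp: d_def F_def)
  let ?Z = "tensor_cycles B d residue_scale UNIV i" and ?W = "tensor_boundaries B d residue_scale UNIV i"
  note Z = tensor_cycles_eq[where d = d and B = B, OF d di[unfolded F_def], of i, folded F_def]
  note W = tensor_boundaries_eq[where d = d and B = B and i = i, OF d di[unfolded F_def], folded F_def]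
  note fr = free_mod.subspace_0[OF submodule_free_on] free_mod.subspace_add[OF submodule_free_on]
    free_mod.subspace_scale[OF submodule_free_on]
  note dh = module_hom.zero[OF d] module_hom.add[OF d] module_hom.scale[OF d]
  show sW: "const_space.subspace ?W"
    unfolding W
  proof (rule const_space.subspaceI)
    show "0 \<in> {t \<in> free_on (F i \<times> (UNIV :: 'k set)). \<exists>g\<in>F (Suc i). red (tensor_val t) = red (d i g)}"
      using free_mod.subspace_0[OF sF] by (auto simp: fr tensor_val_simps dh intro!: bexI[of _ 0])
  next
    fix t t' assume "t \<in> {t \<in> free_on (F i \<times> (UNIV :: 'k set)). \<exists>g\<in>F (Suc i). red (tensor_val t) = red (d i g)}"
       "t' \<in> {t \<in> free_on (F i \<times> (UNIV :: 'k set)). \<exists>g\<in>F (Suc i). red (tensor_val t) = red (d i g)}"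
    then obtain g g' where "t \<in> free_on (F i \<times> UNIV)" "t' \<in> free_on (F i \<times> UNIV)" "g \<in> F (Suc i)" "g' \<in> F (Suc i)"
      "red (tensor_val t) = red (d i g)" "red (tensor_val t') = red (d i g')" by blast
    thus "t + t' \<in> {t \<in> free_on (F i \<times> UNIV). \<exists>g\<in>F (Suc i). red (tensor_val t) = red (d i g)}"
      by (auto simp: fr tensor_val_simps dh intro!: bexI[of _ "g + g'"] free_mod.subspace_add[OF sF])
  next
    fix c t assume "t \<in> {t \<in> free_on (F i \<times> (UNIV :: 'k set)). \<exists>g\<in>F (Suc i). red (tensor_val t) = red (d i g)}"
    then obtain g where "t \<in> free_on (F i \<times> UNIV)" "g \<in> F (Suc i)" "red (tensor_val t) = red (d i g)" by blast
    thus "free_scale (const c) t \<in> {t \<in> free_on (F i \<times> UNIV). \<exists>g\<in>F (Suc i). red (tensor_val t) = red (d i g)}"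
      by (auto simp: fr tensor_val_simps dh red_scale intro!: bexI[of _ "free_scale (const c) g"] free_mod.subspace_scale[OF sF])
  qed
  have sZ: "const_space.subspace ?Z"
    unfolding Z by (rule const_space.subspaceI) (auto simp: fr tensor_val_simps dh red_scale fun_eq_iff)
  define P where "P w t \<longleftrightarrow> (\<exists>f\<in>F i. w = at_empty (Dm i f) \<and> red (tensor_val t) = red f)" for w :: "'x set \<Rightarrow> _" and t :: "(nat \<Rightarrow>\<^sub>0 ('x, 'k) mpoly) \<times> 'k \<Rightarrow>\<^sub>0 ('x, 'k) mpoly"
  note Dh = module_hom.zero[OF D] module_hom.add[OF D] module_hom.scale[OF D] module_hom.diff[OF D]
  have sC: "fam_space.subspace C" unfolding C_def
    by (auto intro!: fam_space.subspace_inter subspace_kchains subspace_kcycles subspace_kbounds sM sF)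
  have kM: "at_empty (Dm i f) \<in> kchains M 0" if "f \<in> F i" for f
    unfolding kchains_0_iff[OF sM] using that by (auto simp: M_def)
  have C_iff: "at_empty (Dm i f) \<in> C \<longleftrightarrow> (i > 0 \<longrightarrow> red (Dm i f) = 0)" if "f \<in> F i" for f
  proof (cases i)
    case 0
    thus ?thesis using kM[OF that] by (simp add: C_def)
  next
    case (Suc j)
    have "Dm i f \<in> F j" using di[of j] that Suc by (auto simp: d_def)
    thus ?thesis using kM[OF that] at_empty_kbounds_free_on[of "Dm i f" "B j"] Suc
      by (simp add: C_def kcycles_0 F_def)
  qed
  have C_sub: "\<exists>f\<in>F i. w = at_empty (Dm i f)" if "w \<in> C" for w
  proof -
    have "w \<in> kchains M 0" using that by (auto simp: C_def kcycles_0 split: if_splits)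
    thus ?thesis unfolding kchains_0_iff[OF sM] by (auto simp: M_def)
  qed
  have red_cong: "red (Dm j f) = red (Dm j f')" if "red f = red f'" for j f f'
    using red_hom_eq_0[OF D, of "f - f'" j] that by (simp add: Dh)
  show "has_qdim (\<lambda>c. free_scale (const c)) ?Z ?W n"
  proof (rule has_qdim_transport[where P = P and s = fam_scale and Z = C and W = "kbounds M 0" and s' = "\<lambda>c. free_scale (const c)"])
    show "vector_space (fam_scale :: 'k \<Rightarrow> ('x set \<Rightarrow> nat \<Rightarrow>\<^sub>0 ('x, 'k) mpoly) \<Rightarrow> _)" by unfold_locales
    show "vector_space (\<lambda>c :: 'k. free_scale (const c :: ('x, 'k) mpoly) :: ((nat \<Rightarrow>\<^sub>0 ('x, 'k) mpoly) \<times> 'k \<Rightarrow>\<^sub>0 ('x, 'k) mpoly) \<Rightarrow> _)" by unfold_locales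
    show "linear_rel fam_scale (\<lambda>c. free_scale (const c)) P"
      unfolding linear_rel_def
    proof (intro conjI allI impI)
      show "P 0 0" unfolding P_def using free_mod.subspace_0[OF sF]
        by (intro bexI[of _ 0]) (auto simp: Dh tensor_val_simps at_empty_def fun_eq_iff)
    next
      fix x y x' y' assume "P x y" "P x' y'"
      then obtain f f' where "f \<in> F i" "f' \<in> F i" "x = at_empty (Dm i f)" "x' = at_empty (Dm i f')"
        "red (tensor_val y) = red f" "red (tensor_val y') = red f'" by (auto simp: P_def)
      thus "P (x + x') (y + y')" unfolding P_def using free_mod.subspace_add[OF sF]
        by (intro bexI[of _ "f + f'"]) (auto simp: Dh tensor_val_simps at_empty_def fun_eq_iff)
    next
      fix c x y assume "P x y"
      then obtain f where "f \<in> F i" "x = at_empty (Dm i f)" "red (tensor_val y) = red f" by (auto simp: P_def)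
      thus "P (fam_scale c x) (free_scale (const c) y)" unfolding P_def using free_mod.subspace_scale[OF sF]
        by (intro bexI[of _ "free_scale (const c) f"]) (auto simp: Dh tensor_val_simps at_empty_def fun_eq_iff red_scale)
    qed
  next
    show "fam_space.subspace C" by (rule sC)
    show "const_space.subspace ?Z" by (rule sZ)
    show "const_space.subspace ?W" by (rule sW)
    show "has_qdim fam_scale C (kbounds M 0) n" by (rule C)
  next
    fix w assume w: "w \<in> C"
    then obtain f where f: "f \<in> F i" "w = at_empty (Dm i f)" using C_sub by blast
    have "Poly_Mapping.single (f, 1) 1 \<in> ?Z"
      unfolding Z using f w C_iff[OF f(1)] by (auto simp: tensor_val_single_1 d_def intro!: single_free_on)
    thus "\<exists>t\<in>?Z. P w t" using f by (auto simp: P_def tensor_val_single_1 intro!: bexI[of _ "Poly_Mapping.single (f, 1) 1"])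
  next
    fix t assume t: "t \<in> ?Z"
    hence "tensor_val t \<in> F i" unfolding Z by (auto intro: tensor_val_mem[OF sF])
    moreover from this have "at_empty (Dm i (tensor_val t)) \<in> C" using t C_iff unfolding Z by (auto simp: d_def)
    ultimately show "\<exists>w\<in>C. P w t" by (auto simp: P_def)
  next
    fix w t assume w: "w \<in> C" and t: "t \<in> ?Z" and "P w t"
    then obtain f where f: "f \<in> F i" "w = at_empty (Dm i f)" "red (tensor_val t) = red f" by (auto simp: P_def)
    have tF: "t \<in> free_on (F i \<times> UNIV)" using t unfolding Z by auto
    have "w \<in> kbounds M 0 \<longleftrightarrow> (\<exists>g\<in>F (Suc i). red f = red (d i g))"
    proof
      assume "w \<in> kbounds M 0"
      then obtain v where v: "v \<in> kchains M (Suc 0)" "w = kd v" by (auto simp: kbounds_def)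
      then obtain v' where v': "v' \<in> kchains (F i) (Suc 0)" "Dm i \<circ> v' = v"
        unfolding M_def using kchains_lift[of v "Dm i" "F i" "Suc 0"] free_mod.subspace_0[OF sF] Dh(1) by metis
      have "Dm i f = w {}" by (simp add: f at_empty_def)
      also have "\<dots> = Dm i (kd v' {})" using v v' kd_module_hom[OF D, of i v'] by simp
      finally have "Dm i (f - kd v' {}) = 0" by (simp add: Dh)
      moreover have "f - kd v' {} \<in> F i"
        using v' f by (intro free_mod.subspace_diff[OF sF] kd_mem sF) (auto simp: kchains_def)
      ultimately have "f - kd v' {} \<in> d i ` F (Suc i)" unfolding d_def F_def exact by simp
      then obtain g where g: "g \<in> F (Suc i)" "f - kd v' {} = d i g" by (rule imageE)
      have "red f = red (d i g)" by (simp add: red_kd flip: g(2))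
      thus "\<exists>g\<in>F (Suc i). red f = red (d i g)" using g(1) by (rule bexI)
    next
      assume "\<exists>g\<in>F (Suc i). red f = red (d i g)"
      then obtain g where g: "g \<in> F (Suc i)" "red f = red (d i g)" by blast
      have dg: "d i g \<in> F i" "Dm i (d i g) = 0" using exact[of i] g by (auto simp: F_def d_def)
      have "at_empty (f - d i g) \<in> kbounds (F i) 0"
        unfolding F_def using free_mod.subspace_diff[OF sF f(1) dg(1)] g
        by (subst at_empty_kbounds_free_on) (auto simp: F_def)
      then obtain v where v: "v \<in> kchains (F i) (Suc 0)" "at_empty (f - d i g) = kd v" by (auto simp: kbounds_def)
      have "kd (Dm i \<circ> v) = Dm i \<circ> at_empty (f - d i g)" using v kd_module_hom[OF D] by simp
      also have "\<dots> = w" by (auto simp: fun_eq_iff at_empty_def f Dh dg)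
      finally have "w = kd (Dm i \<circ> v)" ..
      moreover have "Dm i \<circ> v \<in> kchains M (Suc 0)" using v by (auto simp: kchains_def M_def Dh)
      ultimately show "w \<in> kbounds M 0" by (auto simp: kbounds_def)
    qed
    thus "w \<in> kbounds M 0 \<longleftrightarrow> t \<in> ?W" unfolding W using f tF by auto
  qed
qed

section \<open>Free resolutions over countable rings\<close>

lemma countable_poly_mapping:
  assumes "countable (UNIV :: 'a set)" "countable (UNIV :: 'b::zero set)"
  shows "countable (UNIV :: ('a \<Rightarrow>\<^sub>0 'b) set)"
proof -
  let ?g = "\<lambda>f :: 'a \<Rightarrow>\<^sub>0 'b. (\<lambda>k. (k, Poly_Mapping.lookup f k)) ` Poly_Mapping.keys f"
  have "countable {A :: ('a \<times> 'b) set. finite A \<and> A \<subseteq> UNIV \<times> UNIV}"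
    by (intro countable_Collect_finite_subset countable_SIGMA assms)
  hence "countable (range ?g)" by (rule countable_subset[rotated]) auto
  moreover have "inj ?g"
  proof (rule injI, rule poly_mapping_eqI)
    fix f g :: "'a \<Rightarrow>\<^sub>0 'b" and k assume eq: "?g f = ?g g"
    have iff: "(k, c) \<in> ?g f \<longleftrightarrow> c = Poly_Mapping.lookup f k \<and> c \<noteq> 0" for f :: "'a \<Rightarrow>\<^sub>0 'b" and c
      by (auto simp: in_keys_iff)
    show "Poly_Mapping.lookup f k = Poly_Mapping.lookup g k" using iff[of _ f] iff[of _ g] eq by metis
  qed
  ultimately show ?thesis using countable_image_inj_on by blast
qed

text \<open>
  The linear map from the free module with basis \<open>\<nat>\<close> that sends the basis to an enumeration of \<open>M\<close>.
\<close>

definition cover :: "('r::comm_ring_1 \<Rightarrow> 'm::ab_group_add \<Rightarrow> 'm) \<Rightarrow> 'm set \<Rightarrow> (nat \<Rightarrow>\<^sub>0 'r) \<Rightarrow> 'm"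
  where "cover s M u = (\<Sum>n\<in>Poly_Mapping.keys u. s (Poly_Mapping.lookup u n) (from_nat_into M n))"

lemma cover_hom:
  assumes "module s"
  shows "module_hom free_scale s (cover s M)"
proof -
  interpret module s by fact
  have sup: "cover s M u = (\<Sum>n\<in>T. s (Poly_Mapping.lookup u n) (from_nat_into M n))"
    if "finite T" "Poly_Mapping.keys u \<subseteq> T" for u T
    unfolding cover_def using that by (intro sum.mono_neutral_left) (auto simp: in_keys_iff)
  show ?thesis
  proof unfold_locales
    fix u v :: "nat \<Rightarrow>\<^sub>0 'a"
    let ?T = "Poly_Mapping.keys u \<union> Poly_Mapping.keys v"
    have "Poly_Mapping.keys (u + v) \<subseteq> ?T" by (rule keys_add)
    thus "cover s M (u + v) = cover s M u + cover s M v"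
      by (simp add: sup[of ?T] lookup_add scale_left_distrib sum.distrib)
  next
    fix r and u :: "nat \<Rightarrow>\<^sub>0 'a"
    have "Poly_Mapping.keys (free_scale r u) \<subseteq> Poly_Mapping.keys u"
      by (auto simp: in_keys_iff lookup_free_scale)
    thus "cover s M (free_scale r u) = s r (cover s M u)"
      by (simp add: sup[of "Poly_Mapping.keys u"] lookup_free_scale scale_sum_right)
  qed
qed

lemma cover_range:
  assumes "module s" "module.subspace s M" "countable M"
  shows "cover s M ` UNIV = M"
proof -
  interpret module s by fact
  have ne: "M \<noteq> {}" using subspace_0[OF assms(2)] by auto
  have "m \<in> range (cover s M)" if "m \<in> M" for m
  proof -
    have "\<exists>n. from_nat_into M n = m" by (rule from_nat_into_surj[OF assms(3) that])
    then obtain n where "from_nat_into M n = m" ..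
    hence "cover s M (Poly_Mapping.single n 1) = m" by (simp add: cover_def)
    thus ?thesis by (metis rangeI)
  qed
  moreover have "cover s M u \<in> M" for u
    unfolding cover_def by (intro subspace_sum[OF assms(2)] subspace_scale[OF assms(2)] from_nat_into ne)
  ultimately show ?thesis by blast
qed

text \<open>
  The successive kernels in the resolution that covers each kernel by \<open>cover\<close>.
\<close>

fun syzygies :: "('r::comm_ring_1 \<Rightarrow> 'm::ab_group_add \<Rightarrow> 'm) \<Rightarrow> 'm set \<Rightarrow> nat \<Rightarrow> (nat \<Rightarrow>\<^sub>0 'r) set"
  where "syzygies s M 0 = {u. cover s M u = 0}"
  | "syzygies s M (Suc i) = {u. cover free_scale (syzygies s M i) u = 0}"

text \<open>
  Since the bases of a resolution are sets of natural numbers, the existence of a resolution is a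
  matter of cardinality. Over a countable ring the elements of a module themselves generate it
  countably, so that no finiteness property of the ring is needed.
\<close>

lemma free_resolution_exists:
  fixes s :: "'r::comm_ring_1 \<Rightarrow> 'm::ab_group_add \<Rightarrow> 'm"
  assumes s: "module s" "module.subspace s M" and count: "countable M" "countable (UNIV :: 'r set)"
  shows "\<exists>B d e. free_resolution s M B d e"
proof -
  have sub: "submodule (syzygies s M i)" for i
    by (cases i) (auto intro!: module_hom.subspace_kernel[OF cover_hom] s module_free_scale)
  have "countable (UNIV :: (nat \<Rightarrow>\<^sub>0 'r) set)" by (intro countable_poly_mapping count) auto
  hence c: "countable (syzygies s M i)" for i by (rule countable_subset[OF subset_UNIV])
  have U: "{u. Poly_Mapping.keys u \<subseteq> UNIV} = UNIV" by simp
  have rng: "cover free_scale (syzygies s M i) ` UNIV = syzygies s M i" for i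
    by (rule cover_range[OF module_free_scale sub c])
  have "free_resolution s M (\<lambda>_. UNIV) (\<lambda>i. cover free_scale (syzygies s M i)) (cover s M)"
    unfolding free_resolution_def free_on_def U rng cover_range[OF s count(1)]
    by (intro conjI allI cover_hom[OF s(1)] cover_hom[OF module_free_scale]) simp_all
  thus ?thesis by blast
qed

interpretation ring_mod: module "(*) :: 'r::comm_ring_1 \<Rightarrow> 'r \<Rightarrow> 'r"
  by unfold_locales (simp_all add: algebra_simps)

lemma subspace_keys_subset:
  assumes "\<And>m d. m \<in> S \<Longrightarrow> m + d \<in> S"
  shows "ring_mod.subspace {f :: ('x, 'k::comm_ring_1) mpoly. Poly_Mapping.keys f \<subseteq> S}"
proof (rule ring_mod.subspaceI)
  fix f g :: "('x, 'k) mpoly"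
  assume f: "f \<in> {f. Poly_Mapping.keys f \<subseteq> S}"
  show "g * f \<in> {f. Poly_Mapping.keys f \<subseteq> S}"
  proof -
    have "d + m \<in> S" if "m \<in> Poly_Mapping.keys f" for m d
      using assms[of m d] f that by (auto simp: add.commute)
    thus ?thesis using keys_mult[of g f] by blast
  qed
next
  fix f g :: "('x, 'k) mpoly"
  assume "f \<in> {f. Poly_Mapping.keys f \<subseteq> S}" "g \<in> {f. Poly_Mapping.keys f \<subseteq> S}"
  thus "f + g \<in> {f. Poly_Mapping.keys f \<subseteq> S}" using keys_add[of f g] by blast
qed simp

text \<open>
  \<open>J\<close> is viewed as a submodule of the free module with basis \<open>{0}\<close>. Countability of the field
  guarantees that the resolution chosen by \<open>Tor\<close> is a resolution.
\<close>

lemma betti_eqI: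
  fixes J :: "('x::finite, 'k::field) mpoly set"
  assumes J: "module.subspace (*) J" and count: "countable (UNIV :: 'k set)"
    and n: "has_qdim fam_scale (kcycles (Poly_Mapping.single 0 ` J) i)
      (kbounds (Poly_Mapping.single (0::nat) ` J :: (nat \<Rightarrow>\<^sub>0 ('x, 'k) mpoly) set) i) n"
  shows "betti i J = n"
proof -
  have cR: "countable (UNIV :: ('x, 'k) mpoly set)"
    by (intro countable_poly_mapping count) auto
  hence "countable J" by (rule countable_subset[OF subset_UNIV])
  from free_resolution_exists[OF ring_mod.module_axioms J this cR]
  have ex: "\<exists>x. (\<lambda>(B, d, e). free_resolution (*) J B d e) x" by auto
  obtain B d e where Bde: "(SOME (B, d, e). free_resolution (*) J B d e) = (B, d, e)"
    by (rule prod_cases3)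
  have res: "free_resolution (*) J B d e" using someI_ex[OF ex] by (simp add: Bde)
  define Dm where "Dm j = (case j of 0 \<Rightarrow> (\<lambda>u. Poly_Mapping.single 0 (e u)) | Suc j \<Rightarrow> d j)" for j
  have e: "module_hom free_scale (*) e" and d: "\<And>j. module_hom free_scale free_scale (d j)"
    and eJ: "e ` free_on (B 0) = J" and d0: "d 0 ` free_on (B (Suc 0)) = {u \<in> free_on (B 0). e u = 0}"
    and dS: "\<And>j. d (Suc j) ` free_on (B (Suc (Suc j))) = {u \<in> free_on (B (Suc j)). d j u = 0}"
    using res unfolding free_resolution_def One_nat_def by blast+
  have "module_hom free_scale free_scale (\<lambda>u. Poly_Mapping.single (0::nat) (e u))"
  proof unfold_locales
    show "Poly_Mapping.single 0 (e (u + v)) = Poly_Mapping.single 0 (e u) + Poly_Mapping.single 0 (e v)" for u v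
      by (simp add: module_hom.add[OF e] single_add)
    show "Poly_Mapping.single (0::nat) (e (free_scale r u)) = free_scale r (Poly_Mapping.single 0 (e u))" for r u
      by (rule poly_mapping_eqI) (simp add: module_hom.scale[OF e] lookup_free_scale lookup_single when_def)
  qed
  hence D: "module_hom free_scale free_scale (Dm j)" for j using d by (cases j) (auto simp: Dm_def)
  have s0: "Poly_Mapping.single (0::nat) f = 0 \<longleftrightarrow> f = 0" for f :: "('x, 'k) mpoly"
    by (metis lookup_single_eq lookup_zero single_zero)
  have exact: "Dm (Suc j) ` free_on (B (Suc j)) = {u \<in> free_on (B j). Dm j u = 0}" for j
    using d0 dS by (cases j) (auto simp: Dm_def s0)
  have im: "Dm 0 ` free_on (B 0) = Poly_Mapping.single 0 ` J"
    unfolding eJ[symmetric] by (auto simp: Dm_def)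
  have dm: "(\<lambda>j. Dm (Suc j)) = d" by (simp add: Dm_def)
  note T = has_qdim_Tor[where Dm = Dm and B = B, OF D exact n[folded im], unfolded dm]
  have "betti i J = quotient_dim (\<lambda>c. free_scale (const c))
      (tensor_cycles B d residue_scale UNIV i) (tensor_boundaries B d residue_scale (UNIV :: 'k set) i)"
    by (simp add: betti_def Tor_def Bde)
  also have "\<dots> = n"
    by (rule quotient_dim_eqI[OF _ T(2) T(1)]) unfold_locales
  finally show ?thesis .
qed

text \<open>
  The total Betti numbers of a monomial ideal as sums of dimensions of simplicial homology.
  \<open>A\<close> is the set of exponents of the monomials of the ideal, and \<open>\<Delta> a\<close> is its
  upper Koszul complex in degree \<open>a\<close>.
\<close>

lemma betti_mon_sub:
  fixes A :: "('x::finite \<Rightarrow>\<^sub>0 nat) set"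
  defines "\<Delta> \<equiv> \<lambda>a. {\<sigma>. \<exists>m\<in>A. a = m + exponent \<sigma>}"
  assumes count: "countable (UNIV :: 'k::field set)"
    and A: "\<And>m d. m \<in> A \<Longrightarrow> m + d \<in> A"
    and E: "finite {a. \<forall>j. \<not> cone_point (\<Delta> a) j}"
  shows "betti i {f :: ('x, 'k) mpoly. Poly_Mapping.keys f \<subseteq> A}
    = (\<Sum>a | \<forall>j. \<not> cone_point (\<Delta> a) j.
        quotient_dim fun_scale (cycles (\<Delta> a) i) (boundaries (\<Delta> a) i :: ('x set \<Rightarrow> 'k) set))"
proof -
  let ?J = "{f :: ('x, 'k) mpoly. Poly_Mapping.keys f \<subseteq> A}"
  let ?A = "{0::nat} \<times> A"
  let ?q = "\<lambda>\<Delta>. quotient_dim fun_scale (cycles \<Delta> i) (boundaries \<Delta> i :: ('x set \<Rightarrow> 'k) set)"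
  define E where "E = {a. \<forall>j. \<not> cone_point (\<Delta> a) j}"
  have up: "up_closed ?A" using A by (auto simp: up_closed_def)
  have kc: "koszul_complex ?A (0, a) = \<Delta> a" for a
    unfolding koszul_complex_def \<Delta>_def by (auto simp: divides_iff)
  have kc': "koszul_complex ?A (b, a) = {}" if "b \<noteq> 0" for a b
    using that by (auto simp: koszul_complex_def)
  have im: "Poly_Mapping.single 0 ` ?J = mon_sub ?A"
  proof safe
    fix f :: "('x, 'k) mpoly" assume "Poly_Mapping.keys f \<subseteq> A"
    thus "Poly_Mapping.single 0 f \<in> mon_sub ?A"
      by (intro mon_subI) (auto simp: coef_def lookup_single when_def in_keys_iff split: if_splits)
  next
    fix f :: "nat \<Rightarrow>\<^sub>0 ('x, 'k) mpoly" assume f: "f \<in> mon_sub ?A"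
    have "f = Poly_Mapping.single 0 (Poly_Mapping.lookup f 0)"
    proof (rule coef_eqI)
      fix b m show "coef f b m = coef (Poly_Mapping.single 0 (Poly_Mapping.lookup f 0)) b m"
        using mon_subD[OF f, of b m] by (auto simp: coef_def lookup_single when_def)
    qed
    moreover have "Poly_Mapping.keys (Poly_Mapping.lookup f 0) \<subseteq> A"
      using mon_subD[OF f, of 0] by (auto simp: coef_def in_keys_iff)
    ultimately show "f \<in> Poly_Mapping.single 0 ` ?J" by blast
  qed
  have "has_qdim fam_scale (kcycles (mon_sub ?A) i)
      (kbounds (mon_sub ?A) i :: ('x set \<Rightarrow> nat \<Rightarrow>\<^sub>0 ('x, 'k) mpoly) set) (\<Sum>i\<in>Pair 0 ` E. ?q (koszul_complex ?A i))"
  proof (rule has_qdim_koszul_mon_sub[OF up])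
    show "finite (Pair 0 ` E)" using E by (simp add: E_def)
  next
    fix ba :: "nat \<times> ('x \<Rightarrow>\<^sub>0 nat)" assume ba: "ba \<notin> Pair 0 ` E"
    obtain b a where eq: "ba = (b, a)" by force
    have "\<exists>j. cone_point (koszul_complex ?A ba) j"
    proof (cases "b = 0")
      case True
      thus ?thesis using ba by (auto simp: eq kc E_def)
    next
      case False
      thus ?thesis by (auto simp: eq kc' cone_point_def)
    qed
    thus "cycles (koszul_complex ?A ba) i \<subseteq> (boundaries (koszul_complex ?A ba) i :: ('x set \<Rightarrow> 'k) set)"
      using cone_cycles_subset_boundaries by blast
  qed
  hence *: "has_qdim fam_scale (kcycles (Poly_Mapping.single 0 ` ?J) i)
      (kbounds (Poly_Mapping.single (0::nat) ` ?J) i) (\<Sum>a\<in>E. ?q (\<Delta> a))"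
    unfolding im by (simp add: sum.reindex inj_on_def kc)
  have "ring_mod.subspace ?J" using A by (rule subspace_keys_subset)
  from betti_eqI[OF this count *] show ?thesis by (simp add: E_def)
qed

section \<open>Counting differences of up-sets in exponent space\<close>

definition supp_in :: "'v set \<Rightarrow> ('v \<Rightarrow> nat) \<Rightarrow> bool"
  where "supp_in V c \<longleftrightarrow> (\<forall>v. v \<notin> V \<longrightarrow> c v = 0)"

definition up_set :: "('v \<Rightarrow> nat) set \<Rightarrow> bool"
  where "up_set P \<longleftrightarrow> (\<forall>c c'. c \<in> P \<longrightarrow> c \<le> c' \<longrightarrow> c' \<in> P)"

abbreviation trunc :: "nat \<Rightarrow> ('v \<Rightarrow> nat) \<Rightarrow> 'v \<Rightarrow> nat"
  where "trunc N c \<equiv> \<lambda>v. min (c v) N"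

lemma finite_bounded_funs: "finite V \<Longrightarrow> finite {c. supp_in V c \<and> (\<forall>v. c v \<le> N)}"
  by (rule finite_subset[OF _ finite_set_of_finite_funs[of V "{..N}" 0]]) (auto simp: supp_in_def)

text \<open>
  Dickson's lemma. Since \<open>trunc N c \<le> c\<close>, it says that all minimal elements of \<open>P\<close> with support in
  \<open>V\<close> have entries at most \<open>N\<close>. In the induction step, the slices of \<open>P\<close> at \<open>c x = t\<close> increase with
  \<open>t\<close> and are constant from some \<open>t0\<close> on.
\<close>

lemma up_set_truncation:
  assumes "finite V" "up_set P"
  shows "\<exists>N. \<forall>c\<in>P. supp_in V c \<longrightarrow> trunc N c \<in> P"
  using assms
proof (induction V arbitrary: P rule: finite_induct)
  case empty
  have "trunc 0 c = c" if "supp_in {} c" for c :: "'a \<Rightarrow> nat" using that by (auto simp: supp_in_def)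
  thus ?case by (intro exI[of _ 0] ballI impI) simp
next
  case (insert x V)
  have upP: "c' \<in> P" if "c \<in> P" "c \<le> c'" for c c' using insert.prems that by (auto simp: up_set_def)
  define Q where "Q t = {c. c(x := t) \<in> P}" for t
  define R where "R = (\<Union>t. Q t)"
  have upQ: "up_set (Q t)" for t
    unfolding up_set_def Q_def by (auto intro: upP simp: le_fun_def)
  hence upR: "up_set R" unfolding R_def up_set_def by blast
  have mono: "c \<in> Q t'" if "c \<in> Q t" "t \<le> t'" for c t t'
    using that unfolding Q_def by (auto intro: upP simp: le_fun_def)
  obtain N where N: "\<And>t c. c \<in> Q t \<Longrightarrow> supp_in V c \<Longrightarrow> trunc (N t) c \<in> Q t"
    using insert.IH[OF upQ] by metis
  obtain NR where NR: "\<And>c. c \<in> R \<Longrightarrow> supp_in V c \<Longrightarrow> trunc NR c \<in> R"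
    using insert.IH[OF upR] by metis
  define T where "T = {c \<in> R. supp_in V c \<and> (\<forall>v. c v \<le> NR)}"
  have finT: "finite T" unfolding T_def by (rule finite_subset[OF _ finite_bounded_funs[OF insert.hyps(1)]]) auto
  have "\<exists>t. c \<in> T \<longrightarrow> c \<in> Q t" for c by (auto simp: T_def R_def)
  then obtain tt where tt: "\<And>c. c \<in> T \<Longrightarrow> c \<in> Q (tt c)" by metis
  \<comment> \<open>The sum serves as an upper bound of all \<open>tt c\<close>.\<close>
  define t0 where "t0 = (\<Sum>c\<in>T. tt c)"
  have t0: "c \<in> Q t0" if "c \<in> T" for c
    using mono[OF tt[OF that]] member_le_sum[of c T tt] that finT by (simp add: t0_def)
  define M where "M = NR + t0 + (\<Sum>t\<le>t0. N t)"
  have "trunc M c \<in> P" if c: "c \<in> P" "supp_in (insert x V) c" for c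
  proof -
    define c' where "c' = c(x := 0)"
    have c': "supp_in V c'" using c insert.hyps by (auto simp: supp_in_def c'_def)
    have cQ: "c' \<in> Q (c x)" using c by (simp add: Q_def c'_def)
    show ?thesis
    proof (cases "c x \<le> t0")
      case True
      have "N (c x) \<le> M" using member_le_sum[of "c x" "{..t0}" N] True by (simp add: M_def)
      moreover have "c x \<le> M" using True by (simp add: M_def)
      moreover have "(trunc (N (c x)) c')(x := c x) \<in> P" using N[OF cQ c'] by (simp add: Q_def)
      moreover from calculation(1,2) have "(trunc (N (c x)) c')(x := c x) \<le> trunc M c"
        by (auto simp: le_fun_def c'_def)
      ultimately show ?thesis by (blast intro: upP)
    next
      case False
      have "trunc NR c' \<in> R" using NR c' cQ by (auto simp: R_def)
      hence "trunc NR c' \<in> T" using c' by (auto simp: T_def supp_in_def)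
      hence "(trunc NR c')(x := t0) \<in> P" using t0 by (simp add: Q_def)
      moreover have "(trunc NR c')(x := t0) \<le> trunc M c" using False by (auto simp: le_fun_def c'_def M_def)
      ultimately show ?thesis by (rule upP)
    qed
  qed
  thus ?case by blast
qed

lemma up_set_trunc_iff:
  assumes "finite V" "up_set P"
  shows "\<exists>N. \<forall>M\<ge>N. \<forall>c. supp_in V c \<longrightarrow> (trunc M c \<in> P \<longleftrightarrow> c \<in> P)"
proof -
  obtain N where N: "\<And>c. c \<in> P \<Longrightarrow> supp_in V c \<Longrightarrow> trunc N c \<in> P" using up_set_truncation[OF assms] by blast
  have "trunc M c \<in> P \<longleftrightarrow> c \<in> P" if "N \<le> M" "supp_in V c" for M c
  proof
    assume "trunc M c \<in> P"
    moreover have "trunc M c \<le> c" by (auto simp: le_fun_def)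
    ultimately show "c \<in> P" using assms(2) by (auto simp: up_set_def)
  next
    assume "c \<in> P"
    hence "trunc N c \<in> P" using N that by blast
    moreover have "trunc N c \<le> trunc M c" using that by (auto simp: le_fun_def)
    ultimately show "trunc M c \<in> P" using assms(2) by (auto simp: up_set_def)
  qed
  thus ?thesis by blast
qed

text \<open>
  \<open>f\<close> agrees with a polynomial at all sufficiently large arguments.
\<close>

definition eventually_poly :: "(nat \<Rightarrow> real) \<Rightarrow> bool"
  where "eventually_poly f \<longleftrightarrow> (\<exists>p h0. \<forall>h\<ge>h0. f h = poly p (real h))"

lemma ev_polyI: "(\<And>h. h \<ge> h0 \<Longrightarrow> f h = poly p (real h)) \<Longrightarrow> eventually_poly f"
  unfolding eventually_poly_def by blast

lemma eventually_poly_cong: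
  assumes "eventually_poly f" "\<And>h. h \<ge> h1 \<Longrightarrow> g h = f h"
  shows "eventually_poly g"
proof -
  obtain p h0 where "\<And>h. h \<ge> h0 \<Longrightarrow> f h = poly p (real h)" using assms(1) unfolding eventually_poly_def by blast
  thus ?thesis using assms(2) by (intro ev_polyI[of "max h0 h1" _ p]) auto
qed

lemma eventually_poly_const: "eventually_poly (\<lambda>_. c)"
  by (rule ev_polyI[of 0 _ "[:c:]"]) simp

lemma eventually_poly_add:
  assumes "eventually_poly f" "eventually_poly g"
  shows "eventually_poly (\<lambda>h. f h + g h)"
proof -
  obtain p h0 where "\<And>h. h \<ge> h0 \<Longrightarrow> f h = poly p (real h)" using assms(1) unfolding eventually_poly_def by blast
  moreover obtain q h1 where "\<And>h. h \<ge> h1 \<Longrightarrow> g h = poly q (real h)" using assms(2) unfolding eventually_poly_def by blast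
  ultimately show ?thesis by (intro ev_polyI[of "max h0 h1" _ "p + q"]) auto
qed

lemma eventually_poly_mult_const:
  assumes "eventually_poly f"
  shows "eventually_poly (\<lambda>h. c * f h)"
proof -
  obtain p h0 where "\<And>h. h \<ge> h0 \<Longrightarrow> f h = poly p (real h)" using assms(1) unfolding eventually_poly_def by blast
  thus ?thesis by (intro ev_polyI[of h0 _ "smult c p"]) auto
qed

lemma eventually_poly_sum: "(\<And>i. i \<in> A \<Longrightarrow> eventually_poly (f i)) \<Longrightarrow> eventually_poly (\<lambda>h. \<Sum>i\<in>A. f i h)"
  by (induction A rule: infinite_finite_induct) (auto intro: eventually_poly_const eventually_poly_add)

lemma eventually_poly_shift:
  assumes "eventually_poly f"
  shows "eventually_poly (\<lambda>h. f (h - d))"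
proof -
  obtain p h0 where "\<And>h. h \<ge> h0 \<Longrightarrow> f h = poly p (real h)" using assms(1) unfolding eventually_poly_def by blast
  thus ?thesis by (intro ev_polyI[of "h0 + d" _ "pcompose p [:- real d, 1:]"]) (auto simp: poly_pcompose of_nat_diff)
qed

lemma eventually_poly_zero_or_nonzero:
  assumes "eventually_poly f"
  shows "\<exists>h0. (\<forall>h\<ge>h0. f h = 0) \<or> (\<forall>h\<ge>h0. f h \<noteq> 0)"
proof -
  obtain p h0 where p: "\<And>h. h \<ge> h0 \<Longrightarrow> f h = poly p (real h)" using assms unfolding eventually_poly_def by blast
  show ?thesis
  proof (cases "p = 0")
    case True
    thus ?thesis using p by auto
  next
    case False
    have "finite (real -` {x. poly p x = 0})"
      by (intro finite_vimageI poly_roots_finite False) (simp add: inj_on_def)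
    then obtain h1 where h1: "\<And>h. poly p (real h) = 0 \<Longrightarrow> h \<le> h1"
      unfolding finite_nat_set_iff_bounded_le by auto
    have "f h \<noteq> 0" if "h \<ge> max h0 (Suc h1)" for h
      using p[of h] h1[of h] that by auto
    thus ?thesis by blast
  qed
qed

lemma list_as_map: "distinct xs \<Longrightarrow> length l = length xs \<Longrightarrow> \<exists>c. map c xs = l"
proof (induction xs arbitrary: l)
  case (Cons x xs)
  then obtain y l' where l: "l = y # l'" by (cases l) auto
  then obtain c where "map c xs = l'" using Cons by auto
  hence "map (c(x := y)) (x # xs) = l" using Cons.prems l by (auto intro!: map_cong)
  thus ?case by blast
qed simp

lemma card_functions_with_sum:
  assumes "finite F" "F \<noteq> {}"
  shows "card {c. supp_in F c \<and> sum c F = m} = (m + (card F - 1)) choose (card F - 1)"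
proof -
  obtain xs where xs: "set xs = F" "distinct xs" using finite_distinct_list[OF assms(1)] by blast
  have len: "length xs = card F" using xs distinct_card by fastforce
  have "bij_betw (\<lambda>c. map c xs) {c. supp_in F c \<and> sum c F = m} {l. size l = card F \<and> sum_list l = m}"
  proof (rule bij_betw_imageI)
    show "inj_on (\<lambda>c. map c xs) {c. supp_in F c \<and> sum c F = m}"
    proof (rule inj_onI, rule ext)
      fix c c' v
      assume c: "c \<in> {c. supp_in F c \<and> sum c F = m}" "c' \<in> {c. supp_in F c \<and> sum c F = m}"
        and eq: "map c xs = map c' xs"
      show "c v = c' v"
      proof (cases "v \<in> F")
        case True
        thus ?thesis using eq xs by auto
      next
        case False
        thus ?thesis using c by (simp add: supp_in_def)
      qed
    qed
    show "(\<lambda>c. map c xs) ` {c. supp_in F c \<and> sum c F = m} = {l. size l = card F \<and> sum_list l = m}"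
    proof (intro equalityI subsetI)
      fix l assume l: "l \<in> {l :: nat list. size l = card F \<and> sum_list l = m}"
      then obtain c where c: "map c xs = l" using list_as_map[OF xs(2)] len by auto
      define c' where "c' v = (if v \<in> F then c v else 0)" for v
      have "map c' xs = l" using c xs by (auto simp: c'_def)
      moreover have "supp_in F c'" by (auto simp: supp_in_def c'_def)
      moreover have "sum c' F = m" using l xs \<open>map c' xs = l\<close> by (metis (mono_tags) mem_Collect_eq sum_list_distinct_conv_sum_set)
      ultimately show "l \<in> (\<lambda>c. map c xs) ` {c. supp_in F c \<and> sum c F = m}" by blast
    qed (auto simp: len xs sum_list_distinct_conv_sum_set)
  qed
  hence "card {c. supp_in F c \<and> sum c F = m} = card {l :: nat list. size l = card F \<and> sum_list l = m}"
    by (rule bij_betw_same_card)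
  also have "\<dots> = (m + card F - 1) choose m" by (rule card_length_sum_list)
  also have "m + card F - 1 = m + (card F - 1)" using assms by (simp add: card_gt_0_iff Suc_leI)
  also have "(m + (card F - 1)) choose m = (m + (card F - 1)) choose (card F - 1)"
    using binomial_symmetric[of m "m + (card F - 1)"] by simp
  finally show ?thesis .
qed

lemma eventually_poly_choose: "eventually_poly (\<lambda>m. real ((m + k) choose k))"
proof (rule ev_polyI[of 0])
  fix m
  have "real ((m + k) choose k) = (real m + real k) gchoose k" by (simp add: binomial_gbinomial)
  also have "\<dots> = (\<Prod>i=0..<k. real m + real k - real i) / fact k" by (simp add: gbinomial_prod_rev)
  also have "\<dots> = poly (smult (1 / fact k) (\<Prod>i=0..<k. [:real k - real i, 1:])) (real m)"
    by (simp add: poly_prod algebra_simps)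
  finally show "real ((m + k) choose k) = poly (smult (1 / fact k) (\<Prod>i=0..<k. [:real k - real i, 1:])) (real m)" .
qed

lemma eventually_poly_card_functions_with_sum:
  assumes "finite F"
  shows "eventually_poly (\<lambda>m. real (card {c. supp_in F c \<and> sum c F = m}))"
proof (cases "F = {}")
  case True
  show ?thesis by (rule eventually_poly_cong[OF eventually_poly_const[of 0], of 1]) (simp add: True)
next
  case False
  show ?thesis unfolding card_functions_with_sum[OF assms False] by (rule eventually_poly_choose)
qed

text \<open>
  The degree of \<open>c\<close> counts only the coordinates in \<open>V'\<close>. Finiteness in each degree forces the
  unbounded directions of \<open>P - Q\<close> to lie in \<open>V'\<close>.
\<close>

theorem eventually_poly_card_difference:
  fixes P Q :: "('v \<Rightarrow> nat) set"
  assumes V: "finite V" and V': "V' \<subseteq> V" and P: "up_set P" and Q: "up_set Q"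
  defines "D \<equiv> \<lambda>h. {c. supp_in V c \<and> c \<in> P \<and> c \<notin> Q \<and> sum c V' = h}"
  assumes fin: "\<And>h. finite (D h)"
  shows "eventually_poly (\<lambda>h. real (card (D h)))"
proof -
  obtain N1 where N1: "\<And>M c. M \<ge> N1 \<Longrightarrow> supp_in V c \<Longrightarrow> trunc M c \<in> P \<longleftrightarrow> c \<in> P"
    using up_set_trunc_iff[OF V P] by blast
  obtain N2 where N2: "\<And>M c. M \<ge> N2 \<Longrightarrow> supp_in V c \<Longrightarrow> trunc M c \<in> Q \<longleftrightarrow> c \<in> Q"
    using up_set_trunc_iff[OF V Q] by blast
  define N where "N = max N1 N2"
  have N: "trunc N c \<in> P \<longleftrightarrow> c \<in> P" "trunc N c \<in> Q \<longleftrightarrow> c \<in> Q" if "supp_in V c" for c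
    using N1[of N c] N2[of N c] that by (auto simp: N_def)
  define Z where "Z = {z. supp_in V z \<and> (\<forall>v. z v \<le> N) \<and> z \<in> P \<and> z \<notin> Q}"
  have finZ: "finite Z" unfolding Z_def by (rule finite_subset[OF _ finite_bounded_funs[OF V, of N]]) auto
  have finV': "finite V'" using V V' finite_subset by blast
  \<comment> \<open>\<open>D h\<close> is the disjoint union of the fibres of truncation at \<open>N\<close> over \<open>Z\<close>. The fibre over \<open>z\<close> is the
    orthant with apex \<open>z\<close> that is unbounded in the coordinates where \<open>z\<close> equals \<open>N\<close>.\<close>
  define K where "K z h = {c. supp_in V c \<and> trunc N c = z \<and> sum c V' = h}" for z h
  have D_eq: "D h = (\<Union>z\<in>Z. K z h)" for h
  proof (intro equalityI subsetI)
    fix c assume c: "c \<in> D h"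
    have "trunc N c \<in> Z" using c N[of c] by (auto simp: Z_def D_def supp_in_def)
    thus "c \<in> (\<Union>z\<in>Z. K z h)" using c by (auto simp: K_def D_def)
  next
    fix c assume "c \<in> (\<Union>z\<in>Z. K z h)"
    thus "c \<in> D h" using N by (auto simp: K_def D_def Z_def)
  qed
  have finK: "finite (K z h)" if "z \<in> Z" for z h
  proof -
    have "K z h \<subseteq> D h" unfolding D_eq using that by blast
    thus ?thesis using fin finite_subset by blast
  qed
  have "eventually_poly (\<lambda>h. real (card (K z h)))" if z: "z \<in> Z" for z
  proof -
    define F where "F = {v \<in> V. z v = N}"
    have finF: "finite F" using V by (simp add: F_def)
    have "F \<subseteq> V'"
    proof (rule ccontr)
      assume "\<not> F \<subseteq> V'"
      then obtain v where v: "v \<in> V" "z v = N" "v \<notin> V'" by (auto simp: F_def)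
      have "z(v := N + n) \<in> K z (sum z V')" for n
      proof -
        have "trunc N (z(v := N + n)) = z" using z v by (auto simp: Z_def fun_eq_iff min_def)
        moreover have "sum (z(v := N + n)) V' = sum z V'" using v by (intro sum.cong) auto
        ultimately show ?thesis using z v by (auto simp: K_def Z_def supp_in_def)
      qed
      hence "range (\<lambda>n. z(v := N + n)) \<subseteq> K z (sum z V')" by blast
      hence "finite (range (\<lambda>n. z(v := N + n)))" using finK[OF z] finite_subset by blast
      moreover have "inj (\<lambda>n. z(v := N + n))" by (rule injI) (metis add_left_cancel fun_upd_same)
      ultimately show False using finite_imageD infinite_UNIV_nat by blast
    qed
    have "card (K z h) = card {e. supp_in F e \<and> sum e F = h - sum z V'}" if h: "h \<ge> sum z V'" for h
    proof -
      have "bij_betw (\<lambda>e v. z v + e v) {e. supp_in F e \<and> sum e F = h - sum z V'} (K z h)"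
      proof (rule bij_betw_imageI)
        show "inj_on (\<lambda>e v. z v + e v) {e. supp_in F e \<and> sum e F = h - sum z V'}"
          by (rule inj_onI) (auto simp: fun_eq_iff)
        have sumF: "sum e V' = sum e F" if "supp_in F e" for e
          using that \<open>F \<subseteq> V'\<close> finV' by (intro sum.mono_neutral_right) (auto simp: supp_in_def)
        show "(\<lambda>e v. z v + e v) ` {e. supp_in F e \<and> sum e F = h - sum z V'} = K z h"
        proof (intro equalityI subsetI)
          fix c assume "c \<in> (\<lambda>e v. z v + e v) ` {e. supp_in F e \<and> sum e F = h - sum z V'}"
          then obtain e where e: "supp_in F e" "sum e F = h - sum z V'" "c = (\<lambda>v. z v + e v)" by blast
          have "supp_in V c" using e z by (auto simp: supp_in_def F_def Z_def)
          moreover have "trunc N c = z"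
          proof
            fix v show "min (c v) N = z v"
              using e z by (cases "v \<in> F") (auto simp: F_def supp_in_def Z_def min_def)
          qed
          moreover have "sum c V' = h" using e h by (simp add: sum.distrib sumF)
          ultimately show "c \<in> K z h" by (simp add: K_def)
        next
          fix c assume c: "c \<in> K z h"
          define e where "e v = c v - z v" for v
          have le: "z v \<le> c v" for v using c by (auto simp: K_def)
          have "supp_in F e"
            unfolding supp_in_def
          proof (intro allI impI)
            fix v assume "v \<notin> F"
            hence "v \<notin> V \<or> z v \<noteq> N" by (auto simp: F_def)
            thus "e v = 0" using c by (auto simp: e_def K_def supp_in_def min_def split: if_splits)
          qed
          moreover have c_eq: "c = (\<lambda>v. z v + e v)" using le by (auto simp: e_def)
          moreover have "sum e F = h - sum z V'"
          proof -
            have "sum c V' = sum z V' + sum e V'" by (subst c_eq) (rule sum.distrib)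
            moreover have "sum c V' = h" using c by (simp add: K_def)
            ultimately show ?thesis using sumF[OF \<open>supp_in F e\<close>] by linarith
          qed
          ultimately show "c \<in> (\<lambda>e v. z v + e v) ` {e. supp_in F e \<and> sum e F = h - sum z V'}" by blast
        qed
      qed
      thus ?thesis by (simp add: bij_betw_same_card)
    qed
    thus ?thesis
      by (intro eventually_poly_cong[OF eventually_poly_shift[OF eventually_poly_card_functions_with_sum[OF finF], of "sum z V'"], of "sum z V'"]) simp
  qed
  moreover have "real (card (D h)) = (\<Sum>z\<in>Z. real (card (K z h)))" for h
    unfolding D_eq using finK by (subst card_UN_disjoint[OF finZ]) (auto simp: K_def)
  ultimately show ?thesis by (simp add: eventually_poly_sum)
qed

section \<open>Powers of monomial ideals\<close>

text \<open>
  The exponents of the monomials in the ideal generated by the monomials with exponents in \<open>A\<close>.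
\<close>

definition multiples :: "('x \<Rightarrow>\<^sub>0 nat) set \<Rightarrow> ('x \<Rightarrow>\<^sub>0 nat) set"
  where "multiples A = {a + d | a d. a \<in> A}"

lemma multiplesI: "a \<in> A \<Longrightarrow> a + d \<in> multiples A"
  unfolding multiples_def by blast

lemma multiples_base: "a \<in> A \<Longrightarrow> a \<in> multiples A"
  using multiplesI[of a A 0] by simp

lemma multiples_up:
  assumes "m \<in> multiples A" shows "m + d \<in> multiples A"
proof -
  obtain a d' where "m = a + d'" "a \<in> A" using assms by (auto simp: multiples_def)
  thus ?thesis using multiplesI[of a A "d' + d"] by (simp add: add.assoc)
qed

text \<open>
  The exponents of the monomials in the \<open>h\<close>-th power of that ideal, with the whole ring for \<open>h = 0\<close>.
\<close>

fun mon_power :: "('x \<Rightarrow>\<^sub>0 nat) set \<Rightarrow> nat \<Rightarrow> ('x \<Rightarrow>\<^sub>0 nat) set"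
  where "mon_power A 0 = UNIV"
  | "mon_power A (Suc h) = {a + b | a b. a \<in> A \<and> b \<in> mon_power A h}"

lemma mon_power_up: "m \<in> mon_power A h \<Longrightarrow> m + d \<in> mon_power A h"
proof (induction h arbitrary: m)
  case (Suc h)
  then obtain a b where "m = a + b" "a \<in> A" "b \<in> mon_power A h" by auto
  moreover from this have "b + d \<in> mon_power A h" using Suc.IH by blast
  ultimately show ?case by (auto simp: add.assoc)
qed simp

lemma keys_subset_span:
  fixes f :: "('x, 'k::comm_ring_1) mpoly"
  assumes "\<And>m. m \<in> Poly_Mapping.keys f \<Longrightarrow> monomial m \<in> ideal_generated X"
  shows "f \<in> ideal_generated X"
proof -
  have "const (Poly_Mapping.lookup f m) * monomial m \<in> ideal_generated X" if "m \<in> Poly_Mapping.keys f" for m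
    using assms[OF that] by (rule ring_mod.span_scale)
  hence "(\<Sum>m\<in>Poly_Mapping.keys f. const (Poly_Mapping.lookup f m) * monomial m) \<in> ideal_generated X"
    by (rule ring_mod.span_sum)
  thus ?thesis by (simp add: mult_single flip: poly_mapping_sum_single)
qed

lemma ideal_generated_monomials:
  "ideal_generated (monomial ` A) = {f :: ('x, 'k::comm_ring_1) mpoly. Poly_Mapping.keys f \<subseteq> multiples A}"
proof
  show "ideal_generated (monomial ` A) \<subseteq> {f :: ('x, 'k) mpoly. Poly_Mapping.keys f \<subseteq> multiples A}"
    by (intro ring_mod.span_minimal subspace_keys_subset multiples_up) (auto simp: multiples_base)
next
  show "{f :: ('x, 'k) mpoly. Poly_Mapping.keys f \<subseteq> multiples A} \<subseteq> ideal_generated (monomial ` A)"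
  proof
    fix f :: "('x, 'k) mpoly" assume f: "f \<in> {f. Poly_Mapping.keys f \<subseteq> multiples A}"
    show "f \<in> ideal_generated (monomial ` A)"
    proof (rule keys_subset_span)
      fix m assume "m \<in> Poly_Mapping.keys f"
      then obtain a d where a: "a \<in> A" "m = a + d" using f by (auto simp: multiples_def)
      have "monomial d * monomial a \<in> ideal_generated (monomial ` A)"
        using a by (intro ring_mod.span_scale ring_mod.span_base) auto
      thus "monomial m \<in> ideal_generated (monomial ` A :: ('x, 'k) mpoly set)" by (simp add: mult_single a add.commute)
    qed
  qed
qed

lemma ideal_power_monomials:
  "ideal_power {f :: ('x, 'k::comm_ring_1) mpoly. Poly_Mapping.keys f \<subseteq> multiples A} h
    = {f. Poly_Mapping.keys f \<subseteq> mon_power A h}"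
proof (induction h)
  case (Suc h)
  let ?I = "{f :: ('x, 'k) mpoly. Poly_Mapping.keys f \<subseteq> multiples A}"
  let ?J = "{f :: ('x, 'k) mpoly. Poly_Mapping.keys f \<subseteq> mon_power A h}"
  let ?X = "{f * g | f g. f \<in> ?I \<and> g \<in> ?J}"
  have "ideal_generated ?X = {f. Poly_Mapping.keys f \<subseteq> mon_power A (Suc h)}"
  proof
    have "s + t \<in> mon_power A (Suc h)" if "s \<in> multiples A" "t \<in> mon_power A h" for s t
    proof -
      obtain a d where "s = a + d" "a \<in> A" using \<open>s \<in> multiples A\<close> by (auto simp: multiples_def)
      moreover have "t + d \<in> mon_power A h" using that(2) by (rule mon_power_up)
      moreover have "s + t = a + (t + d)" using \<open>s = a + d\<close> by (simp add: ac_simps)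
      ultimately show ?thesis by auto
    qed
    hence "Poly_Mapping.keys (f * g) \<subseteq> mon_power A (Suc h)" if "f \<in> ?I" "g \<in> ?J" for f g
      using that keys_mult[of f g] by blast
    thus "ideal_generated ?X \<subseteq> {f. Poly_Mapping.keys f \<subseteq> mon_power A (Suc h)}"
      by (intro ring_mod.span_minimal subspace_keys_subset mon_power_up) blast+
  next
    show "{f. Poly_Mapping.keys f \<subseteq> mon_power A (Suc h)} \<subseteq> ideal_generated ?X"
    proof
      fix f :: "('x, 'k) mpoly" assume f: "f \<in> {f. Poly_Mapping.keys f \<subseteq> mon_power A (Suc h)}"
      show "f \<in> ideal_generated ?X"
      proof (rule keys_subset_span)
        fix m assume "m \<in> Poly_Mapping.keys f"
        then obtain a b where m: "m = a + b" "a \<in> A" "b \<in> mon_power A h" using f by auto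
        have "a \<in> multiples A" using m by (simp add: multiples_base)
        hence "monomial a \<in> ?I" "monomial b \<in> ?J" using m by auto
        hence "monomial a * monomial b \<in> ?X" by blast
        hence "monomial a * monomial b \<in> ideal_generated ?X" by (rule ring_mod.span_base)
        thus "monomial m \<in> ideal_generated ?X" by (simp add: mult_single m)
      qed
    qed
  qed
  thus ?case by (simp only: ideal_power.simps Suc)
qed simp

lemma multiples_minimal:
  fixes S :: "('x::finite \<Rightarrow>\<^sub>0 nat) set"
  assumes up: "\<And>m d. m \<in> S \<Longrightarrow> m + d \<in> S"
  shows "multiples {m \<in> S. \<forall>m'\<in>S. divides m' m \<longrightarrow> m' = m} = S"
proof
  show "multiples {m \<in> S. \<forall>m'\<in>S. divides m' m \<longrightarrow> m' = m} \<subseteq> S" using up by (auto simp: multiples_def)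
next
  let ?deg = "\<lambda>m :: 'x \<Rightarrow>\<^sub>0 nat. \<Sum>x\<in>UNIV. Poly_Mapping.lookup m x"
  show "S \<subseteq> multiples {m \<in> S. \<forall>m'\<in>S. divides m' m \<longrightarrow> m' = m}"
  proof
    fix s assume s: "s \<in> S"
    define m where "m = arg_min ?deg (\<lambda>m. m \<in> S \<and> divides m s)"
    have "s \<in> S \<and> divides s s" using s by (simp add: divides_def)
    note arg = arg_min_nat_lemma[where P = "\<lambda>m. m \<in> S \<and> divides m s", OF this, of ?deg, folded m_def]
    have "m' = m" if m': "m' \<in> S" "divides m' m" for m'
    proof -
      obtain d where d: "m = d + m'" using m' divides_iff by blast
      have "divides m' s" using m' arg by (auto simp: divides_def intro: order_trans)
      hence "?deg m \<le> ?deg m'" using arg m' by blast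
      hence "(\<Sum>x\<in>UNIV. Poly_Mapping.lookup d x) = 0" by (simp add: d lookup_add sum.distrib)
      hence "d = 0" by (intro poly_mapping_eqI) simp
      thus ?thesis using d by simp
    qed
    hence "m \<in> {m \<in> S. \<forall>m'\<in>S. divides m' m \<longrightarrow> m' = m}" using arg by auto
    moreover obtain d where "s = m + d" using arg divides_iff by (metis add.commute)
    ultimately show "s \<in> multiples {m \<in> S. \<forall>m'\<in>S. divides m' m \<longrightarrow> m' = m}"
      by (simp only: multiplesI)
  qed
qed

text \<open>
  The minimal generators of a monomial ideal over \<open>'a\<close> generate over \<open>'k\<close> the ideal with the same
  monomials.
\<close>

lemma ideal_generated_minimal_generators:
  fixes S :: "('x::finite \<Rightarrow>\<^sub>0 nat) set"
  assumes up: "\<And>m d. m \<in> S \<Longrightarrow> m + d \<in> S"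
  shows "ideal_generated (monomial ` minimal_generators {f :: ('x, 'a::field) mpoly. Poly_Mapping.keys f \<subseteq> S})
    = {f :: ('x, 'k::field) mpoly. Poly_Mapping.keys f \<subseteq> S}"
proof -
  have "minimal_generators {f :: ('x, 'a::field) mpoly. Poly_Mapping.keys f \<subseteq> S}
      = {m \<in> S. \<forall>m'\<in>S. divides m' m \<longrightarrow> m' = m}"
    by (auto simp: minimal_generators_def divides_def)
  thus ?thesis by (simp add: ideal_generated_monomials multiples_minimal[OF up])
qed

lemma lookup_Abs_finite [simp]: "Poly_Mapping.lookup (Abs_poly_mapping f) = f" for f :: "'x::finite \<Rightarrow> nat"
  by (rule lookup_Abs_poly_mapping) simp

lemma finite_bounded_exponents: "finite {a :: 'x::finite \<Rightarrow>\<^sub>0 nat. \<forall>x. Poly_Mapping.lookup a x \<le> N}"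
proof -
  have "finite {c. supp_in UNIV c \<and> (\<forall>x :: 'x. c x \<le> N)}" by (rule finite_bounded_funs) simp
  moreover have "Poly_Mapping.lookup ` {a :: 'x \<Rightarrow>\<^sub>0 nat. \<forall>x. Poly_Mapping.lookup a x \<le> N}
      \<subseteq> {c. supp_in UNIV c \<and> (\<forall>x. c x \<le> N)}"
    by (auto simp: supp_in_def)
  ultimately have "finite (Poly_Mapping.lookup ` {a :: 'x \<Rightarrow>\<^sub>0 nat. \<forall>x. Poly_Mapping.lookup a x \<le> N})"
    by (rule finite_subset[rotated])
  thus ?thesis by (rule finite_imageD) (auto intro!: inj_onI poly_mapping_eqI)
qed

text \<open>
  A monomial ideal is finitely generated, by Dickson's lemma.
\<close>

lemma finite_generators:
  fixes A :: "('x::finite \<Rightarrow>\<^sub>0 nat) set"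
  obtains G where "finite G" "multiples G = multiples A"
proof -
  define P where "P = {c. Abs_poly_mapping c \<in> multiples A}"
  have "up_set P"
    unfolding up_set_def
  proof (intro allI impI)
    fix c c' assume c: "c \<in> P" "c \<le> c'"
    have "Abs_poly_mapping c' = Abs_poly_mapping c + Abs_poly_mapping (\<lambda>x. c' x - c x)"
      using c by (intro poly_mapping_eqI) (auto simp: lookup_add le_fun_def)
    thus "c' \<in> P" using c multiples_up by (simp add: P_def)
  qed
  then obtain N where N: "\<And>c. c \<in> P \<Longrightarrow> trunc N c \<in> P"
    using up_set_truncation[of UNIV P] by (auto simp: supp_in_def)
  define G where "G = {a \<in> multiples A. \<forall>x. Poly_Mapping.lookup a x \<le> N}"
  have "finite G" unfolding G_def by (rule finite_subset[OF _ finite_bounded_exponents]) auto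
  moreover have "multiples G = multiples A"
  proof
    show "multiples G \<subseteq> multiples A"
    proof
      fix m assume "m \<in> multiples G"
      then obtain g d where "m = g + d" "g \<in> G" unfolding multiples_def by blast
      thus "m \<in> multiples A" using multiples_up[of g A d] by (simp add: G_def)
    qed
    show "multiples A \<subseteq> multiples G"
    proof
      fix a assume a: "a \<in> multiples A"
      let ?b = "Abs_poly_mapping (trunc N (Poly_Mapping.lookup a))"
      have "Poly_Mapping.lookup a \<in> P" using a by (simp add: P_def Poly_Mapping.lookup_inverse)
      hence "?b \<in> G" using N by (auto simp: P_def G_def)
      moreover have "a = ?b + (a - ?b)"
        by (intro poly_mapping_eqI) (auto simp: lookup_add lookup_minus)
      ultimately show "a \<in> multiples G" unfolding multiples_def by blast
    qed
  qed
  ultimately show thesis by (rule that)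
qed

definition unit_vec :: "'v \<Rightarrow> 'v \<Rightarrow> nat" where "unit_vec v = (\<lambda>w. if w = v then 1 else 0)"

context
  fixes G :: "('x::finite \<Rightarrow>\<^sub>0 nat) set"
begin

text \<open>
  For a finite set \<open>G\<close> of generators, a function \<open>c\<close> on \<open>rep_vars\<close> represents a product of variables
  (summand \<open>Inl\<close>) and generators (summand \<open>Inr\<close>). Its value \<open>rep_val c\<close> is the exponent of
  this product, and its degree \<open>rep_deg c\<close> is the number of generators.
\<close>

definition rep_vars :: "('x + ('x \<Rightarrow>\<^sub>0 nat)) set" where "rep_vars = UNIV <+> G"

definition rep_val :: "('x + ('x \<Rightarrow>\<^sub>0 nat) \<Rightarrow> nat) \<Rightarrow> ('x \<Rightarrow>\<^sub>0 nat)"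
  where "rep_val c = Abs_poly_mapping (\<lambda>x. c (Inl x) + (\<Sum>g\<in>G. c (Inr g) * Poly_Mapping.lookup g x))"

definition rep_deg :: "('x + ('x \<Rightarrow>\<^sub>0 nat) \<Rightarrow> nat) \<Rightarrow> nat"
  where "rep_deg c = sum c (Inr ` G)"

text \<open>
  The upper Koszul complex of the \<open>h\<close>-th power in degree \<open>a\<close>.
\<close>

definition deg_complex :: "nat \<Rightarrow> ('x \<Rightarrow>\<^sub>0 nat) \<Rightarrow> 'x set set"
  where "deg_complex h a = {\<sigma>. \<exists>m\<in>mon_power G h. a = m + exponent \<sigma>}"

text \<open>
  An additive code in a type with a translation invariant linear order, injective on functions with
  support in \<open>rep_vars\<close>. It turns this order into a monomial order on representations.
\<close>

definition rep_code :: "('x + ('x \<Rightarrow>\<^sub>0 nat) \<Rightarrow> nat) \<Rightarrow> (nat \<Rightarrow>\<^sub>0 nat)"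
  where "rep_code c = (\<Sum>v\<in>rep_vars. Poly_Mapping.single (to_nat_on rep_vars v) (c v))"

text \<open>
  The representations that are not the least ones of the same value and degree. Translation
  invariance of the order makes this set closed under addition of arbitrary functions.
\<close>

definition non_least :: "('x + ('x \<Rightarrow>\<^sub>0 nat) \<Rightarrow> nat) set"
  where "non_least = {c. \<exists>c'. rep_val c' = rep_val c \<and> rep_deg c' = rep_deg c \<and> rep_code c' < rep_code c}"

context
  assumes finG: "finite G"
begin

lemma rep_deg_alt: "rep_deg c = (\<Sum>g\<in>G. c (Inr g))"
  by (simp add: rep_deg_def sum.reindex)

lemma finite_rep_vars: "finite rep_vars"
  by (simp add: rep_vars_def finG)

lemma lookup_rep_val: "Poly_Mapping.lookup (rep_val c) x = c (Inl x) + (\<Sum>g\<in>G. c (Inr g) * Poly_Mapping.lookup g x)"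
  by (simp add: rep_val_def)

lemma rep_add: "rep_val (c + e) = rep_val c + rep_val e" "rep_deg (c + e) = rep_deg c + rep_deg e"
  by (auto intro!: poly_mapping_eqI simp: lookup_rep_val lookup_add sum.distrib algebra_simps rep_deg_def)

lemma rep_unit:
  "rep_val (unit_vec (Inl x)) = Poly_Mapping.single x 1" "rep_deg (unit_vec (Inl x)) = 0"
  "g \<in> G \<Longrightarrow> rep_val (unit_vec (Inr g)) = g" "g \<in> G \<Longrightarrow> rep_deg (unit_vec (Inr g)) = 1"
proof -
  have *: "(\<Sum>g'\<in>G. unit_vec (Inr g) (Inr g') * f g') = f g" if "g \<in> G" for g and f :: "_ \<Rightarrow> nat"
  proof -
    have "(\<Sum>g'\<in>G. unit_vec (Inr g) (Inr g') * f g') = (\<Sum>g'\<in>G. if g' = g then f g' else 0)"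
      by (intro sum.cong) (auto simp: unit_vec_def)
    thus ?thesis using finG that by simp
  qed
  show "rep_val (unit_vec (Inl x)) = Poly_Mapping.single x 1"
    by (rule poly_mapping_eqI) (auto simp: lookup_rep_val unit_vec_def lookup_single when_def)
  show "rep_deg (unit_vec (Inl x)) = 0" by (simp add: rep_deg_alt unit_vec_def)
  show "rep_val (unit_vec (Inr g)) = g" if "g \<in> G"
    by (rule poly_mapping_eqI) (simp add: lookup_rep_val *[OF that], simp add: unit_vec_def)
  show "rep_deg (unit_vec (Inr g)) = 1" if "g \<in> G"
    using *[OF that, of "\<lambda>_. 1"] by (simp add: rep_deg_alt)
qed

lemma rep_split:
  assumes "c v > 0"
  obtains c' where "c = unit_vec v + c'"
  using assms by (intro that[of "c(v := c v - 1)"]) (auto simp: fun_eq_iff unit_vec_def)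

lemma rep_restrict:
  "rep_val (\<lambda>v. if v \<in> rep_vars then c v else 0) = rep_val c"
  "rep_deg (\<lambda>v. if v \<in> rep_vars then c v else 0) = rep_deg c"
  "supp_in rep_vars (\<lambda>v. if v \<in> rep_vars then c v else 0)"
  by (auto intro!: poly_mapping_eqI sum.cong simp: lookup_rep_val rep_vars_def rep_deg_alt supp_in_def)

lemma mon_power_iff_rep: "m \<in> mon_power G h \<longleftrightarrow> (\<exists>c. rep_val c = m \<and> rep_deg c = h)"
proof
  show "m \<in> mon_power G h \<Longrightarrow> \<exists>c. rep_val c = m \<and> rep_deg c = h"
  proof (induction h arbitrary: m)
    case 0
    let ?c = "case_sum (Poly_Mapping.lookup m) (\<lambda>_. 0)"
    have "rep_val ?c = m" by (rule poly_mapping_eqI) (simp add: lookup_rep_val)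
    moreover have "rep_deg ?c = 0" by (simp add: rep_deg_alt)
    ultimately show ?case by blast
  next
    case (Suc h)
    then obtain g b where g: "m = g + b" "g \<in> G" "b \<in> mon_power G h" by auto
    then obtain c where c: "rep_val c = b" "rep_deg c = h" using Suc.IH by blast
    have "rep_val (unit_vec (Inr g) + c) = m" "rep_deg (unit_vec (Inr g) + c) = Suc h"
      using g c by (simp_all add: rep_add rep_unit)
    thus ?case by blast
  qed
  show "\<exists>c. rep_val c = m \<and> rep_deg c = h \<Longrightarrow> m \<in> mon_power G h"
  proof (induction h arbitrary: m)
    case (Suc h)
    then obtain c where c: "rep_val c = m" "rep_deg c = Suc h" by blast
    have "\<exists>g\<in>G. c (Inr g) > 0"
    proof (rule ccontr)
      assume "\<not> ?thesis"
      hence "rep_deg c = 0" by (simp add: rep_deg_alt)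
      thus False using c by simp
    qed
    then obtain g where g: "g \<in> G" "c (Inr g) > 0" by blast
    then obtain c' where c': "c = unit_vec (Inr g) + c'" using rep_split[of c "Inr g"] by metis
    have "m = g + rep_val c'" "rep_deg c' = h" using c c' g by (simp_all add: rep_add rep_unit)
    thus ?case using Suc.IH g by auto
  qed simp
qed

lemma deg_complex_add:
  assumes "\<sigma> \<in> deg_complex h a"
  shows "\<sigma> \<in> deg_complex (h + rep_deg e) (a + rep_val e)"
proof -
  obtain c where c: "a = rep_val c + exponent \<sigma>" "rep_deg c = h"
    using assms by (auto simp: deg_complex_def mon_power_iff_rep)
  have "rep_val (c + e) \<in> mon_power G (h + rep_deg e)"
    unfolding mon_power_iff_rep using c by (intro exI[of _ "c + e"]) (simp add: rep_add)
  moreover have "a + rep_val e = rep_val (c + e) + exponent \<sigma>" by (simp add: c rep_add ac_simps)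
  ultimately show ?thesis by (auto simp: deg_complex_def)
qed

lemma rep_code_add: "rep_code (c + e) = rep_code c + rep_code e"
  by (simp add: rep_code_def single_add sum.distrib)

lemma rep_code_restrict: "rep_code (\<lambda>v. if v \<in> rep_vars then c v else 0) = rep_code c"
  by (auto simp: rep_code_def intro!: sum.cong)

lemma rep_code_inj:
  assumes "supp_in rep_vars c" "supp_in rep_vars c'" "rep_code c = rep_code c'"
  shows "c = c'"
proof
  fix v
  have l: "Poly_Mapping.lookup (rep_code c) (to_nat_on rep_vars v) = c v" if "v \<in> rep_vars" for c
  proof -
    have "to_nat_on rep_vars w = to_nat_on rep_vars v \<longleftrightarrow> w = v" if "w \<in> rep_vars" for w
      using that \<open>v \<in> rep_vars\<close> countable_finite[OF finite_rep_vars] by simp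
    hence "Poly_Mapping.lookup (rep_code c) (to_nat_on rep_vars v) = (\<Sum>w\<in>rep_vars. if w = v then c w else 0)"
      unfolding rep_code_def lookup_sum by (intro sum.cong) (auto simp: lookup_single when_def)
    thus ?thesis using that finite_rep_vars by simp
  qed
  show "c v = c' v" using l[of c] l[of c'] assms by (cases "v \<in> rep_vars") (auto simp: supp_in_def)
qed

lemma least_rep_exists:
  assumes "a \<in> mon_power G h"
  obtains c where "supp_in rep_vars c" "rep_val c = a" "rep_deg c = h" "c \<notin> non_least"
proof -
  let ?S = "{c. supp_in rep_vars c \<and> rep_val c = a \<and> rep_deg c = h}"
  let ?N = "h + (\<Sum>x\<in>UNIV. Poly_Mapping.lookup a x)"
  have "c v \<le> ?N" if "c \<in> ?S" for c v
  proof (cases v)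
    case (Inl x)
    have "c v \<le> Poly_Mapping.lookup a x" using that by (auto simp: lookup_rep_val Inl)
    also have "\<dots> \<le> (\<Sum>x\<in>UNIV. Poly_Mapping.lookup a x)" by (rule member_le_sum) auto
    finally show ?thesis by simp
  next
    case (Inr g)
    show ?thesis
    proof (cases "g \<in> G")
      case True
      hence "c v \<le> rep_deg c" using member_le_sum[of g G "\<lambda>g. c (Inr g)"] finG by (simp add: rep_deg_alt Inr)
      thus ?thesis using that by simp
    next
      case False
      thus ?thesis using that by (auto simp: supp_in_def rep_vars_def Inr)
    qed
  qed
  hence "finite ?S" by (intro finite_subset[OF _ finite_bounded_funs[OF finite_rep_vars, of ?N]]) auto
  moreover have "?S \<noteq> {}"
  proof -
    obtain c where "rep_val c = a" "rep_deg c = h" using assms by (auto simp: mon_power_iff_rep)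
    hence "(\<lambda>v. if v \<in> rep_vars then c v else 0) \<in> ?S" using rep_restrict[of c] by simp
    thus ?thesis by blast
  qed
  ultimately have "\<exists>c. is_arg_min rep_code (\<lambda>c. c \<in> ?S) c" by (rule ex_is_arg_min_if_finite)
  hence "\<exists>c. c \<in> ?S \<and> (\<forall>c'. c' \<in> ?S \<longrightarrow> rep_code c \<le> rep_code c')"
    by (simp only: is_arg_min_linorder)
  then obtain c where c: "c \<in> ?S" "\<And>c'. c' \<in> ?S \<Longrightarrow> rep_code c \<le> rep_code c'" by blast
  have "c \<notin> non_least"
  proof
    assume "c \<in> non_least"
    then obtain c' where c': "rep_val c' = rep_val c" "rep_deg c' = rep_deg c" "rep_code c' < rep_code c"
      by (auto simp: non_least_def)
    have "(\<lambda>v. if v \<in> rep_vars then c' v else 0) \<in> ?S" using c c' rep_restrict[of c'] by simp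
    from c(2)[OF this] show False using c' by (simp add: rep_code_restrict)
  qed
  thus thesis using c that by blast
qed

lemma least_rep_unique:
  assumes "supp_in rep_vars c" "supp_in rep_vars c'" "rep_val c = rep_val c'" "rep_deg c = rep_deg c'"
    "c \<notin> non_least" "c' \<notin> non_least"
  shows "c = c'"
proof -
  have "\<not> rep_code c' < rep_code c" "\<not> rep_code c < rep_code c'"
    using assms(3-6) by (auto simp: non_least_def)
  hence "rep_code c = rep_code c'" by (metis linorder_neqE)
  thus ?thesis using rep_code_inj assms by blast
qed

text \<open>
  A degree \<open>a\<close> with \<open>deg_complex G h a = \<Delta>\<close> lies in \<open>mon_power G h\<close> because \<open>\<Delta>\<close> is non-empty, and so
  it has exactly one least representation. These representations form a difference of two up-sets.
\<close>

theorem eventually_poly_card_deg_complex: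
  assumes "\<Delta> \<noteq> {}" and fin: "\<And>h. finite {a. deg_complex h a = \<Delta>}"
  shows "eventually_poly (\<lambda>h. real (card {a. deg_complex h a = \<Delta>}))"
proof -
  define P where "P = {c. \<Delta> \<subseteq> deg_complex (rep_deg c) (rep_val c)}"
  define Q where "Q = {c. \<not> deg_complex (rep_deg c) (rep_val c) \<subseteq> \<Delta>} \<union> non_least"
  define D where "D h = {c. supp_in rep_vars c \<and> c \<in> P \<and> c \<notin> Q \<and> sum c (Inr ` G) = h}" for h
  have upI: "up_set X" if "\<And>c e. c \<in> X \<Longrightarrow> c + e \<in> X" for X :: "('x + ('x \<Rightarrow>\<^sub>0 nat) \<Rightarrow> nat) set"
    unfolding up_set_def
  proof (intro allI impI)
    fix c c' assume c: "c \<in> X" "c \<le> c'"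
    have "c' = c + (\<lambda>v. c' v - c v)" using c by (auto simp: fun_eq_iff le_fun_def)
    thus "c' \<in> X" using that[OF c(1)] by metis
  qed
  have upP: "up_set P"
    by (rule upI) (auto simp: P_def rep_add intro: deg_complex_add)
  have upQ: "up_set Q"
  proof (rule upI)
    fix c e assume "c \<in> Q"
    then consider "\<not> deg_complex (rep_deg c) (rep_val c) \<subseteq> \<Delta>" | "c \<in> non_least" by (auto simp: Q_def)
    thus "c + e \<in> Q"
    proof cases
      case 1
      thus ?thesis by (auto simp: Q_def rep_add intro: deg_complex_add)
    next
      case 2
      then obtain c' where "rep_val c' = rep_val c" "rep_deg c' = rep_deg c" "rep_code c' < rep_code c"
        by (auto simp: non_least_def)
      hence "rep_val (c' + e) = rep_val (c + e) \<and> rep_deg (c' + e) = rep_deg (c + e) \<and> rep_code (c' + e) < rep_code (c + e)"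
        by (simp add: rep_add rep_code_add)
      thus ?thesis unfolding Q_def non_least_def by blast
    qed
  qed
  have D: "c \<in> D h \<longleftrightarrow> supp_in rep_vars c \<and> c \<notin> non_least \<and> rep_deg c = h \<and> deg_complex h (rep_val c) = \<Delta>" for c h
    by (auto simp: D_def P_def Q_def rep_deg_def)
  have bij: "bij_betw rep_val (D h) {a. deg_complex h a = \<Delta>}" for h
  proof (rule bij_betw_imageI)
    show "inj_on rep_val (D h)" by (rule inj_onI) (auto simp: D intro: least_rep_unique)
    show "rep_val ` D h = {a. deg_complex h a = \<Delta>}"
    proof (intro equalityI subsetI)
      fix a assume a: "a \<in> {a. deg_complex h a = \<Delta>}"
      then obtain \<sigma> where "\<sigma> \<in> deg_complex h a" using assms(1) by blast
      then obtain m where "m \<in> mon_power G h" "a = m + exponent \<sigma>" by (auto simp: deg_complex_def)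
      hence "a \<in> mon_power G h" by (simp add: mon_power_up)
      from least_rep_exists[OF this] obtain c where c: "supp_in rep_vars c" "rep_val c = a" "rep_deg c = h" "c \<notin> non_least" .
      hence "c \<in> D h" using a by (simp add: D)
      thus "a \<in> rep_val ` D h" using c by blast
    qed (auto simp: D)
  qed
  have "finite (D h)" for h using bij_betw_finite[OF bij] fin by blast
  hence "eventually_poly (\<lambda>h. real (card (D h)))"
    using eventually_poly_card_difference[of rep_vars "Inr ` G" P Q] finite_rep_vars upP upQ
    unfolding D_def by (auto simp: rep_vars_def)
  moreover have "card (D h) = card {a. deg_complex h a = \<Delta>}" for h using bij_betw_same_card[OF bij] .
  ultimately show ?thesis by simp
qed

text \<open>
  If the exponent of the variable \<open>j\<close> in \<open>a\<close> exceeds its exponent in every product of \<open>h\<close> generators,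
  then \<open>j\<close> is a cone point.
\<close>

lemma finite_non_cone: "finite {a. \<forall>j. \<not> cone_point (deg_complex h a) j}"
proof -
  define N where "N = (\<Sum>g\<in>G. \<Sum>x\<in>UNIV. h * Poly_Mapping.lookup g x)"
  have "cone_point (deg_complex h a) j" if big: "Poly_Mapping.lookup a j > N" for a j
    unfolding cone_point_def
  proof
    fix \<sigma> assume \<sigma>: "\<sigma> \<in> deg_complex h a"
    show "insert j \<sigma> \<in> deg_complex h a"
    proof (cases "j \<in> \<sigma>")
      case True
      thus ?thesis using \<sigma> by (simp add: insert_absorb)
    next
      case False
      obtain c where c: "a = rep_val c + exponent \<sigma>" "rep_deg c = h"
        using \<sigma> by (auto simp: deg_complex_def mon_power_iff_rep)
      have "(\<Sum>g\<in>G. c (Inr g) * Poly_Mapping.lookup g j) \<le> N"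
        unfolding N_def
      proof (rule sum_mono)
        fix g assume "g \<in> G"
        hence "c (Inr g) \<le> h" using member_le_sum[of g G "\<lambda>g. c (Inr g)"] finG c by (simp add: rep_deg_alt)
        hence "c (Inr g) * Poly_Mapping.lookup g j \<le> h * Poly_Mapping.lookup g j" by simp
        also have "\<dots> \<le> (\<Sum>x\<in>UNIV. h * Poly_Mapping.lookup g x)"
          by (rule member_le_sum[of j UNIV "\<lambda>x. h * Poly_Mapping.lookup g x"]) auto
        finally show "c (Inr g) * Poly_Mapping.lookup g j \<le> (\<Sum>x\<in>UNIV. h * Poly_Mapping.lookup g x)" .
      qed
      moreover have "Poly_Mapping.lookup a j = c (Inl j) + (\<Sum>g\<in>G. c (Inr g) * Poly_Mapping.lookup g j)"
        using False by (simp add: c lookup_add lookup_exponent lookup_rep_val)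
      ultimately have "c (Inl j) > 0" using big by simp
      then obtain c' where c': "c = unit_vec (Inl j) + c'" using rep_split[of c "Inl j"] by metis
      have "rep_val c' \<in> mon_power G h" using c c' by (auto simp: mon_power_iff_rep rep_add rep_unit)
      moreover have "a = rep_val c' + exponent (insert j \<sigma>)"
        using False by (simp add: c c' rep_add rep_unit exponent_insert ac_simps)
      ultimately show ?thesis by (auto simp: deg_complex_def)
    qed
  qed
  hence "{a. \<forall>j. \<not> cone_point (deg_complex h a) j} \<subseteq> {a. \<forall>x. Poly_Mapping.lookup a x \<le> N}"
    by (auto simp: not_less[symmetric])
  thus ?thesis using finite_bounded_exponents finite_subset by blast
qed

end

end

section \<open>Betti numbers of powers are eventually polynomial\<close>

text \<open>
  In each summand the field enters only through the first factor, and the power only through the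
  second.
\<close>

lemma betti_over_power:
  fixes G :: "('x::finite \<Rightarrow>\<^sub>0 nat) set"
  assumes G: "finite G" and count: "countable (UNIV :: 'k::field set)"
  shows "betti_over TYPE('k) i {f :: ('x, 'a::field) mpoly. Poly_Mapping.keys f \<subseteq> mon_power G h}
    = (\<Sum>\<Delta> | \<forall>j. \<not> cone_point \<Delta> j.
        quotient_dim fun_scale (cycles \<Delta> i) (boundaries \<Delta> i :: ('x set \<Rightarrow> 'k) set)
          * card {a. deg_complex G h a = \<Delta>})"
proof -
  let ?q = "\<lambda>\<Delta>. quotient_dim fun_scale (cycles \<Delta> i) (boundaries \<Delta> i :: ('x set \<Rightarrow> 'k) set)"
  let ?E = "{a. \<forall>j. \<not> cone_point (deg_complex G h a) j}"
  have "betti_over TYPE('k) i {f :: ('x, 'a) mpoly. Poly_Mapping.keys f \<subseteq> mon_power G h}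
      = betti i {f :: ('x, 'k) mpoly. Poly_Mapping.keys f \<subseteq> mon_power G h}"
    unfolding betti_over_def by (subst ideal_generated_minimal_generators) (auto intro: mon_power_up)
  also have "\<dots> = (\<Sum>a\<in>?E. ?q (deg_complex G h a))"
    using betti_mon_sub[OF count mon_power_up, of G h i] finite_non_cone[OF G, of h]
    by (simp add: deg_complex_def)
  also have "\<dots> = (\<Sum>\<Delta>\<in>{\<Delta>. \<forall>j. \<not> cone_point \<Delta> j}. \<Sum>a\<in>{a \<in> ?E. deg_complex G h a = \<Delta>}. ?q (deg_complex G h a))"
    by (rule sum.group[symmetric]) (use finite_non_cone[OF G, of h] in auto)
  also have "\<dots> = (\<Sum>\<Delta>\<in>{\<Delta>. \<forall>j. \<not> cone_point \<Delta> j}. ?q \<Delta> * card {a. deg_complex G h a = \<Delta>})"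
  proof (rule sum.cong)
    fix \<Delta> :: "'x set set" assume "\<Delta> \<in> {\<Delta>. \<forall>j. \<not> cone_point \<Delta> j}"
    hence "{a \<in> ?E. deg_complex G h a = \<Delta>} = {a. deg_complex G h a = \<Delta>}" by auto
    thus "(\<Sum>a\<in>{a \<in> ?E. deg_complex G h a = \<Delta>}. ?q (deg_complex G h a)) = ?q \<Delta> * card {a. deg_complex G h a = \<Delta>}"
      by simp
  qed simp
  finally show ?thesis .
qed

theorem eventually_poly_betti_over_power:
  fixes G :: "('x::finite \<Rightarrow>\<^sub>0 nat) set"
  assumes G: "finite G" and count: "countable (UNIV :: 'k::field set)"
  shows "eventually_poly (\<lambda>h. real (betti_over TYPE('k) i {f :: ('x, 'a::field) mpoly. Poly_Mapping.keys f \<subseteq> mon_power G h}))"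
proof -
  have "eventually_poly (\<lambda>h. real (card {a. deg_complex G h a = \<Delta>}))" if "\<forall>j. \<not> cone_point \<Delta> j" for \<Delta>
  proof (rule eventually_poly_card_deg_complex[OF G])
    show "\<Delta> \<noteq> {}" using that by (auto simp: cone_point_def)
    show "finite {a. deg_complex G h a = \<Delta>}" for h
      by (rule finite_subset[OF _ finite_non_cone[OF G, of h]]) (use that in auto)
  qed
  thus ?thesis
    unfolding betti_over_power[OF G count] of_nat_sum of_nat_mult
    by (intro eventually_poly_sum eventually_poly_mult_const) auto
qed

theorem proposition3p1:
  fixes I :: "('x::finite, 'a::field) mpoly set" and p :: nat
  assumes "monomial_ideal I"
    and "prime p"
    and "CARD('zp::field) = p"
  shows "\<forall>i::nat. \<exists>h\<^sub>i\<ge>1.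
    (\<forall>h\<ge>h\<^sub>i. betti_over TYPE('zp) i (ideal_power I h) = betti_over TYPE(rat) i (ideal_power I h)) \<or>
    (\<forall>h\<ge>h\<^sub>i. betti_over TYPE('zp) i (ideal_power I h) \<noteq> betti_over TYPE(rat) i (ideal_power I h))"
proof
  fix i :: nat
  obtain A where A: "I = ideal_generated (monomial ` A)" using assms(1) by (auto simp: monomial_ideal_def)
  obtain G where G: "finite G" "multiples G = multiples A" by (rule finite_generators)
  have pow: "ideal_power I h = {f. Poly_Mapping.keys f \<subseteq> mon_power G h}" for h
    unfolding A ideal_generated_monomials G(2)[symmetric] by (rule ideal_power_monomials)
  have "CARD('zp) > 0" using assms(2,3) prime_gt_0_nat by simp
  hence zp: "countable (UNIV :: 'zp set)" by (intro countable_finite card_ge_0_finite)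
  have q: "countable (UNIV :: rat set)" by simp
  have "eventually_poly (\<lambda>h. real (betti_over TYPE('zp) i (ideal_power I h)) + - 1 * real (betti_over TYPE(rat) i (ideal_power I h)))"
    unfolding pow by (intro eventually_poly_add eventually_poly_mult_const eventually_poly_betti_over_power G zp q)
  from eventually_poly_zero_or_nonzero[OF this] obtain h0 where
    "(\<forall>h\<ge>h0. betti_over TYPE('zp) i (ideal_power I h) = betti_over TYPE(rat) i (ideal_power I h)) \<or>
     (\<forall>h\<ge>h0. betti_over TYPE('zp) i (ideal_power I h) \<noteq> betti_over TYPE(rat) i (ideal_power I h))"
    by auto
  thus "\<exists>h\<^sub>i\<ge>1.
    (\<forall>h\<ge>h\<^sub>i. betti_over TYPE('zp) i (ideal_power I h) = betti_over TYPE(rat) i (ideal_power I h)) \<or>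
    (\<forall>h\<ge>h\<^sub>i. betti_over TYPE('zp) i (ideal_power I h) \<noteq> betti_over TYPE(rat) i (ideal_power I h))"
    by (intro exI[of _ "max 1 h0"]) auto
qed

end
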